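(* Let $1\le d\le 3$, assume [H2] and [H3] (see context), and let $A_\varepsilon=(P(\mathbf x,\mathbf D)+q_\varepsilon)^{-1}$ and $A=P(\mathbf x,\mathbf D)^{-1}=\mathcal G$ be the (compact, self-adjoint) solution operators on $L^2(D)$ of the perturbed and unperturbed problems. Let $\lambda_n\ne0$, $Au_n=\lambda_nu_n$ with $\|u_n\|=1$ and $u_n$ continuous (sufficiently smooth), and let $A_\varepsilon u_n^\varepsilon=\lambda_n^\varepsilon u_n^\varepsilon$, $\|u_n^\varepsilon\|=1$, be labelled so that $\mathbb E\{|\lambda_n-\lambda_n^\varepsilon|^2\}+\mathbb E\{\|u_n^\varepsilon-u_n\|^2\}\lesssim\varepsilon^d$. Then, as $\varepsilon\to0$, $$\frac{\lambda_n^\varepsilon-\lambda_n}{\varepsilon^{d/2}}\ \longrightarrow\ -\lambda_n\sigma\int_{D^2}u_n(\mathbf x)G(\mathbf x,\mathbf y)u_n(\mathbf y)\,dW_{\mathbf y}\,d\mathbf x=-\lambda_n^2\sigma\int_Du_n^2(\mathbf y)\,dW_{\mathbf y}\qquad\text{in distribution},$$ or equivalently, for the eigenvalues of $P+q_\varepsilon$ and $P$, $$\frac{(\lambda_n^\varepsilon)^{-1}-\lambda_n^{-1}}{\varepsilon^{d/2}}\ \longrightarrow\ \sigma\int_Du_n^2(\mathbf y)\,dW_{\mathbf y}\qquad\text{in distribution},$$ where $dW_{\mathbf y}$ is standard white noise and $\sigma\ge0$, $\sigma^2=\int_{\mathbb R^d}\mathbb E\{q(\mathbf 0)q(\mathbf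 y)\}\,d\mathbf y$.
   Context: $\alpha\lesssim\beta$ means $\alpha\le C\beta$ with $C$ independent of $\varepsilon$. $D\subset\mathbb R^d$ is a bounded open set with sufficiently smooth boundary; $\|\cdot\|$ denotes the $L^2(D)$ norm or the operator norm on $\mathcal L(L^2(D))$. $P(\mathbf x,\mathbf D)$ is a deterministic self-adjoint elliptic pseudo-differential operator such that $Pu=f$ in $D$, $u=0$ on $\partial D$, has a unique solution $u(\mathbf x)=\mathcal G f(\mathbf x)=\int_D G(\mathbf x,\mathbf y)f(\mathbf y)\,d\mathbf y$, where $G$ is real-valued, non-negative, symmetric, and $\sup_{\mathbf x\in D}\int_D |G|^{2+\eta}(\mathbf x,\mathbf y)\,d\mathbf y<\infty$ for some $\eta>0$. Random field: $q(\mathbf x,\omega)$, $\mathbf x\in\mathbb R^d$, is a real, mean-zero, strictly stationary process on a probability space $(\Omega,\mathcal F,\mathbb P)$, with integrable correlation function $R(\mathbf x)=\mathbb E\{q(\mathbf y)q(\mathbf y+\mathbf x)\}$. [H2]: $\mathbb E\{q^6\}<\infty$ and $q$ is strongly mixing: there is a bounded decreasing function $\varphi:[0,\infty)\to[0,\infty)$ with $r^{d-1}\varphi^{1/2}(r)$ integrable on $\mathbb R^+$ such that for all Borel sets $A',B'\subset\mathbb R^d$ at Euclidean distance $d(A',B')$ and all real square-integrable random variables $\zeta,\xi$ measurable with respect to the $\sigma$-algebras generated by $q$ restricted to $A'$ and $B'$ respectively, $$\big|\mathbb E\{(\zeta-\mathbb E\zeta)(\xi-\mathbb E\xi)\}\big|\le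 \varphi(2\,d(A',B'))\,(\mathbb E\{\zeta^2\}\mathbb E\{\xi^2\})^{1/2}.$$ Modified potential: $\tilde q_\varepsilon(\mathbf x,\omega)=q(\mathbf x/\varepsilon,\omega)$; fix $0<\rho<1$, let $\Omega_\varepsilon=\{\omega:\|\mathcal G\tilde q_\varepsilon\mathcal G\tilde q_\varepsilon\|>\rho\}$, and set $q_\varepsilon=\tilde q_\varepsilon$ on $\Omega\setminus\Omega_\varepsilon$, $q_\varepsilon=0$ on $\Omega_\varepsilon$ (potentials act as multiplication operators). $A_\varepsilon f$ denotes the solution $u_\varepsilon$ of $u_\varepsilon=\mathcal G f-\mathcal Gq_\varepsilon\mathcal Gf+\mathcal Gq_\varepsilon\mathcal Gq_\varepsilon u_\varepsilon$, which is uniquely solvable $\mathbb P$-a.s. [H3]: $\lim_{\varepsilon\to0}\mathbb E\big\{\chi_{\Omega_\varepsilon}(\omega)\,\|\varepsilon^{-d/2}q(\cdot/\varepsilon,\omega)\|\big\}=0$. *)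

theory Defs
  imports "HOL-Probability.Probability"
begin

section \<open>Real $L^2(D)$\<close>

abbreviation lborel_on :: "'a::euclidean_space set \<Rightarrow> 'a measure" where
  "lborel_on D \<equiv> restrict_space lborel D"

text \<open>Elements of $L^2(D)$ are represented by Borel functions; only their values on \<open>D\<close> matter, and
  equations between them are stated almost everywhere on \<open>D\<close>.\<close>

definition L2 :: "'a::euclidean_space set \<Rightarrow> ('a \<Rightarrow> real) set" where
  "L2 D = {f \<in> borel_measurable (lborel_on D). integrable (lborel_on D) (\<lambda>x. (f x)\<^sup>2)}"

definition L2_inner :: "'a::euclidean_space set \<Rightarrow> ('a \<Rightarrow> real) \<Rightarrow> ('a \<Rightarrow> real) \<Rightarrow> real" where
  "L2_inner D f g = (LINT x|lborel_on D. f x * g x)"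

definition L2_norm :: "'a::euclidean_space set \<Rightarrow> ('a \<Rightarrow> real) \<Rightarrow> real" where
  "L2_norm D f = sqrt (LINT x|lborel_on D. (f x)\<^sup>2)"

text \<open>The operator norm is \<open>\<infinity>\<close> if \<open>T\<close> is not a bounded operator on $L^2(D)$.\<close>

definition L2_opnorm :: "'a::euclidean_space set \<Rightarrow> (('a \<Rightarrow> real) \<Rightarrow> 'a \<Rightarrow> real) \<Rightarrow> ennreal" where
  "L2_opnorm D T = Inf {ennreal c | c. 0 \<le> c \<and>
     (\<forall>f\<in>L2 D. T f \<in> L2 D \<and> L2_norm D (T f) \<le> c * L2_norm D f)}"


section \<open>The unperturbed problem\<close>

text \<open>A boundary that is locally a regular level set of a $C^1$ function. This is the weakest
  reading of ``sufficiently smooth''.\<close>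

definition smooth_boundary :: "'a::euclidean_space set \<Rightarrow> bool" where
  "smooth_boundary D \<longleftrightarrow> (\<forall>p\<in>frontier D. \<exists>U g g'. open U \<and> p \<in> U \<and>
     (\<forall>x\<in>U. (g has_derivative (\<lambda>h. g' x \<bullet> h)) (at x) \<and> g' x \<noteq> 0) \<and>
     continuous_on U g' \<and> D \<inter> U = {x\<in>U. g x < (0::real)})"

primrec iter_deriv ::
  "'a::real_normed_vector list \<Rightarrow> ('a \<Rightarrow> 'b::real_normed_vector) \<Rightarrow> 'a \<Rightarrow> 'b" where
  "iter_deriv [] f = f"
| "iter_deriv (v # vs) f = (\<lambda>x. frechet_derivative (iter_deriv vs f) (at x) v)"

definition infinitely_differentiable_on ::
  "'a::real_normed_vector set \<Rightarrow> ('a \<Rightarrow> 'b::real_normed_vector) \<Rightarrow> bool" where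
  "infinitely_differentiable_on S f \<longleftrightarrow> (\<forall>vs. \<forall>x\<in>S. iter_deriv vs f differentiable at x)"

text \<open>The symbol class $S^m(D \times \mathbf{R}^d)$, with estimates locally uniform in \<open>D\<close>.\<close>

definition symbol_class :: "(real^'d) set \<Rightarrow> real \<Rightarrow> (((real^'d) \<times> (real^'d)) \<Rightarrow> complex) set" where
  "symbol_class D m = {a. infinitely_differentiable_on (D \<times> UNIV) a \<and>
     (\<forall>K \<alpha> \<beta>. compact K \<and> K \<subseteq> D \<longrightarrow> (\<exists>C. \<forall>x\<in>K. \<forall>\<xi>.
        norm (iter_deriv (map (\<lambda>i. (axis i 1, 0)) \<alpha> @ map (\<lambda>j. (0, axis j 1)) \<beta>) a (x, \<xi>))
          \<le> C * (1 + norm \<xi>) powr (m - real (length \<beta>))))}"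

definition elliptic_symbol ::
  "(real^'d) set \<Rightarrow> real \<Rightarrow> (((real^'d) \<times> (real^'d)) \<Rightarrow> complex) \<Rightarrow> bool" where
  "elliptic_symbol D m a \<longleftrightarrow> a \<in> symbol_class D m \<and>
     (\<forall>K. compact K \<and> K \<subseteq> D \<longrightarrow> (\<exists>c>0. \<exists>r>0. \<forall>x\<in>K. \<forall>\<xi>. r \<le> norm \<xi> \<longrightarrow>
        c * norm \<xi> powr m \<le> norm (a (x, \<xi>))))"

definition fourier :: "(real^'d \<Rightarrow> real) \<Rightarrow> real^'d \<Rightarrow> complex" where
  "fourier \<phi> \<xi> = (LINT y|lborel. cis (- (\<xi> \<bullet> y)) * complex_of_real (\<phi> y))"

definition pseudo_diff ::
  "(((real^'d) \<times> (real^'d)) \<Rightarrow> complex) \<Rightarrow> (real^'d \<Rightarrow> real) \<Rightarrow> real^'d \<Rightarrow> complex" where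
  "pseudo_diff a \<phi> x = complex_of_real (1 / (2 * pi) ^ CARD('d)) *
     (LINT \<xi>|lborel. cis (x \<bullet> \<xi>) * a (x, \<xi>) * fourier \<phi> \<xi>)"

definition test_functions :: "'a::euclidean_space set \<Rightarrow> ('a \<Rightarrow> real) set" where
  "test_functions D = {\<phi>. infinitely_differentiable_on UNIV \<phi> \<and>
     (\<exists>K. compact K \<and> K \<subseteq> D \<and> (\<forall>x. x \<notin> K \<longrightarrow> \<phi> x = 0))}"

text \<open>Operators are given by a domain \<open>Dom\<close> and their action \<open>P\<close>. The equivalence below says that the
  graphs of the operator and of its adjoint coincide; it implies that \<open>Dom\<close> is a dense subspace and
  that \<open>P\<close> is linear (up to null sets).\<close>

definition self_adjoint_on ::
  "'a::euclidean_space set \<Rightarrow> ('a \<Rightarrow> real) set \<Rightarrow> (('a \<Rightarrow> real) \<Rightarrow> 'a \<Rightarrow> real) \<Rightarrow> bool" where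
  "self_adjoint_on D Dom P \<longleftrightarrow> (\<forall>u\<in>Dom. u \<in> L2 D \<and> P u \<in> L2 D) \<and>
     (\<forall>v\<in>L2 D. \<forall>w\<in>L2 D. (v \<in> Dom \<and> (AE x in lborel_on D. P v x = w x)) \<longleftrightarrow>
        (\<forall>u\<in>Dom. L2_inner D (P u) v = L2_inner D u w))"

definition vanishes_on_boundary :: "'a::euclidean_space set \<Rightarrow> ('a \<Rightarrow> real) \<Rightarrow> bool" where
  "vanishes_on_boundary D u \<longleftrightarrow> (\<exists>v. (AE x in lborel_on D. u x = v x) \<and>
     (\<forall>p\<in>frontier D. (v \<longlongrightarrow> 0) (at p within D)))"

text \<open>A self-adjoint realization on $L^2(D)$, with the condition \<open>u = 0\<close> on the boundary built into
  the domain, of the pseudo-differential operator with elliptic symbol \<open>a\<close> of order \<open>m\<close>.\<close>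

definition elliptic_dirichlet_operator ::
  "(real^'d) set \<Rightarrow> real \<Rightarrow> (((real^'d) \<times> (real^'d)) \<Rightarrow> complex) \<Rightarrow> (real^'d \<Rightarrow> real) set \<Rightarrow>
     ((real^'d \<Rightarrow> real) \<Rightarrow> real^'d \<Rightarrow> real) \<Rightarrow> bool" where
  "elliptic_dirichlet_operator D m a Dom P \<longleftrightarrow>
     elliptic_symbol D m a \<and> self_adjoint_on D Dom P \<and>
     (\<forall>u\<in>Dom. vanishes_on_boundary D u) \<and>
     (\<forall>\<phi>\<in>test_functions D. \<phi> \<in> Dom \<and>
        (AE x in lborel_on D. complex_of_real (P \<phi> x) = pseudo_diff a \<phi> x))"

definition green_op ::
  "'a::euclidean_space set \<Rightarrow> ('a \<Rightarrow> 'a \<Rightarrow> real) \<Rightarrow> ('a \<Rightarrow> real) \<Rightarrow> 'a \<Rightarrow> real" where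
  "green_op D G f x = (LINT y|lborel_on D. G x y * f y)"

text \<open>\<open>u = green_op D G f\<close> is the unique solution of \<open>P u = f\<close> in \<open>Dom\<close>.\<close>

definition solution_operator ::
  "'a::euclidean_space set \<Rightarrow> ('a \<Rightarrow> real) set \<Rightarrow> (('a \<Rightarrow> real) \<Rightarrow> 'a \<Rightarrow> real) \<Rightarrow>
     ('a \<Rightarrow> 'a \<Rightarrow> real) \<Rightarrow> bool" where
  "solution_operator D Dom P G \<longleftrightarrow> (\<forall>f\<in>L2 D.
     green_op D G f \<in> Dom \<and> (AE x in lborel_on D. P (green_op D G f) x = f x) \<and>
     (\<forall>u\<in>Dom. (AE x in lborel_on D. P u x = f x) \<longrightarrow>
        (AE x in lborel_on D. u x = green_op D G f x)))"

definition admissible_kernel ::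
  "'a::euclidean_space set \<Rightarrow> ('a \<Rightarrow> 'a \<Rightarrow> real) \<Rightarrow> bool" where
  "admissible_kernel D G \<longleftrightarrow>
     case_prod G \<in> borel_measurable (lborel_on D \<Otimes>\<^sub>M lborel_on D) \<and>
     (\<forall>x\<in>D. \<forall>y\<in>D. 0 \<le> G x y \<and> G x y = G y x) \<and>
     (\<exists>\<eta>>0. \<exists>C. \<forall>x\<in>D. integrable (lborel_on D) (\<lambda>y. \<bar>G x y\<bar> powr (2 + \<eta>)) \<and>
        (LINT y|lborel_on D. \<bar>G x y\<bar> powr (2 + \<eta>)) \<le> C)"


section \<open>The random potential\<close>

definition strictly_stationary ::
  "'w measure \<Rightarrow> ('a::euclidean_space \<Rightarrow> 'w \<Rightarrow> real) \<Rightarrow> bool" where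
  "strictly_stationary M q \<longleftrightarrow> (\<forall>F h. finite F \<longrightarrow>
     distr M (\<Pi>\<^sub>M x\<in>F. borel) (\<lambda>\<omega>. \<lambda>x\<in>F. q (x + h) \<omega>) =
     distr M (\<Pi>\<^sub>M x\<in>F. borel) (\<lambda>\<omega>. \<lambda>x\<in>F. q x \<omega>))"

text \<open>The base point in the correlation function is irrelevant for a stationary field.\<close>

definition correlation :: "'w measure \<Rightarrow> ('a::euclidean_space \<Rightarrow> 'w \<Rightarrow> real) \<Rightarrow> 'a \<Rightarrow> real" where
  "correlation M q x = (LINT \<omega>|M. q 0 \<omega> * q x \<omega>)"

definition sigma_generated ::
  "'w measure \<Rightarrow> ('a \<Rightarrow> 'w \<Rightarrow> real) \<Rightarrow> 'a set \<Rightarrow> 'w measure" where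
  "sigma_generated M q S =
     vimage_algebra (space M) (\<lambda>\<omega>. \<lambda>x\<in>S. q x \<omega>) (\<Pi>\<^sub>M x\<in>S. borel)"

definition strongly_mixing ::
  "'w measure \<Rightarrow> ('a::euclidean_space \<Rightarrow> 'w \<Rightarrow> real) \<Rightarrow> bool" where
  "strongly_mixing M q \<longleftrightarrow> (\<exists>\<phi>::real \<Rightarrow> real.
     (\<forall>r\<ge>0. 0 \<le> \<phi> r) \<and> bounded (\<phi> ` {0..}) \<and> antimono_on {0..} \<phi> \<and>
     set_integrable lborel {0..} (\<lambda>r. r ^ (DIM('a) - 1) * sqrt (\<phi> r)) \<and>
     (\<forall>S\<in>sets borel. \<forall>T\<in>sets borel.
        \<forall>\<zeta>\<in>borel_measurable (sigma_generated M q S). \<forall>\<xi>\<in>borel_measurable (sigma_generated M q T).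
          integrable M (\<lambda>\<omega>. (\<zeta> \<omega>)\<^sup>2) \<longrightarrow> integrable M (\<lambda>\<omega>. (\<xi> \<omega>)\<^sup>2) \<longrightarrow>
          \<bar>LINT \<omega>|M. (\<zeta> \<omega> - (LINT w|M. \<zeta> w)) * (\<xi> \<omega> - (LINT w|M. \<xi> w))\<bar>
            \<le> \<phi> (2 * setdist S T) * sqrt ((LINT \<omega>|M. (\<zeta> \<omega>)\<^sup>2) * (LINT \<omega>|M. (\<xi> \<omega>)\<^sup>2))))"

definition scaled_potential ::
  "('a::euclidean_space \<Rightarrow> 'w \<Rightarrow> real) \<Rightarrow> real \<Rightarrow> 'w \<Rightarrow> 'a \<Rightarrow> real" where
  "scaled_potential q \<epsilon> \<omega> x = q (x /\<^sub>R \<epsilon>) \<omega>"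

text \<open>The event $\Omega_\varepsilon$ on which the potential is switched off.\<close>

definition cutoff_event ::
  "'w measure \<Rightarrow> 'a::euclidean_space set \<Rightarrow> ('a \<Rightarrow> 'a \<Rightarrow> real) \<Rightarrow> real \<Rightarrow>
     ('a \<Rightarrow> 'w \<Rightarrow> real) \<Rightarrow> real \<Rightarrow> 'w set" where
  "cutoff_event M D G \<rho> q \<epsilon> = {\<omega>\<in>space M. ennreal \<rho> <
     L2_opnorm D (\<lambda>f. green_op D G (\<lambda>x. scaled_potential q \<epsilon> \<omega> x *
       green_op D G (\<lambda>y. scaled_potential q \<epsilon> \<omega> y * f y) x))}"

definition modified_potential ::
  "'w measure \<Rightarrow> 'a::euclidean_space set \<Rightarrow> ('a \<Rightarrow> 'a \<Rightarrow> real) \<Rightarrow> real \<Rightarrow>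
     ('a \<Rightarrow> 'w \<Rightarrow> real) \<Rightarrow> real \<Rightarrow> 'w \<Rightarrow> 'a \<Rightarrow> real" where
  "modified_potential M D G \<rho> q \<epsilon> \<omega> x =
     (if \<omega> \<in> cutoff_event M D G \<rho> q \<epsilon> then 0 else scaled_potential q \<epsilon> \<omega> x)"

definition perturbed_solution ::
  "'a::euclidean_space set \<Rightarrow> ('a \<Rightarrow> 'a \<Rightarrow> real) \<Rightarrow> ('a \<Rightarrow> real) \<Rightarrow> ('a \<Rightarrow> real) \<Rightarrow>
     ('a \<Rightarrow> real) \<Rightarrow> bool" where
  "perturbed_solution D G V f u \<longleftrightarrow> u \<in> L2 D \<and>
     (AE x in lborel_on D. u x = green_op D G f x
        - green_op D G (\<lambda>y. V y * green_op D G f y) x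
        + green_op D G (\<lambda>y. V y * green_op D G (\<lambda>z. V z * u z) y) x)"

text \<open>The operator $A_\varepsilon$ for a fixed realization \<open>V\<close> of the modified potential. The solution is
  unique up to null sets; \<open>SOME\<close> picks a representative.\<close>

definition perturbed_op ::
  "'a::euclidean_space set \<Rightarrow> ('a \<Rightarrow> 'a \<Rightarrow> real) \<Rightarrow> ('a \<Rightarrow> real) \<Rightarrow> ('a \<Rightarrow> real) \<Rightarrow> 'a \<Rightarrow> real" where
  "perturbed_op D G V f = (SOME u. perturbed_solution D G V f u)"


section \<open>White noise and convergence in distribution\<close>

definition normal_law :: "real \<Rightarrow> real \<Rightarrow> real measure" where
  "normal_law \<mu> s = (if s = 0 then return borel \<mu> else density lborel (normal_density \<mu> s))"

text \<open>White noise as an isonormal process: a centred jointly Gaussian family indexed by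
  $L^2(\mathbf{R}^d)$ with the $L^2$ inner product as covariance; \<open>W f\<close> is $\int f\,dW$.\<close>

definition white_noise :: "'v measure \<Rightarrow> (('a::euclidean_space \<Rightarrow> real) \<Rightarrow> 'v \<Rightarrow> real) \<Rightarrow> bool" where
  "white_noise N W \<longleftrightarrow>
     (\<forall>f\<in>L2 UNIV. W f \<in> borel_measurable N) \<and>
     (\<forall>F c. finite F \<and> F \<subseteq> L2 UNIV \<longrightarrow>
        (\<exists>s\<ge>0. distr N borel (\<lambda>w. \<Sum>f\<in>F. c f * W f w) = normal_law 0 s)) \<and>
     (\<forall>f\<in>L2 UNIV. \<forall>g\<in>L2 UNIV. (LINT w|N. W f w * W g w) = L2_inner UNIV f g)"

definition wiener_integral ::
  "(('a::euclidean_space \<Rightarrow> real) \<Rightarrow> 'v \<Rightarrow> real) \<Rightarrow> 'a set \<Rightarrow> ('a \<Rightarrow> real) \<Rightarrow> 'v \<Rightarrow> real" where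
  "wiener_integral W D f = W (\<lambda>y. indicator D y * f y)"

text \<open>The integral $\int_{D^2} h(x,y)\,dW_y\,dx$ of a deterministic \<open>h\<close>, white noise in \<open>y\<close> only.\<close>

definition wiener_integral2 ::
  "(('a::euclidean_space \<Rightarrow> real) \<Rightarrow> 'v \<Rightarrow> real) \<Rightarrow> 'a set \<Rightarrow> ('a \<Rightarrow> 'a \<Rightarrow> real) \<Rightarrow> 'v \<Rightarrow> real" where
  "wiener_integral2 W D h = wiener_integral W D (\<lambda>y. LINT x|lborel_on D. h x y)"

definition converges_in_distribution ::
  "'w measure \<Rightarrow> (real \<Rightarrow> 'w \<Rightarrow> real) \<Rightarrow> 'v measure \<Rightarrow> ('v \<Rightarrow> real) \<Rightarrow> bool" where
  "converges_in_distribution M X N Y \<longleftrightarrow> (\<forall>e::nat \<Rightarrow> real. filterlim e (at_right 0) sequentially \<longrightarrow>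
     weak_conv_m (\<lambda>k. distr M borel (X (e k))) (distr N borel Y))"

end

(*
Write V for the modified potential, G for the Green operator, and (lam, v) for the perturbed
eigenpair. A_eps v is given by a Neumann series. Pairing the equation for A_eps v = lam v
with u and moving all operators to the other side gives
  (lam - Lam) <v, u> = - Lam <V u, G v> + lam Lam <v, V G (V u)>.
The main part of the right-hand side is - Lam^2 <V u, u>. After division by eps^(d/2) the other
parts vanish in probability: the covariance bound E (int g q(./eps))^2 <= eps^d |R|_1 |g|^2
handles the terms with v - u, while <V u, G (V u)> is only bounded by eps^(d/2) this way; it is
o(eps^(d/2)) because this is true for finite sums of product kernels and these are dense in
L^2(D x D).

The central limit theorem for Y = eps^(-d/2) int f q(./eps) is proved without fourth order mixing
estimates. The characteristic function psi of Y satisfies psi'(t) = - t s^2 psi(t) + o(1): in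
E[q(x/eps) exp(i t Y)] one removes from Y the contribution of a ball around x of radius
eps^(7/10), expands the exponential to first order in it, and decouples by strong mixing.
*)
theory Submission
  imports Defs "HOL-Real_Asymp.Real_Asymp"
begin

section \<open>Square integrable functions\<close>

text \<open>The argument is shaped by \<open>V\<close> being almost surely square integrable on
  \<open>D\<close> but not bounded: \<open>V * v\<close> is merely integrable, and multiplication by
  \<open>V\<close> does not act on L2. What rescues every pairing is the uniform bound on the
  integral of G(x,y)^2 over y. It makes the kernel operator map L1 to L2 and L2 to bounded
  functions; hence \<open>u\<close> is bounded, \<open>V * u\<close> is square integrable, and
  operators are moved onto these. The exponent 7/10 balances two demands. Let the radius be L eps
  with L = eps^(-a). The mixing error L^(-2d) is multiplied by eps^(-d/2), which forces a > 1/4; the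
  Taylor error eps^(-d) (L eps)^(3d/2) forces a < 1/3. The choice a = 3/10 lies between. On the
  cutoff event V = 0 and the identity collapses to (lam - Lam) <v, u> = 0; the oscillatory integral,
  then unmatched, is controlled by [H3].\<close>

definition square_integrable :: "'b measure \<Rightarrow> ('b \<Rightarrow> real) \<Rightarrow> bool" where
  "square_integrable N f \<longleftrightarrow> f \<in> borel_measurable N \<and> integrable N (\<lambda>x. (f x)\<^sup>2)"

text \<open>Over an arbitrary measure, because the same inequalities serve functions on
  \<open>D\<close>, kernels on the product of \<open>D\<close> with itself, and random
  variables.\<close>

definition norm2 :: "'b measure \<Rightarrow> ('b \<Rightarrow> real) \<Rightarrow> real" where
  "norm2 N f = sqrt (LINT x|N. (f x)\<^sup>2)"

lemma L2_iff_square_integrable: "f \<in> L2 D \<longleftrightarrow> square_integrable (lborel_on D) f"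
  by (simp add: L2_def square_integrable_def)

lemma L2_norm_eq_norm2: "L2_norm D f = norm2 (lborel_on D) f"
  by (simp add: L2_norm_def norm2_def)

lemma square_integrable_measurable [measurable_dest]:
  "square_integrable N f \<Longrightarrow> f \<in> borel_measurable N"
  by (simp add: square_integrable_def)

lemma square_integrable_power2: "square_integrable N f \<Longrightarrow> integrable N (\<lambda>x. (f x)\<^sup>2)"
  by (simp add: square_integrable_def)

lemma norm2_nonneg [simp]: "0 \<le> norm2 N f"
  by (simp add: norm2_def)

lemma norm2_power2: "(norm2 N f)\<^sup>2 = (LINT x|N. (f x)\<^sup>2)"
  by (simp add: norm2_def)

lemma square_integrable_bound:
  assumes "square_integrable N f" and [measurable]: "g \<in> borel_measurable N"
    and "AE x in N. \<bar>g x\<bar> \<le> \<bar>f x\<bar>"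
  shows "square_integrable N g"
  unfolding square_integrable_def
proof
  show "integrable N (\<lambda>x. (g x)\<^sup>2)"
    by (rule Bochner_Integration.integrable_bound[OF square_integrable_power2[OF assms(1)]])
      (use assms(3) in \<open>auto elim!: eventually_mono simp: abs_le_square_iff\<close>)
qed (use assms in auto)

lemma square_integrable_cmult:
  "square_integrable N f \<Longrightarrow> square_integrable N (\<lambda>x. c * f x)"
  by (auto simp: square_integrable_def power_mult_distrib)

lemma square_integrable_uminus:
  "square_integrable N f \<Longrightarrow> square_integrable N (\<lambda>x. - f x)"
  by (auto simp: square_integrable_def)

lemma square_integrable_abs:
  "square_integrable N f \<Longrightarrow> square_integrable N (\<lambda>x. \<bar>f x\<bar>)"
  by (auto simp: square_integrable_def)

lemma square_integrable_mult_integrable: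
  assumes f: "square_integrable N f" and g: "square_integrable N g"
  shows "integrable N (\<lambda>x. f x * g x)"
proof (rule Bochner_Integration.integrable_bound)
  show "integrable N (\<lambda>x. (f x)\<^sup>2 + (g x)\<^sup>2)"
    using f g by (auto intro: square_integrable_power2)
  have "\<bar>a * b\<bar> \<le> a\<^sup>2 + b\<^sup>2" for a b :: real
  proof -
    have "2 * (\<bar>a\<bar> * \<bar>b\<bar>) \<le> a\<^sup>2 + b\<^sup>2"
      using zero_le_power2[of "\<bar>a\<bar> - \<bar>b\<bar>"] by (simp add: power2_diff)
    moreover have "0 \<le> \<bar>a\<bar> * \<bar>b\<bar>" by simp
    ultimately show ?thesis unfolding abs_mult by linarith
  qed
  then show "AE x in N. norm (f x * g x) \<le> norm ((f x)\<^sup>2 + (g x)\<^sup>2)"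
    by (auto intro!: AE_I2)
qed (use f g in measurable)

lemma square_integrable_add:
  assumes f: "square_integrable N f" and g: "square_integrable N g"
  shows "square_integrable N (\<lambda>x. f x + g x)"
  using f g square_integrable_mult_integrable[OF f g]
  by (auto simp: square_integrable_def power2_sum intro!: integrable_mult_right simp: mult.assoc)

lemma square_integrable_diff:
  assumes f: "square_integrable N f" and g: "square_integrable N g"
  shows "square_integrable N (\<lambda>x. f x - g x)"
  using square_integrable_add[OF f square_integrable_uminus[OF g]] by simp

lemma square_integrable_sum:
  assumes "\<And>i. i \<in> I \<Longrightarrow> square_integrable N (f i)"
  shows "square_integrable N (\<lambda>x. \<Sum>i\<in>I. f i x)"
  using assms
proof (induction I rule: infinite_finite_induct)
  case (insert i I)
  then show ?case by (simp add: square_integrable_add)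
qed (simp_all add: square_integrable_def)

lemma square_integrable_cong_AE:
  assumes "square_integrable N f" "g \<in> borel_measurable N" "AE x in N. f x = g x"
  shows "square_integrable N g"
  by (rule square_integrable_bound[OF assms(1,2)]) (use assms(3) in auto)

lemma norm2_cong_AE:
  assumes "f \<in> borel_measurable N" "g \<in> borel_measurable N" "AE x in N. f x = g x"
  shows "norm2 N f = norm2 N g"
  unfolding norm2_def
  using assms by (intro arg_cong[where f=sqrt] integral_cong_AE) auto

text \<open>The Cauchy-Schwarz inequality follows from the sign of the quadratic
  \<open>t \<mapsto> \<integral>(\<bar>f\<bar> - t \<bar>g\<bar>)\<^sup>2\<close>.\<close>

lemma integral_abs_mult_le_norm2:
  assumes f: "square_integrable N f" and g: "square_integrable N g"
  shows "(LINT x|N. \<bar>f x * g x\<bar>) \<le> norm2 N f * norm2 N g"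
proof -
  define A where "A = (LINT x|N. (f x)\<^sup>2)"
  define B where "B = (LINT x|N. (g x)\<^sup>2)"
  define C where "C = (LINT x|N. \<bar>f x * g x\<bar>)"
  have i: "integrable N (\<lambda>x. \<bar>f x * g x\<bar>)"
    using square_integrable_mult_integrable[OF f g] by auto
  have AB: "0 \<le> A" "0 \<le> B" "0 \<le> C" by (auto simp: A_def B_def C_def)
  have q: "0 \<le> s\<^sup>2 * A - 2 * s * t * C + t\<^sup>2 * B" for s t
  proof -
    have "0 \<le> (LINT x|N. (s * \<bar>f x\<bar> - t * \<bar>g x\<bar>)\<^sup>2)" by simp
    also have "(\<lambda>x. (s * \<bar>f x\<bar> - t * \<bar>g x\<bar>)\<^sup>2)
        = (\<lambda>x. s\<^sup>2 * (f x)\<^sup>2 - 2 * s * t * \<bar>f x * g x\<bar> + t\<^sup>2 * (g x)\<^sup>2)"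
      by (auto simp: power2_diff power_mult_distrib abs_mult algebra_simps)
    also have "(LINT x|N. s\<^sup>2 * (f x)\<^sup>2 - 2 * s * t * \<bar>f x * g x\<bar> + t\<^sup>2 * (g x)\<^sup>2)
        = s\<^sup>2 * A - 2 * s * t * C + t\<^sup>2 * B"
      unfolding A_def B_def C_def using i f g by (simp add: square_integrable_power2)
    finally show ?thesis .
  qed
  have "C\<^sup>2 \<le> A * B"
  proof (cases "B = 0")
    case True
    show ?thesis
    proof (cases "C = 0")
      case False
      \<comment> \<open>With \<open>B = 0\<close> the quadratic is affine in \<open>t\<close>; this
        \<open>t\<close> makes it equal to \<open>- A - 2\<close>, which is negative.\<close>
      have "0 \<le> 1 * A - 2 * 1 * ((A + 1) / C) * C" using q[of 1 "(A + 1) / C"] True by simp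
      then show ?thesis using False AB by simp
    qed (use True in simp)
  next
    case False
    \<comment> \<open>The minimiser \<open>t / s = C / B\<close> with the denominator
      cleared.\<close>
    have "0 \<le> B\<^sup>2 * A - 2 * B * C * C + C\<^sup>2 * B" by (rule q)
    then have "0 \<le> B * (A * B - C\<^sup>2)" by (simp add: algebra_simps power2_eq_square)
    then show ?thesis using False AB by (simp add: zero_le_mult_iff)
  qed
  then have "C \<le> sqrt (A * B)" using AB by (simp add: real_le_rsqrt)
  then show ?thesis by (simp add: norm2_def A_def B_def C_def real_sqrt_mult)
qed

lemma abs_integral_mult_le_norm2:
  assumes f: "square_integrable N f" and g: "square_integrable N g"
  shows "\<bar>LINT x|N. f x * g x\<bar> \<le> norm2 N f * norm2 N g"
  using integral_abs_mult_le_norm2[OF f g] integral_abs_bound[of N "\<lambda>x. f x * g x"] by (rule order_trans[rotated])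

lemma norm2_triangle:
  assumes f: "square_integrable N f" and g: "square_integrable N g"
  shows "norm2 N (\<lambda>x. f x + g x) \<le> norm2 N f + norm2 N g"
proof (rule power2_le_imp_le)
  have "(norm2 N (\<lambda>x. f x + g x))\<^sup>2 = (LINT x|N. (f x)\<^sup>2 + (g x)\<^sup>2 + 2 * (f x * g x))"
    by (simp add: norm2_power2 power2_sum mult.assoc)
  also have "\<dots> = (norm2 N f)\<^sup>2 + (norm2 N g)\<^sup>2 + 2 * (LINT x|N. f x * g x)"
    using f g square_integrable_mult_integrable[OF f g]
    by (simp add: square_integrable_power2 norm2_power2)
  also have "\<dots> \<le> (norm2 N f + norm2 N g)\<^sup>2"
    using abs_integral_mult_le_norm2[OF f g] by (simp add: power2_sum)
  finally show "(norm2 N (\<lambda>x. f x + g x))\<^sup>2 \<le> (norm2 N f + norm2 N g)\<^sup>2" .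
qed simp

lemma norm2_cmult: "norm2 N (\<lambda>x. c * f x) = \<bar>c\<bar> * norm2 N f"
  by (simp add: norm2_def power_mult_distrib real_sqrt_mult)

lemma norm2_uminus: "norm2 N (\<lambda>x. - f x) = norm2 N f"
  by (simp add: norm2_def)

lemma norm2_abs: "norm2 N (\<lambda>x. \<bar>f x\<bar>) = norm2 N f"
  by (simp add: norm2_def)

lemma norm2_triangle_diff:
  assumes f: "square_integrable N f" and g: "square_integrable N g"
  shows "norm2 N (\<lambda>x. f x - g x) \<le> norm2 N f + norm2 N g"
  using norm2_triangle[OF f square_integrable_uminus[OF g]] by (simp add: norm2_uminus)

lemma norm2_mono:
  assumes "square_integrable N f" and "g \<in> borel_measurable N"
    and "AE x in N. \<bar>g x\<bar> \<le> \<bar>f x\<bar>"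
  shows "norm2 N g \<le> norm2 N f"
proof -
  note g = square_integrable_bound[OF assms]
  show ?thesis unfolding norm2_def
    by (intro real_sqrt_le_mono integral_mono_AE)
      (use g assms in \<open>auto simp: square_integrable_def abs_le_square_iff\<close>)
qed

lemma norm2_sum_le:
  assumes "\<And>i. i \<in> I \<Longrightarrow> square_integrable N (f i)"
  shows "norm2 N (\<lambda>x. \<Sum>i\<in>I. f i x) \<le> (\<Sum>i\<in>I. norm2 N (f i))"
  using assms
proof (induction I rule: infinite_finite_induct)
  case (insert i I)
  have "norm2 N (\<lambda>x. f i x + (\<Sum>i\<in>I. f i x)) \<le> norm2 N (f i) + norm2 N (\<lambda>x. \<Sum>i\<in>I. f i x)"
    using insert by (intro norm2_triangle square_integrable_sum) auto
  then show ?case using insert by fastforce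
qed (simp_all add: norm2_def)

lemma (in finite_measure) square_integrable_bounded:
  assumes "f \<in> borel_measurable M" "AE x in M. \<bar>f x\<bar> \<le> B"
  shows "square_integrable M f"
  by (rule square_integrable_bound[where f="\<lambda>_. B"])
    (use assms in \<open>auto simp: square_integrable_def elim: eventually_mono\<close>)

lemma (in finite_measure) square_integrable_integrable:
  assumes "square_integrable M f"
  shows "integrable M f"
  using square_integrable_mult_integrable[OF assms, of "\<lambda>_. 1"]
  by (simp add: square_integrable_def)

lemma square_integrable_mult_bounded:
  assumes "square_integrable N f" and [measurable]: "g \<in> borel_measurable N"
    and "AE x in N. \<bar>g x\<bar> \<le> B"
  shows "square_integrable N (\<lambda>x. g x * f x)"
proof (rule square_integrable_bound[OF square_integrable_cmult[OF assms(1), of B]])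
  show "AE x in N. \<bar>g x * f x\<bar> \<le> \<bar>B * f x\<bar>"
    using assms(3) by eventually_elim (auto simp: abs_mult intro!: mult_right_mono)
qed (use assms in measurable)

lemma norm2_mult_bounded_le:
  assumes f: "square_integrable N f" and [measurable]: "g \<in> borel_measurable N"
    and "AE x in N. \<bar>g x\<bar> \<le> B" and "0 \<le> B"
  shows "norm2 N (\<lambda>x. g x * f x) \<le> B * norm2 N f"
proof -
  have "norm2 N (\<lambda>x. g x * f x) \<le> norm2 N (\<lambda>x. B * f x)"
  proof (rule norm2_mono[OF square_integrable_cmult[OF f]])
    show "AE x in N. \<bar>g x * f x\<bar> \<le> \<bar>B * f x\<bar>"
      using assms(3) by eventually_elim (auto simp: abs_mult intro!: mult_right_mono)
  qed (use f in measurable)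
  then show ?thesis using assms(4) by (simp add: norm2_cmult)
qed

lemma norm2_eq_0_AE:
  assumes "square_integrable N f" "norm2 N f = 0"
  shows "AE x in N. f x = 0"
proof -
  have "(LINT x|N. (f x)\<^sup>2) = 0" using assms(2) by (metis norm2_power2 zero_power2)
  then have "AE x in N. (f x)\<^sup>2 = 0"
    using integral_nonneg_eq_0_iff_AE[OF square_integrable_power2[OF assms(1)]] by simp
  then show ?thesis by simp
qed

text \<open>Monotone convergence for the partial sums of \<open>\<Sum>\<bar>h n\<bar>\<close> yields a square integrable majorant.\<close>

lemma square_integrable_series:
  fixes h :: "nat \<Rightarrow> 'b \<Rightarrow> real"
  assumes h: "\<And>n. square_integrable N (h n)" and s: "summable (\<lambda>n. norm2 N (h n))"
  obtains w where "square_integrable N w"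
    "(\<lambda>n. norm2 N (\<lambda>x. w x - (\<Sum>i<n. h i x))) \<longlonglongrightarrow> 0"
proof -
  define S where "S n x = (\<Sum>i<n. \<bar>h i x\<bar>)" for n x
  define c where "c = (\<Sum>n. norm2 N (h n))"
  have [measurable]: "h n \<in> borel_measurable N" for n using h by measurable
  have S_sq: "square_integrable N (S n)" for n
    unfolding S_def by (intro square_integrable_sum square_integrable_abs h)
  have S_norm: "norm2 N (S n) \<le> c" for n
  proof -
    have "norm2 N (S n) \<le> (\<Sum>i<n. norm2 N (\<lambda>x. \<bar>h i x\<bar>))"
      unfolding S_def by (intro norm2_sum_le square_integrable_abs h)
    also have "\<dots> \<le> c" unfolding c_def norm2_abs by (rule sum_le_suminf[OF s]) auto
    finally show ?thesis .
  qed
  have S_mono: "mono (\<lambda>n. S n x)" for x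
    unfolding mono_def S_def by (auto intro!: sum_mono2)
  have S_pos: "0 \<le> S n x" for n x by (auto simp: S_def intro: sum_nonneg)
  define F where "F x = (SUP n. ennreal ((S n x)\<^sup>2))" for x
  have [measurable]: "S n \<in> borel_measurable N" for n unfolding S_def by measurable
  have F_meas [measurable]: "F \<in> borel_measurable N" unfolding F_def by measurable
  have "(\<integral>\<^sup>+x. F x \<partial>N) = (SUP n. \<integral>\<^sup>+x. ennreal ((S n x)\<^sup>2) \<partial>N)"
    unfolding F_def
    by (intro nn_integral_monotone_convergence_SUP)
      (auto simp: incseq_def le_fun_def intro!: ennreal_leI power_mono S_pos monoD[OF S_mono])
  also have "\<dots> \<le> ennreal (c\<^sup>2)"
  proof (rule SUP_least)
    fix n
    have "(\<integral>\<^sup>+x. ennreal ((S n x)\<^sup>2) \<partial>N) = ennreal ((norm2 N (S n))\<^sup>2)"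
      unfolding norm2_power2
      by (intro nn_integral_eq_integral square_integrable_power2 S_sq) auto
    also have "\<dots> \<le> ennreal (c\<^sup>2)" by (intro ennreal_leI power_mono S_norm) auto
    finally show "(\<integral>\<^sup>+x. ennreal ((S n x)\<^sup>2) \<partial>N) \<le> ennreal (c\<^sup>2)" .
  qed
  finally have Ffin: "(\<integral>\<^sup>+x. F x \<partial>N) < \<infinity>" by (rule le_less_trans) simp
  then have "AE x in N. F x \<noteq> \<infinity>" by (intro nn_integral_PInf_AE) auto
  define F' where "F' x = enn2real (F x)" for x
  have SF: "S n x \<le> sqrt (F' x)" if "F x \<noteq> \<infinity>" for n x
  proof -
    have "ennreal ((S n x)\<^sup>2) \<le> F x" unfolding F_def by (rule SUP_upper) simp
    then have "(S n x)\<^sup>2 \<le> F' x" unfolding F'_def using that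
      by (metis S_pos enn2real_ennreal enn2real_mono infinity_ennreal_def top.not_eq_extremum zero_le_power2)
    then show ?thesis by (simp add: real_le_rsqrt)
  qed
  have F'_int: "integrable N F'"
    unfolding F'_def
  proof (rule integrableI_bounded)
    have "(\<integral>\<^sup>+x. ennreal (norm (enn2real (F x))) \<partial>N) \<le> (\<integral>\<^sup>+x. F x \<partial>N)"
      by (intro nn_integral_mono) (simp add: ennreal_enn2real_if)
    then show "(\<integral>\<^sup>+x. ennreal (norm (enn2real (F x))) \<partial>N) < \<infinity>" using Ffin by (rule le_less_trans)
  qed measurable
  have summ: "summable (\<lambda>i. \<bar>h i x\<bar>)" if "F x \<noteq> \<infinity>" for x
    by (rule summableI_nonneg_bounded[where x="sqrt (F' x)"]) (use SF[OF that] in \<open>auto simp: S_def\<close>)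
  define w where "w x = (if F x = \<infinity> then 0 else \<Sum>i. h i x)" for x
  have w_meas [measurable]: "w \<in> borel_measurable N" unfolding w_def by measurable
  \<comment> \<open>A bound uniform in \<open>n\<close>: the limit and each partial sum are at most
    \<open>sqrt (F' x)\<close> in absolute value, so \<open>4 * F'\<close> dominates all squared
    tails.\<close>
  have tail: "\<bar>w x - (\<Sum>i<n. h i x)\<bar> \<le> 2 * sqrt (F' x)" if x: "F x \<noteq> \<infinity>" for n x
  proof -
    have "\<bar>\<Sum>i. h i x\<bar> \<le> (\<Sum>i. \<bar>h i x\<bar>)" using summable_rabs[OF summ[OF x]] .
    also have "\<dots> \<le> sqrt (F' x)"
      by (rule suminf_le_const[OF summ[OF x]]) (use SF[OF x] in \<open>auto simp: S_def\<close>)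
    finally have 1: "\<bar>w x\<bar> \<le> sqrt (F' x)" using x by (simp add: w_def)
    have "\<bar>\<Sum>i<n. h i x\<bar> \<le> S n x" unfolding S_def by (rule sum_abs)
    then have 2: "\<bar>\<Sum>i<n. h i x\<bar> \<le> sqrt (F' x)" using SF[OF x, of n] by simp
    show ?thesis using 1 2 by linarith
  qed
  have dom: "AE x in N. ((w x - (\<Sum>i<n. h i x))\<^sup>2) \<le> 4 * F' x" for n
    using \<open>AE x in N. F x \<noteq> \<infinity>\<close>
  proof eventually_elim
    case (elim x)
    have "\<bar>w x - (\<Sum>i<n. h i x)\<bar>\<^sup>2 \<le> (2 * sqrt (F' x))\<^sup>2"
      using tail[OF elim, of n] by (intro power_mono) auto
    then show ?case by (simp add: power_mult_distrib F'_def)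
  qed
  have w_sq: "square_integrable N w"
    unfolding square_integrable_def
  proof
    show "integrable N (\<lambda>x. (w x)\<^sup>2)"
      by (rule Bochner_Integration.integrable_bound[of _ "\<lambda>x. 4 * F' x"])
        (use dom[of 0] F'_int in \<open>auto elim!: eventually_mono\<close>)
  qed simp
  have "(\<lambda>n. LINT x|N. (w x - (\<Sum>i<n. h i x))\<^sup>2) \<longlonglongrightarrow> (LINT x|N. 0)"
  proof (rule integral_dominated_convergence[where w="\<lambda>x. 4 * F' x"])
    show "AE x in N. (\<lambda>n. (w x - (\<Sum>i<n. h i x))\<^sup>2) \<longlonglongrightarrow> 0"
      using \<open>AE x in N. F x \<noteq> \<infinity>\<close>
    proof eventually_elim
      case (elim x)
      have "(\<lambda>n. \<Sum>i<n. h i x) \<longlonglongrightarrow> w x"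
        using summable_LIMSEQ[OF summable_rabs_cancel[OF summ[OF elim]]] elim by (simp add: w_def)
      then have "(\<lambda>n. (w x - (\<Sum>i<n. h i x))\<^sup>2) \<longlonglongrightarrow> (w x - w x)\<^sup>2"
        by (intro tendsto_intros)
      then show ?case by simp
    qed
  qed (use F'_int dom in auto)
  then have "(\<lambda>n. sqrt (LINT x|N. (w x - (\<Sum>i<n. h i x))\<^sup>2)) \<longlonglongrightarrow> sqrt 0"
    by (intro tendsto_real_sqrt) simp
  then show ?thesis using that[OF w_sq] by (simp add: norm2_def)
qed

section \<open>Integral operators with a square integrable symmetric kernel\<close>

text \<open>What an admissible kernel provides on a set of finite measure. By symmetry
  \<open>K\<close> bounds the columns as well as the rows, and this is why the operator acts on
  L1.\<close>

locale symmetric_kernel = finite_measure N for N :: "'b measure" +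
  fixes G :: "'b \<Rightarrow> 'b \<Rightarrow> real" and K :: real
  assumes G_measurable [measurable]: "case_prod G \<in> borel_measurable (N \<Otimes>\<^sub>M N)"
    and G_nonneg: "\<And>x y. x \<in> space N \<Longrightarrow> y \<in> space N \<Longrightarrow> 0 \<le> G x y"
    and G_sym: "\<And>x y. x \<in> space N \<Longrightarrow> y \<in> space N \<Longrightarrow> G x y = G y x"
    and G_integrable: "\<And>x. x \<in> space N \<Longrightarrow> integrable N (\<lambda>y. (G x y)\<^sup>2)"
    and G_bound: "\<And>x. x \<in> space N \<Longrightarrow> (LINT y|N. (G x y)\<^sup>2) \<le> K"
    and K_nonneg: "0 \<le> K"
begin

sublocale NN: pair_sigma_finite N N ..

definition kop :: "('b \<Rightarrow> real) \<Rightarrow> 'b \<Rightarrow> real" where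
  "kop f x = (LINT y|N. G x y * f y)"

lemma G_section: "x \<in> space N \<Longrightarrow> square_integrable N (G x)"
  using G_integrable[of x] by (simp add: square_integrable_def)

lemma norm2_G: "x \<in> space N \<Longrightarrow> norm2 N (G x) \<le> sqrt K"
  unfolding norm2_def by (intro real_sqrt_le_mono G_bound)

lemma kop_measurable [measurable]:
  assumes [measurable]: "f \<in> borel_measurable N"
  shows "kop f \<in> borel_measurable N"
  unfolding kop_def by measurable

lemma kop_cong_AE:
  assumes "x \<in> space N" "AE y in N. f y = g y" "f \<in> borel_measurable N" "g \<in> borel_measurable N"
  shows "kop f x = kop g x"
proof -
  have [measurable]: "G x \<in> borel_measurable N" using G_section[OF assms(1)] by measurable
  show ?thesis unfolding kop_def
    by (intro integral_cong_AE) (use assms in \<open>auto elim!: eventually_mono\<close>)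
qed

lemma kop_cmult: "kop (\<lambda>y. c * f y) x = c * kop f x"
  unfolding kop_def by (simp add: mult.left_commute)

lemma kop_bound:
  assumes "square_integrable N f" "x \<in> space N"
  shows "\<bar>kop f x\<bar> \<le> sqrt K * norm2 N f"
proof -
  have "\<bar>kop f x\<bar> \<le> norm2 N (G x) * norm2 N f"
    unfolding kop_def by (rule abs_integral_mult_le_norm2[OF G_section[OF assms(2)] assms(1)])
  also have "\<dots> \<le> sqrt K * norm2 N f" by (intro mult_right_mono norm2_G assms) simp
  finally show ?thesis .
qed

lemma square_integrable_mult_kop:
  assumes "square_integrable N V" "square_integrable N f"
  shows "square_integrable N (\<lambda>x. V x * kop f x)"
  using square_integrable_mult_bounded[OF assms(1), of "kop f" "sqrt K * norm2 N f"] assms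
  by (auto simp: mult.commute intro!: AE_I2 kop_bound)

text \<open>Cauchy-Schwarz with weight \<open>\<bar>f y\<bar>\<close> bounds the square of
  \<open>kop f x\<close> by the integral of \<open>(G x y)\<^sup>2 * \<bar>f y\<bar>\<close> times
  the L1 norm of \<open>f\<close>; integrating over \<open>x\<close> first uses the column bound.
  This L1 to L2 estimate is what makes \<open>kop\<close> applicable to products of \<open>V\<close>
  with a square integrable function.\<close>

lemma kop_integrable_AE:
  assumes f: "integrable N f"
  shows "AE x in N. integrable N (\<lambda>y. G x y * f y)" and "square_integrable N (kop f)"
proof -
  have [measurable]: "f \<in> borel_measurable N" using f by simp
  have Gx: "(\<lambda>x. G x y) \<in> borel_measurable N" if "y \<in> space N" for y
    using that by measurable
  have Gsq: "integrable N (\<lambda>x. (G x y)\<^sup>2)" "(LINT x|N. (G x y)\<^sup>2) \<le> K" if y: "y \<in> space N" for y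
  proof -
    have e: "\<And>x. x \<in> space N \<Longrightarrow> (G x y)\<^sup>2 = (G y x)\<^sup>2" using G_sym y by auto
    show "integrable N (\<lambda>x. (G x y)\<^sup>2)"
      using G_integrable[OF y] by (subst Bochner_Integration.integrable_cong[OF refl e]) auto
    show "(LINT x|N. (G x y)\<^sup>2) \<le> K"
      using G_bound[OF y] by (subst Bochner_Integration.integral_cong[OF refl e]) auto
  qed
  have int: "integrable (N \<Otimes>\<^sub>M N) (\<lambda>(y, x). (G x y)\<^sup>2 * \<bar>f y\<bar>)"
  proof (rule NN.Fubini_integrable)
    show "integrable N (\<lambda>y. LINT x|N. norm (case (y, x) of (y, x) \<Rightarrow> (G x y)\<^sup>2 * \<bar>f y\<bar>))"
    proof (rule Bochner_Integration.integrable_bound)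
      show "integrable N (\<lambda>y. K * \<bar>f y\<bar>)" using f by auto
      show "AE y in N. norm (LINT x|N. norm (case (y, x) of (y, x) \<Rightarrow> (G x y)\<^sup>2 * \<bar>f y\<bar>))
          \<le> norm (K * \<bar>f y\<bar>)"
        using Gsq K_nonneg by (auto intro!: AE_I2 mult_right_mono simp: abs_mult)
    qed measurable
    show "AE y in N. integrable N (\<lambda>x. case (y, x) of (y, x) \<Rightarrow> (G x y)\<^sup>2 * \<bar>f y\<bar>)"
      using Gsq by (auto intro!: AE_I2)
  qed measurable
  then have int': "integrable (N \<Otimes>\<^sub>M N) (\<lambda>(x, y). (G x y)\<^sup>2 * \<bar>f y\<bar>)"
    using NN.integrable_product_swap[OF int] by (simp add: case_prod_beta')
  have ae: "AE x in N. integrable N (\<lambda>y. (G x y)\<^sup>2 * \<bar>f y\<bar>)"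
    using NN.AE_integrable_fst'[OF int'] by simp
  have sqf: "square_integrable N (\<lambda>y. sqrt \<bar>f y\<bar>)"
    using f by (auto simp: square_integrable_def)
  have sqG: "square_integrable N (\<lambda>y. G x y * sqrt \<bar>f y\<bar>)"
    if "integrable N (\<lambda>y. (G x y)\<^sup>2 * \<bar>f y\<bar>)" "x \<in> space N" for x
    using that by (auto simp: square_integrable_def power_mult_distrib)
  have ssgn: "\<bar>G x y\<bar> * \<bar>f y\<bar> = \<bar>(G x y * sqrt \<bar>f y\<bar>) * sqrt \<bar>f y\<bar>\<bar>" for x y
    by (simp add: abs_mult)
  show "AE x in N. integrable N (\<lambda>y. G x y * f y)"
    using ae AE_space
  proof eventually_elim
    case (elim x)
    have [measurable]: "G x \<in> borel_measurable N" using elim by measurable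
    have "integrable N (\<lambda>y. (G x y * sqrt \<bar>f y\<bar>) * sqrt \<bar>f y\<bar>)"
      by (rule square_integrable_mult_integrable[OF sqG[OF elim] sqf])
    then have "integrable N (\<lambda>y. \<bar>G x y\<bar> * \<bar>f y\<bar>)" unfolding ssgn by (rule integrable_abs)
    then show ?case by (subst integrable_abs_iff[symmetric]) (auto simp: abs_mult)
  qed
  show "square_integrable N (kop f)"
    unfolding square_integrable_def
  proof
    show "integrable N (\<lambda>x. (kop f x)\<^sup>2)"
    proof (rule Bochner_Integration.integrable_bound)
      show "integrable N (\<lambda>x. (LINT y|N. (G x y)\<^sup>2 * \<bar>f y\<bar>) * (LINT y|N. \<bar>f y\<bar>))"
        using NN.integrable_fst'[OF int'] by simp
      show "AE x in N. norm ((kop f x)\<^sup>2)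
          \<le> norm ((LINT y|N. (G x y)\<^sup>2 * \<bar>f y\<bar>) * (LINT y|N. \<bar>f y\<bar>))"
        using ae AE_space
      proof eventually_elim
        case (elim x)
        have "\<bar>kop f x\<bar> \<le> (LINT y|N. \<bar>G x y * f y\<bar>)"
          unfolding kop_def by (rule integral_abs_bound)
        also have "\<dots> = (LINT y|N. \<bar>(G x y * sqrt \<bar>f y\<bar>) * sqrt \<bar>f y\<bar>\<bar>)"
          by (simp add: abs_mult mult.assoc)
        also have "\<dots> \<le> norm2 N (\<lambda>y. G x y * sqrt \<bar>f y\<bar>) * norm2 N (\<lambda>y. sqrt \<bar>f y\<bar>)"
          by (rule integral_abs_mult_le_norm2[OF sqG[OF elim] sqf])
        finally have "\<bar>kop f x\<bar>\<^sup>2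
            \<le> (norm2 N (\<lambda>y. G x y * sqrt \<bar>f y\<bar>) * norm2 N (\<lambda>y. sqrt \<bar>f y\<bar>))\<^sup>2"
          by (intro power_mono) auto
        also have "\<dots> = (LINT y|N. (G x y)\<^sup>2 * \<bar>f y\<bar>) * (LINT y|N. \<bar>f y\<bar>)"
          by (simp add: power_mult_distrib norm2_power2)
        finally show ?case by simp
      qed
    qed measurable
  qed measurable
qed

lemma square_integrable_kop: "square_integrable N f \<Longrightarrow> square_integrable N (kop f)"
  by (intro kop_integrable_AE square_integrable_integrable)

lemma kop_diff_AE:
  assumes "integrable N f" "integrable N g"
  shows "AE x in N. kop (\<lambda>y. f y - g y) x = kop f x - kop g x"
  using kop_integrable_AE(1)[OF assms(1)] kop_integrable_AE(1)[OF assms(2)]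
  by eventually_elim (simp add: kop_def right_diff_distrib)

text \<open>Fubini; integrating over \<open>x\<close> first, Cauchy-Schwarz on the column of
  \<open>G\<close> leaves a multiple of \<open>\<bar>f y\<bar>\<close>. The asymmetric hypotheses
  are deliberate: \<open>f\<close> will be a product containing \<open>V\<close>, \<open>g\<close>
  an honest L2 function.\<close>

lemma kop_adjoint:
  assumes f: "integrable N f" and g: "square_integrable N g"
  shows "(LINT x|N. kop f x * g x) = (LINT x|N. f x * kop g x)"
proof -
  have [measurable]: "f \<in> borel_measurable N" "g \<in> borel_measurable N" using f g by auto
  have gi: "integrable N (\<lambda>x. G x y * f y * g x)"
    "(LINT x|N. \<bar>G x y * f y * g x\<bar>) \<le> sqrt K * norm2 N g * \<bar>f y\<bar>" if y: "y \<in> space N" for y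
  proof -
    have e: "G x y * f y * g x = f y * (G y x * g x)" if "x \<in> space N" for x
      using G_sym[OF that y] by simp
    show "integrable N (\<lambda>x. G x y * f y * g x)"
      using square_integrable_mult_integrable[OF G_section[OF y] g]
      by (subst Bochner_Integration.integrable_cong[OF refl e]) auto
    have "(LINT x|N. \<bar>G x y * f y * g x\<bar>) = (LINT x|N. \<bar>f y\<bar> * \<bar>G y x * g x\<bar>)"
      by (rule Bochner_Integration.integral_cong) (auto simp: e abs_mult)
    also have "\<dots> \<le> \<bar>f y\<bar> * (norm2 N (G y) * norm2 N g)"
      using integral_abs_mult_le_norm2[OF G_section[OF y] g] by (simp add: mult_left_mono)
    also have "\<dots> \<le> \<bar>f y\<bar> * (sqrt K * norm2 N g)"
      by (intro mult_left_mono mult_right_mono norm2_G y) auto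
    finally show "(LINT x|N. \<bar>G x y * f y * g x\<bar>) \<le> sqrt K * norm2 N g * \<bar>f y\<bar>"
      by (simp add: mult.commute)
  qed
  have int: "integrable (N \<Otimes>\<^sub>M N) (\<lambda>(y, x). G x y * f y * g x)"
  proof (rule NN.Fubini_integrable)
    show "integrable N (\<lambda>y. LINT x|N. norm (case (y, x) of (y, x) \<Rightarrow> G x y * f y * g x))"
    proof (rule Bochner_Integration.integrable_bound)
      show "integrable N (\<lambda>y. sqrt K * norm2 N g * \<bar>f y\<bar>)" using f by auto
      show "AE y in N. norm (LINT x|N. norm (case (y, x) of (y, x) \<Rightarrow> G x y * f y * g x))
          \<le> norm (sqrt K * norm2 N g * \<bar>f y\<bar>)"
        using gi K_nonneg by (auto intro!: AE_I2 simp: abs_mult)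
    qed measurable
    show "AE y in N. integrable N (\<lambda>x. case (y, x) of (y, x) \<Rightarrow> G x y * f y * g x)"
      using gi by (auto intro!: AE_I2)
  qed measurable
  have "(LINT x|N. kop f x * g x) = (LINT x|N. LINT y|N. G x y * f y * g x)"
    unfolding kop_def by simp
  also have "\<dots> = (LINT y|N. LINT x|N. G x y * f y * g x)"
    using NN.Fubini_integral[of "\<lambda>y x. G x y * f y * g x"] int by simp
  also have "\<dots> = (LINT y|N. f y * kop g y)"
  proof (rule Bochner_Integration.integral_cong[OF refl])
    fix y assume y: "y \<in> space N"
    have "(LINT x|N. G x y * f y * g x) = (LINT x|N. f y * (G y x * g x))"
      by (rule Bochner_Integration.integral_cong) (auto simp: G_sym[OF y])
    then show "(LINT x|N. G x y * f y * g x) = f y * kop g y" by (simp add: kop_def)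
  qed
  finally show ?thesis .
qed

text \<open>The composite G V G V whose operator norm defines the cutoff event. It does act on L2,
  because each application of G repairs the integrability lost in the multiplication by
  \<open>V\<close>.\<close>

definition iter_kop :: "('b \<Rightarrow> real) \<Rightarrow> ('b \<Rightarrow> real) \<Rightarrow> 'b \<Rightarrow> real" where
  "iter_kop V f = kop (\<lambda>x. V x * kop (\<lambda>y. V y * f y) x)"

section \<open>The iterated operator and its Neumann series\<close>

context
  fixes V assumes V: "square_integrable N V"
begin

lemma integrable_mult_kop_mult:
  assumes "square_integrable N f"
  shows "integrable N (\<lambda>x. V x * kop (\<lambda>y. V y * f y) x)"
  by (intro square_integrable_mult_integrable[OF V] kop_integrable_AE assms)

lemma iter_kop_diff_AE:
  assumes f: "square_integrable N f" and g: "square_integrable N g"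
  shows "AE x in N. iter_kop V (\<lambda>y. f y - g y) x = iter_kop V f x - iter_kop V g x"
proof -
  have [measurable]: "V \<in> borel_measurable N" "f \<in> borel_measurable N" "g \<in> borel_measurable N"
    using V f g by auto
  have 1: "AE x in N. kop (\<lambda>y. V y * (f y - g y)) x = kop (\<lambda>y. V y * f y) x - kop (\<lambda>y. V y * g y) x"
    using kop_diff_AE[OF square_integrable_mult_integrable[OF V f] square_integrable_mult_integrable[OF V g]]
    by (simp add: right_diff_distrib)
  have "iter_kop V (\<lambda>y. f y - g y) x
      = kop (\<lambda>x. V x * kop (\<lambda>y. V y * f y) x - V x * kop (\<lambda>y. V y * g y) x) x"
    if "x \<in> space N" for x
    unfolding iter_kop_def
    by (rule kop_cong_AE[OF that]) (use 1 in \<open>auto simp: right_diff_distrib elim!: eventually_mono\<close>)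
  moreover have "AE x in N. kop (\<lambda>x. V x * kop (\<lambda>y. V y * f y) x - V x * kop (\<lambda>y. V y * g y) x) x
      = iter_kop V f x - iter_kop V g x"
    unfolding iter_kop_def by (intro kop_diff_AE integrable_mult_kop_mult f g)
  ultimately show ?thesis using AE_space by (auto elim!: eventually_elim2)
qed

lemma square_integrable_iter_kop:
  assumes f: "square_integrable N f"
  shows "square_integrable N (iter_kop V f)"
  unfolding iter_kop_def by (intro kop_integrable_AE integrable_mult_kop_mult f)

text \<open>Neumann series started at \<open>h\<close>. Elements of L2 are functions, so linearity
  holds only almost everywhere; the equation is therefore checked by showing that the defect
  \<open>d\<close> of the limit has norm zero. The contraction bound also supplies the continuity
  used in passing to the limit.\<close>

lemma fixed_point_iter_kop:
  assumes h: "square_integrable N h" and c: "0 \<le> c" "c < 1"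
    and contr: "\<And>f. square_integrable N f \<Longrightarrow> norm2 N (iter_kop V f) \<le> c * norm2 N f"
  obtains w where "square_integrable N w" "AE x in N. w x = h x + iter_kop V w x"
proof -
  define hn where "hn n = (iter_kop V ^^ n) h" for n
  have hn_sq: "square_integrable N (hn n)" for n
    by (induction n) (auto simp: hn_def h square_integrable_iter_kop)
  have hn_norm: "norm2 N (hn n) \<le> c ^ n * norm2 N h" for n
  proof (induction n)
    case (Suc n)
    have "norm2 N (hn (Suc n)) \<le> c * norm2 N (hn n)"
      using contr[OF hn_sq[of n]] by (simp add: hn_def)
    also have "\<dots> \<le> c * (c ^ n * norm2 N h)" using Suc c by (intro mult_left_mono) auto
    finally show ?case by (simp add: mult.assoc)
  qed (simp add: hn_def)
  have "summable (\<lambda>n. norm2 N (hn n))"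
    by (rule summable_comparison_test[of _ "\<lambda>n. c ^ n * norm2 N h"])
      (use hn_norm c in \<open>auto intro!: summable_mult2 summable_geometric\<close>)
  then obtain w where w: "square_integrable N w"
    and lim: "(\<lambda>n. norm2 N (\<lambda>x. w x - (\<Sum>i<n. hn i x))) \<longlonglongrightarrow> 0"
    using square_integrable_series[of N hn] hn_sq by blast
  define s where "s n x = (\<Sum>i<n. hn i x)" for n x
  have s_sq: "square_integrable N (s n)" for n
    unfolding s_def by (intro square_integrable_sum hn_sq)
  \<comment> \<open>The operator shifts the summation index by one; the term lost at the start is
    \<open>h\<close>.\<close>
  have s_iter: "AE x in N. iter_kop V (s n) x = s (Suc n) x - h x" for n
  proof (induction n)
    case 0
    show ?case by (auto simp: s_def iter_kop_def kop_def hn_def)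
  next
    case (Suc n)
    have "AE x in N. iter_kop V (\<lambda>y. s (Suc n) y - s n y) x = iter_kop V (s (Suc n)) x - iter_kop V (s n) x"
      by (intro iter_kop_diff_AE s_sq)
    moreover have "(\<lambda>y. s (Suc n) y - s n y) = hn n" by (auto simp: s_def)
    moreover have "iter_kop V (hn n) = hn (Suc n)" by (simp add: hn_def)
    ultimately have "AE x in N. hn (Suc n) x = iter_kop V (s (Suc n)) x - iter_kop V (s n) x"
      by simp
    moreover have "s (Suc (Suc n)) x = s (Suc n) x + hn (Suc n) x" for x by (simp add: s_def)
    ultimately show ?case using Suc by (auto elim!: eventually_elim2)
  qed
  define d where "d x = w x - h x - iter_kop V w x" for x
  note sq = w s_sq h square_integrable_iter_kop[OF w] square_integrable_iter_kop[OF s_sq]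
  have d_sq: "square_integrable N d" unfolding d_def by (intro square_integrable_diff sq)
  have d_le: "norm2 N d \<le> norm2 N (\<lambda>x. w x - s (Suc n) x) + c * norm2 N (\<lambda>x. w x - s n x)" for n
  proof -
    have "AE x in N. iter_kop V (\<lambda>y. w y - s n y) x = iter_kop V w x - iter_kop V (s n) x"
      by (intro iter_kop_diff_AE sq)
    then have "AE x in N. d x = (w x - s (Suc n) x) - iter_kop V (\<lambda>y. w y - s n y) x"
      using s_iter[of n] by eventually_elim (simp add: d_def)
    then have "norm2 N d = norm2 N (\<lambda>x. (w x - s (Suc n) x) - iter_kop V (\<lambda>y. w y - s n y) x)"
      by (intro norm2_cong_AE square_integrable_measurable d_sq square_integrable_diff sq
          square_integrable_iter_kop)
    also have "\<dots> \<le> norm2 N (\<lambda>x. w x - s (Suc n) x) + norm2 N (iter_kop V (\<lambda>y. w y - s n y))"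
      by (intro norm2_triangle_diff square_integrable_diff sq square_integrable_iter_kop)
    also have "norm2 N (iter_kop V (\<lambda>y. w y - s n y)) \<le> c * norm2 N (\<lambda>x. w x - s n x)"
      by (intro contr square_integrable_diff sq)
    finally show ?thesis by simp
  qed
  have "(\<lambda>n. norm2 N (\<lambda>x. w x - s (Suc n) x) + c * norm2 N (\<lambda>x. w x - s n x)) \<longlonglongrightarrow> 0 + c * 0"
    using lim unfolding s_def[symmetric] by (intro tendsto_intros LIMSEQ_Suc)
  then have "norm2 N d \<le> 0 + c * 0" by (rule LIMSEQ_le_const) (use d_le in auto)
  then have "norm2 N d = 0" using norm2_nonneg[of N d] by simp
  then have "AE x in N. d x = 0" by (rule norm2_eq_0_AE[OF d_sq])
  then have "AE x in N. w x = h x + iter_kop V w x"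
    by eventually_elim (simp add: d_def)
  then show ?thesis using that[OF w] by blast
qed

text \<open>Pairing the equation for the perturbed eigenfunction \<open>v\<close> with the unperturbed eigenfunction
  \<open>u\<close> and moving every kernel operator to the other side.\<close>

lemma eigenvalue_difference:
  assumes u: "square_integrable N u" and ub: "AE x in N. \<bar>u x\<bar> \<le> B"
    and eig: "AE x in N. kop u x = \<Lambda> * u x"
    and v: "square_integrable N v" and w: "square_integrable N w"
    and wv: "AE x in N. w x = l * v x"
    and eq: "AE x in N. w x = kop v x - kop (\<lambda>y. V y * kop v y) x + iter_kop V w x"
  shows "(l - \<Lambda>) * (LINT x|N. v x * u x) = - \<Lambda> * (LINT x|N. (V x * u x) * kop v x)
    + l * \<Lambda> * (LINT x|N. v x * (V x * kop (\<lambda>y. V y * u y) x))"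
proof -
  have [measurable]: "V \<in> borel_measurable N" "u \<in> borel_measurable N" "v \<in> borel_measurable N"
    "w \<in> borel_measurable N" using V u v w by auto
  have Vu: "square_integrable N (\<lambda>x. V x * u x)"
    using square_integrable_mult_bounded[OF V _ ub] by (simp add: mult.commute)
  have Vkv: "square_integrable N (\<lambda>x. V x * kop v x)"
    by (rule square_integrable_mult_kop[OF V v])
  have iw: "integrable N (\<lambda>x. iter_kop V w x * u x)" 
    by (intro square_integrable_mult_integrable square_integrable_iter_kop w u)
  have adj: "(LINT x|N. kop f x * u x) = \<Lambda> * (LINT x|N. f x * u x)" if f: "integrable N f" for f
  proof -
    have [measurable]: "f \<in> borel_measurable N" using f by simp
    have "(LINT x|N. kop f x * u x) = (LINT x|N. f x * kop u x)" by (rule kop_adjoint[OF f u])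
    also have "\<dots> = (LINT x|N. \<Lambda> * (f x * u x))"
      by (rule integral_cong_AE) (use eig in \<open>auto elim!: eventually_mono\<close>)
    finally show ?thesis by simp
  qed
  have Vw: "AE y in N. V y * w y = l * (V y * v y)" using wv by eventually_elim simp
  have kVw: "kop (\<lambda>y. V y * w y) x = l * kop (\<lambda>y. V y * v y) x" if "x \<in> space N" for x
    using kop_cong_AE[OF that Vw] by (simp add: kop_cmult)
  have 1: "(LINT x|N. w x * u x) = l * (LINT x|N. v x * u x)"
  proof -
    have "(LINT x|N. w x * u x) = (LINT x|N. l * (v x * u x))"
      by (rule integral_cong_AE) (use wv in \<open>auto elim!: eventually_mono\<close>)
    then show ?thesis by simp
  qed
  have "(LINT x|N. w x * u x)
      = (LINT x|N. (kop v x * u x - kop (\<lambda>y. V y * kop v y) x * u x) + iter_kop V w x * u x)"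
  proof (rule integral_cong_AE)
    show "AE x in N. w x * u x
        = (kop v x * u x - kop (\<lambda>y. V y * kop v y) x * u x) + iter_kop V w x * u x"
      using eq by eventually_elim (simp only: left_diff_distrib distrib_right)
  qed (use square_integrable_iter_kop[OF w] in auto)
  also have "\<dots> = (LINT x|N. kop v x * u x) - (LINT x|N. kop (\<lambda>y. V y * kop v y) x * u x)
      + (LINT x|N. iter_kop V w x * u x)"
    using iw square_integrable_mult_integrable[OF square_integrable_kop[OF v] u]
      square_integrable_mult_integrable[OF square_integrable_kop[OF Vkv] u]
    by simp
  also have "(LINT x|N. kop v x * u x) = \<Lambda> * (LINT x|N. v x * u x)"
    by (rule adj[OF square_integrable_integrable[OF v]])
  also have "(LINT x|N. kop (\<lambda>y. V y * kop v y) x * u x) = \<Lambda> * (LINT x|N. (V x * u x) * kop v x)"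
    using adj[OF square_integrable_integrable[OF Vkv]] by (simp add: mult_ac)
  also have "(LINT x|N. iter_kop V w x * u x)
      = \<Lambda> * (LINT x|N. (V x * kop (\<lambda>y. V y * w y) x) * u x)"
    unfolding iter_kop_def by (rule adj[OF integrable_mult_kop_mult[OF w]])
  also have "(LINT x|N. (V x * kop (\<lambda>y. V y * w y) x) * u x)
      = (LINT x|N. l * (kop (\<lambda>y. V y * v y) x * (V x * u x)))"
    by (rule Bochner_Integration.integral_cong) (auto simp: kVw)
  \<comment> \<open>\<open>V * v\<close> is only integrable, whereas \<open>V * u\<close> is square
    integrable because \<open>u\<close> is bounded; the operator can thus be moved from the former
    onto the latter.\<close>
  also have "\<dots> = l * (LINT x|N. (V x * v x) * kop (\<lambda>y. V y * u y) x)"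
    using kop_adjoint[OF square_integrable_mult_integrable[OF V v] Vu] by simp
  finally show ?thesis unfolding 1 by (simp add: algebra_simps)
qed

end

end

section \<open>From the abstract kernel operator to the Green operator\<close>

lemma iter_kop_green_op:
  assumes "symmetric_kernel (lborel_on D) G K"
  shows "symmetric_kernel.kop (lborel_on D) G = green_op D G"
    and "symmetric_kernel.iter_kop (lborel_on D) G V f
      = green_op D G (\<lambda>x. V x * green_op D G (\<lambda>y. V y * f y) x)"
  using symmetric_kernel.kop_def[OF assms] symmetric_kernel.iter_kop_def[OF assms]
  by (auto simp: green_op_def fun_eq_iff)

text \<open>Existence turns the choice made in \<open>perturbed_op\<close> into an actual solution.
  An infimum below 1 in \<open>L2_opnorm\<close> yields an admissible constant below 1, hence a
  contraction.\<close>

lemma perturbed_solution_exists: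
  assumes sk: "symmetric_kernel (lborel_on D) G K" and V: "V \<in> L2 D" and f: "f \<in> L2 D"
    and op: "L2_opnorm D (\<lambda>f. green_op D G (\<lambda>x. V x * green_op D G (\<lambda>y. V y * f y) x)) < 1"
  shows "\<exists>w. perturbed_solution D G V f w"
proof -
  interpret symmetric_kernel "lborel_on D" G K by fact
  note eqs = iter_kop_green_op[OF sk]
  have V: "square_integrable (lborel_on D) V" and f: "square_integrable (lborel_on D) f"
    using V f by (simp_all add: L2_iff_square_integrable)
  obtain c where c: "0 \<le> c" "c < 1"
    and contr: "\<And>g. square_integrable (lborel_on D) g \<Longrightarrow>
      norm2 (lborel_on D) (iter_kop V g) \<le> c * norm2 (lborel_on D) g"
    using op unfolding L2_opnorm_def Inf_less_iff
    by (auto simp: L2_iff_square_integrable L2_norm_eq_norm2 eqs ennreal_less_one_iff)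
  define h where "h x = kop f x - kop (\<lambda>y. V y * kop f y) x" for x
  have h: "square_integrable (lborel_on D) h"
    unfolding h_def
    by (intro square_integrable_diff square_integrable_kop f square_integrable_mult_kop V)
  from fixed_point_iter_kop[OF V h c contr] obtain w where
    "square_integrable (lborel_on D) w" "AE x in lborel_on D. w x = h x + iter_kop V w x" by blast
  then show ?thesis
    unfolding perturbed_solution_def h_def
    by (auto simp: L2_iff_square_integrable eqs intro!: exI[of _ w])
qed

text \<open>On a set of finite measure the pointwise inequality t^2 \<le> 1 + |t|^(2 + \<eta>) turns
  the bound with exponent 2 + \<eta> into a uniform L2 bound.\<close>

lemma symmetric_kernel_admissible:
  assumes ad: "admissible_kernel D G" and D: "D \<in> sets lborel" "emeasure lborel D < \<infinity>"
  obtains K where "symmetric_kernel (lborel_on D) G K"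
proof -
  interpret finite_measure "lborel_on D"
    using D by (intro finite_measureI) (auto simp: emeasure_restrict_space space_restrict_space)
  obtain \<eta> C where \<eta>: "\<eta> > 0" and
    i: "\<And>x. x \<in> D \<Longrightarrow> integrable (lborel_on D) (\<lambda>y. \<bar>G x y\<bar> powr (2 + \<eta>))" and
    C: "\<And>x. x \<in> D \<Longrightarrow> (LINT y|lborel_on D. \<bar>G x y\<bar> powr (2 + \<eta>)) \<le> C"
    and m [measurable]: "case_prod G \<in> borel_measurable (lborel_on D \<Otimes>\<^sub>M lborel_on D)"
    and pos: "\<And>x y. x \<in> D \<Longrightarrow> y \<in> D \<Longrightarrow> 0 \<le> G x y \<and> G x y = G y x"
    using ad unfolding admissible_kernel_def by blast
  have sp: "space (lborel_on D) = D" by (simp add: space_restrict_space)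
  have le: "t\<^sup>2 \<le> 1 + \<bar>t\<bar> powr (2 + \<eta>)" for t :: real
  proof (cases "\<bar>t\<bar> \<le> 1")
    case True
    then have "\<bar>t\<bar>\<^sup>2 \<le> 1" by (intro power_le_one) auto
    then have "t\<^sup>2 \<le> 1" unfolding power2_abs .
    moreover have "0 \<le> \<bar>t\<bar> powr (2 + \<eta>)" by (rule powr_ge_zero)
    ultimately show ?thesis by linarith
  next
    case False
    then have "\<bar>t\<bar> powr 2 \<le> \<bar>t\<bar> powr (2 + \<eta>)" using \<eta> by (intro powr_mono) auto
    moreover have "\<bar>t\<bar> powr 2 = t\<^sup>2" using powr_realpow[of "\<bar>t\<bar>" 2] False by simp
    ultimately show ?thesis by simp
  qed
  have meas [measurable]: "G x \<in> borel_measurable (lborel_on D)" if "x \<in> D" for x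
    using measurable_compose[OF measurable_Pair1'[of x "lborel_on D"] m] that by (simp add: sp)
  have int: "integrable (lborel_on D) (\<lambda>y. (G x y)\<^sup>2)" if x: "x \<in> D" for x
    by (rule Bochner_Integration.integrable_bound[of _ "\<lambda>y. 1 + \<bar>G x y\<bar> powr (2 + \<eta>)"])
      (use i[OF x] meas[OF x] le in \<open>auto\<close>)
  have bnd: "(LINT y|lborel_on D. (G x y)\<^sup>2) \<le> measure (lborel_on D) D + \<bar>C\<bar>" if x: "x \<in> D" for x
  proof -
    have "(LINT y|lborel_on D. (G x y)\<^sup>2) \<le> (LINT y|lborel_on D. 1 + \<bar>G x y\<bar> powr (2 + \<eta>))"
      by (intro integral_mono int x) (use i[OF x] le in auto)
    also have "\<dots> = measure (lborel_on D) D + (LINT y|lborel_on D. \<bar>G x y\<bar> powr (2 + \<eta>))"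
      using i[OF x] by (simp add: sp)
    finally show ?thesis using C[OF x] by linarith
  qed
  have "symmetric_kernel (lborel_on D) G (measure (lborel_on D) D + \<bar>C\<bar>)"
  proof
    show "case_prod G \<in> borel_measurable (lborel_on D \<Otimes>\<^sub>M lborel_on D)" by fact
  qed (use int bnd conjunct1[OF pos] conjunct2[OF pos] in \<open>simp_all add: sp\<close>)
  then show ?thesis by (rule that)
qed

section \<open>Moments of the random field\<close>

locale random_field = prob_space M for M :: "'w measure" +
  fixes q :: "'a::euclidean_space \<Rightarrow> 'w \<Rightarrow> real"
  assumes q_measurable [measurable]: "case_prod q \<in> borel_measurable (borel \<Otimes>\<^sub>M M)"
    and q_mean: "\<And>x. (LINT \<omega>|M. q x \<omega>) = 0"
    and q_stationary: "strictly_stationary M q"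
    and q_correlation: "integrable lborel (correlation M q)"
    and q_moment: "\<And>x. integrable M (\<lambda>\<omega>. (q x \<omega>) ^ 6)"
begin

lemma q_section [measurable]: "q x \<in> borel_measurable M"
proof -
  have "(\<lambda>\<omega>. case_prod q (x, \<omega>)) \<in> borel_measurable M" by measurable
  then show ?thesis by simp
qed

text \<open>Stationarity enters the development through pairs of values. The index set
  \<open>{x, y}\<close> may collapse to one point, which gives the one-point moments.\<close>

lemma stationary_two_point:
  assumes [measurable]: "case_prod g \<in> borel_measurable (borel \<Otimes>\<^sub>M borel)"
  shows "(LINT \<omega>|M. g (q (x + h) \<omega>) (q (y + h) \<omega>)) = (LINT \<omega>|M. (g (q x \<omega>) (q y \<omega>) :: real))"
proof -
  let ?P = "\<Pi>\<^sub>M z\<in>{x, y}. (borel :: real measure)"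
  define k where "k h \<omega> = (\<lambda>z\<in>{x, y}. q (z + h) \<omega>)" for h \<omega>
  have k [measurable]: "k h \<in> measurable M ?P" for h
    unfolding k_def by (intro measurable_restrict) measurable
  have [measurable]: "(\<lambda>p. p x) \<in> borel_measurable ?P" "(\<lambda>p. p y) \<in> borel_measurable ?P"
    by (auto intro!: measurable_component_singleton)
  have G [measurable]: "(\<lambda>p. g (p x) (p y)) \<in> borel_measurable ?P" by measurable
  have e: "(LINT \<omega>|M. g (q (x + h) \<omega>) (q (y + h) \<omega>)) = (LINT p|distr M ?P (k h). g (p x) (p y))" for h
    by (subst integral_distr[OF k G]) (simp add: k_def)
  have "distr M ?P (k h) = distr M ?P (k 0)"
    using q_stationary unfolding strictly_stationary_def k_def by (auto dest!: spec[of _ "{x, y}"])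
  then show ?thesis using e[of h] e[of 0] by simp
qed

definition moment :: "nat \<Rightarrow> real" where
  "moment k = (LINT \<omega>|M. \<bar>q 0 \<omega>\<bar> ^ k)"

lemma moment_nonneg: "0 \<le> moment k"
  by (simp add: moment_def)

lemma integrable_q_power:
  assumes "k \<le> 6"
  shows "integrable M (\<lambda>\<omega>. \<bar>q x \<omega>\<bar> ^ k)"
proof (rule Bochner_Integration.integrable_bound)
  show "integrable M (\<lambda>\<omega>. 1 + (q x \<omega>) ^ 6)" using q_moment by simp
  have "\<bar>t\<bar> ^ k \<le> 1 + \<bar>t\<bar> ^ 6" for t :: real
  proof (cases "\<bar>t\<bar> \<le> 1")
    case True
    then have "\<bar>t\<bar> ^ k \<le> 1" by (intro power_le_one) auto
    moreover have "0 \<le> \<bar>t\<bar> ^ 6" by simp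
    ultimately show ?thesis by linarith
  next
    case False
    then have "\<bar>t\<bar> ^ k \<le> \<bar>t\<bar> ^ 6" using assms by (intro power_increasing) auto
    then show ?thesis by simp
  qed
  then show "AE \<omega> in M. norm (\<bar>q x \<omega>\<bar> ^ k) \<le> norm (1 + (q x \<omega>) ^ 6)"
    by (auto intro!: AE_I2 simp: power_even_abs)
qed measurable

lemma moment_eq: "(LINT \<omega>|M. \<bar>q x \<omega>\<bar> ^ k) = moment k"
  using stationary_two_point[of "\<lambda>s t. \<bar>s\<bar> ^ k" 0 x 0] by (simp add: moment_def)

lemma square_integrable_q: "square_integrable M (q x)"
  using integrable_q_power[of 2 x] by (simp add: square_integrable_def)

lemma norm2_q: "norm2 M (q x) = sqrt (moment 2)"
  using moment_eq[of x 2] by (simp add: norm2_def)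

lemma correlation_eq: "(LINT \<omega>|M. q x \<omega> * q y \<omega>) = correlation M q (y - x)"
  using stationary_two_point[of "\<lambda>s t. s * t" 0 x "y - x"] by (simp add: correlation_def)

lemma correlation_measurable [measurable]: "correlation M q \<in> borel_measurable borel"
  using borel_measurable_integrable[OF q_correlation] by simp

lemma correlation_minus: "correlation M q (- x) = correlation M q x"
  using correlation_eq[of x 0] correlation_eq[of 0 x] by (simp add: mult.commute)

definition corr_mass :: real where
  "corr_mass = (LINT x|lborel. \<bar>correlation M q x\<bar>)"

lemma corr_mass_nonneg: "0 \<le> corr_mass"
  by (simp add: corr_mass_def)

lemma nn_integral_correlation_scaled:
  assumes "0 < \<epsilon>"
  shows "(\<integral>\<^sup>+y. ennreal \<bar>correlation M q ((x - y) /\<^sub>R \<epsilon>)\<bar> \<partial>lborel) = ennreal (\<epsilon> ^ DIM('a) * corr_mass)"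
proof -
  have [measurable]: "correlation M q \<in> borel_measurable lborel" by simp
  have "(\<integral>\<^sup>+y. ennreal \<bar>correlation M q ((x - y) /\<^sub>R \<epsilon>)\<bar> \<partial>lborel)
      = (\<integral>\<^sup>+y. ennreal \<bar>correlation M q ((x - y) /\<^sub>R \<epsilon>)\<bar>
          \<partial>density (distr lborel borel (\<lambda>z. x + (- \<epsilon>) *\<^sub>R z)) (\<lambda>_. ennreal (\<bar>- \<epsilon>\<bar> ^ DIM('a))))"
    using lborel_affine[of "- \<epsilon>" x] assms by simp
  also have "\<dots> = (\<integral>\<^sup>+z. ennreal (\<epsilon> ^ DIM('a)) * ennreal \<bar>correlation M q z\<bar> \<partial>lborel)"
    using assms by (simp add: nn_integral_density nn_integral_distr)
  also have "\<dots> = ennreal (\<epsilon> ^ DIM('a)) * (\<integral>\<^sup>+z. ennreal \<bar>correlation M q z\<bar> \<partial>lborel)"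
    by (rule nn_integral_cmult) simp
  also have "(\<integral>\<^sup>+z. ennreal \<bar>correlation M q z\<bar> \<partial>lborel) = ennreal corr_mass"
    unfolding corr_mass_def using q_correlation by (intro nn_integral_eq_integral) auto
  finally show ?thesis using assms corr_mass_nonneg by (simp add: ennreal_mult)
qed

end

section \<open>Oscillatory integrals of the rescaled field over \<open>D\<close>\<close>

locale random_field_on = random_field M q for M :: "'w measure" and q :: "'a::euclidean_space \<Rightarrow> 'w \<Rightarrow> real" +
  fixes D :: "'a set"
  assumes D_sets [measurable]: "D \<in> sets lborel" and D_finite: "emeasure lborel D < \<infinity>"
begin

abbreviation N where "N \<equiv> lborel_on D"

sublocale N: finite_measure N
  using D_sets D_finite
  by (intro finite_measureI) (auto simp: emeasure_restrict_space space_restrict_space)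

sublocale NM: pair_sigma_finite N M ..
sublocale NN: pair_sigma_finite N N ..

lemma space_N [simp]: "space N = D"
  by (simp add: space_restrict_space)

lemma D_sets_N [measurable, simp]: "D \<in> sets N"
  using sets.top[of N] by simp

abbreviation Q :: "real \<Rightarrow> 'a \<Rightarrow> 'w \<Rightarrow> real" where
  "Q \<epsilon> x \<omega> \<equiv> scaled_potential q \<epsilon> \<omega> x"

lemma Q_measurable [measurable]:
  "(\<lambda>p. Q \<epsilon> (fst p) (snd p)) \<in> borel_measurable (N \<Otimes>\<^sub>M M)"
  "(\<lambda>p. Q \<epsilon> (snd p) (fst p)) \<in> borel_measurable (M \<Otimes>\<^sub>M N)"
  "(\<lambda>\<omega>. Q \<epsilon> x \<omega>) \<in> borel_measurable M"
  "\<omega> \<in> space M \<Longrightarrow> scaled_potential q \<epsilon> \<omega> \<in> borel_measurable N"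
proof -
  have s: "(\<lambda>x. x /\<^sub>R \<epsilon>) \<in> measurable N borel"
    by (intro measurable_restrict_space1) simp
  have "(\<lambda>p. case_prod q (fst p /\<^sub>R \<epsilon>, snd p)) \<in> borel_measurable (N \<Otimes>\<^sub>M M)"
    by (intro measurable_compose[OF _ q_measurable] measurable_Pair measurable_compose[OF measurable_fst s]
        measurable_snd)
  then show *: "(\<lambda>p. Q \<epsilon> (fst p) (snd p)) \<in> borel_measurable (N \<Otimes>\<^sub>M M)"
    by (simp add: scaled_potential_def)
  show "(\<lambda>p. Q \<epsilon> (snd p) (fst p)) \<in> borel_measurable (M \<Otimes>\<^sub>M N)"
    using measurable_compose[OF measurable_pair_swap' *] by (simp add: case_prod_beta')
  show "(\<lambda>\<omega>. Q \<epsilon> x \<omega>) \<in> borel_measurable M"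
    by (simp add: scaled_potential_def)
  show "scaled_potential q \<epsilon> \<omega> \<in> borel_measurable N" if "\<omega> \<in> space M"
    using measurable_compose[OF measurable_Pair2'[of \<omega> M N] *] that by simp
qed

lemma square_integrable_Q: "square_integrable M (\<lambda>\<omega>. Q \<epsilon> x \<omega>)"
  using square_integrable_q by (simp add: scaled_potential_def)

lemma norm2_Q: "norm2 M (\<lambda>\<omega>. Q \<epsilon> x \<omega>) = sqrt (moment 2)"
  using norm2_q by (simp add: scaled_potential_def)

text \<open>A pathwise integral, with default value 0 at those \<omega> where the integrand is not
  integrable; for this reason additivity and its consequences hold almost surely only.\<close>

definition osc :: "real \<Rightarrow> ('a \<Rightarrow> real) \<Rightarrow> 'w \<Rightarrow> real" where
  "osc \<epsilon> g \<omega> = (LINT x|N. g x * Q \<epsilon> x \<omega>)"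

lemma osc_measurable [measurable]:
  assumes [measurable]: "g \<in> borel_measurable N"
  shows "osc \<epsilon> g \<in> borel_measurable M"
  unfolding osc_def
  by (rule N.borel_measurable_lebesgue_integral) (simp add: case_prod_beta')

text \<open>The second moment of \<open>Q \<epsilon> x\<close> does not depend on \<open>x\<close>,
  so Cauchy-Schwarz over \<open>M\<close> leaves an integrable function of \<open>x\<close>.
  \<open>H\<close> takes values in a Banach space in order that one Fubini statement covers real
  factors and the complex exponentials of characteristic functions.\<close>

lemma integrable_Q_scaleR:
  fixes H :: "'w \<Rightarrow> 'b::{banach, second_countable_topology}"
  assumes g: "integrable N g" and [measurable]: "H \<in> borel_measurable M"
    and H: "square_integrable M (\<lambda>\<omega>. norm (H \<omega>))"
  shows "integrable (N \<Otimes>\<^sub>M M) (\<lambda>(x, \<omega>). (g x * Q \<epsilon> x \<omega>) *\<^sub>R H \<omega>)"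
proof (rule NM.Fubini_integrable)
  have [measurable]: "g \<in> borel_measurable N" using g by simp
  have i: "integrable M (\<lambda>\<omega>. norm (Q \<epsilon> x \<omega> *\<^sub>R H \<omega>))"
    "(LINT \<omega>|M. norm (Q \<epsilon> x \<omega> *\<^sub>R H \<omega>)) \<le> sqrt (moment 2) * norm2 M (\<lambda>\<omega>. norm (H \<omega>))" for x
    using square_integrable_mult_integrable[OF square_integrable_abs[OF square_integrable_Q] H, of \<epsilon> x]
      integral_abs_mult_le_norm2[OF square_integrable_Q[of \<epsilon> x] H] norm2_Q[of \<epsilon> x] by (simp_all add: abs_mult)
  show "(\<lambda>(x, \<omega>). (g x * Q \<epsilon> x \<omega>) *\<^sub>R H \<omega>) \<in> borel_measurable (N \<Otimes>\<^sub>M M)"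
    by (simp add: case_prod_beta')
  have n: "norm ((g x * Q \<epsilon> x \<omega>) *\<^sub>R H \<omega>) = \<bar>g x\<bar> * norm (Q \<epsilon> x \<omega> *\<^sub>R H \<omega>)" for x \<omega>
    by (simp add: abs_mult)
  show "integrable N (\<lambda>x. LINT \<omega>|M. norm (case (x, \<omega>) of (x, \<omega>) \<Rightarrow> (g x * Q \<epsilon> x \<omega>) *\<^sub>R H \<omega>))"
    unfolding prod.case n
  proof (rule Bochner_Integration.integrable_bound)
    show "integrable N (\<lambda>x. \<bar>g x\<bar> * (sqrt (moment 2) * norm2 M (\<lambda>\<omega>. norm (H \<omega>))))"
      using g by simp
    show "(\<lambda>x. LINT \<omega>|M. \<bar>g x\<bar> * norm (Q \<epsilon> x \<omega> *\<^sub>R H \<omega>)) \<in> borel_measurable N"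
      by (rule borel_measurable_lebesgue_integral) (simp add: case_prod_beta')
    show "AE x in N. norm (LINT \<omega>|M. \<bar>g x\<bar> * norm (Q \<epsilon> x \<omega> *\<^sub>R H \<omega>))
        \<le> norm (\<bar>g x\<bar> * (sqrt (moment 2) * norm2 M (\<lambda>\<omega>. norm (H \<omega>))))"
      using i(2) moment_nonneg
      by (auto intro!: AE_I2 mult_left_mono simp: abs_mult simp del: norm_scaleR)
  qed
  show "AE x in N. integrable M (\<lambda>\<omega>. case (x, \<omega>) of (x, \<omega>) \<Rightarrow> (g x * Q \<epsilon> x \<omega>) *\<^sub>R H \<omega>)"
  proof (rule AE_I2)
    fix x assume "x \<in> space N"
    show "integrable M (\<lambda>\<omega>. case (x, \<omega>) of (x, \<omega>) \<Rightarrow> (g x * Q \<epsilon> x \<omega>) *\<^sub>R H \<omega>)"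
      by (rule Bochner_Integration.integrable_bound[OF integrable_mult_right[OF i(1), of "g x" x]])
        (auto intro!: AE_I2 simp: abs_mult)
  qed
qed

lemma AE_integrable_Q:
  assumes g: "integrable N g"
  shows "AE \<omega> in M. integrable N (\<lambda>x. g x * Q \<epsilon> x \<omega>)"
  using NM.AE_integrable_snd[OF integrable_Q_scaleR[OF g, of "\<lambda>_. 1::real" \<epsilon>]]
  by (simp add: square_integrable_def)

lemma osc_scaleR:
  fixes H :: "'w \<Rightarrow> 'b::{banach, second_countable_topology}"
  assumes g: "integrable N g" and H: "H \<in> borel_measurable M" "square_integrable M (\<lambda>\<omega>. norm (H \<omega>))"
  shows "integrable M (\<lambda>\<omega>. osc \<epsilon> g \<omega> *\<^sub>R H \<omega>)"
    and "(LINT \<omega>|M. osc \<epsilon> g \<omega> *\<^sub>R H \<omega>) = (LINT x|N. g x *\<^sub>R (LINT \<omega>|M. Q \<epsilon> x \<omega> *\<^sub>R H \<omega>))"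
proof -
  have [measurable]: "H \<in> borel_measurable M" "g \<in> borel_measurable N" using g H by auto
  note i = integrable_Q_scaleR[OF g H, of \<epsilon>]
  have e: "AE \<omega> in M. (LINT x|N. (g x * Q \<epsilon> x \<omega>) *\<^sub>R H \<omega>) = osc \<epsilon> g \<omega> *\<^sub>R H \<omega>"
    using AE_integrable_Q[OF g, of \<epsilon>] by eventually_elim (simp add: osc_def)
  have m: "(\<lambda>\<omega>. LINT x|N. (g x * Q \<epsilon> x \<omega>) *\<^sub>R H \<omega>) \<in> borel_measurable M"
    by (rule N.borel_measurable_lebesgue_integral) (simp add: case_prod_beta')
  have "integrable M (\<lambda>\<omega>. LINT x|N. (g x * Q \<epsilon> x \<omega>) *\<^sub>R H \<omega>)"
    using NM.integrable_snd[OF i] by simp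
  then show "integrable M (\<lambda>\<omega>. osc \<epsilon> g \<omega> *\<^sub>R H \<omega>)"
    by (subst integrable_cong_AE[OF _ m]) (use e in \<open>auto elim!: eventually_mono\<close>)
  have "(LINT \<omega>|M. osc \<epsilon> g \<omega> *\<^sub>R H \<omega>) = (LINT \<omega>|M. LINT x|N. (g x * Q \<epsilon> x \<omega>) *\<^sub>R H \<omega>)"
    by (rule integral_cong_AE[OF _ m]) (use e in \<open>auto elim!: eventually_mono\<close>)
  also have "\<dots> = (LINT x|N. LINT \<omega>|M. (g x * Q \<epsilon> x \<omega>) *\<^sub>R H \<omega>)"
    by (rule NM.Fubini_integral[OF i])
  finally show "(LINT \<omega>|M. osc \<epsilon> g \<omega> *\<^sub>R H \<omega>) = (LINT x|N. g x *\<^sub>R (LINT \<omega>|M. Q \<epsilon> x \<omega> *\<^sub>R H \<omega>))"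
    by (simp add: scaleR_scaleR[symmetric] del: scaleR_scaleR)
qed

text \<open>The mixed product is dominated by the two pure powers of degree \<open>p + 2\<close>;
  \<open>p \<le> 4\<close> keeps the degree within the six available moments.\<close>

lemma integrable_weighted_Q_power2:
  assumes "p \<le> 4" and [measurable]: "A \<in> sets N"
  shows "integrable (N \<Otimes>\<^sub>M M) (\<lambda>(y, \<omega>). indicator A y * (\<bar>Q \<epsilon> x \<omega>\<bar> ^ p * (Q \<epsilon> y \<omega>)\<^sup>2))"
    and "(LINT \<omega>|M. LINT y|N. indicator A y * (\<bar>Q \<epsilon> x \<omega>\<bar> ^ p * (Q \<epsilon> y \<omega>)\<^sup>2))
      \<le> measure N A * (2 * moment (p + 2))"
proof -
  have b: "\<bar>s\<bar> ^ p * t\<^sup>2 \<le> \<bar>s\<bar> ^ (p + 2) + \<bar>t\<bar> ^ (p + 2)" for s t :: real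
  proof (cases "\<bar>s\<bar> \<le> \<bar>t\<bar>")
    case True
    then have "\<bar>s\<bar> ^ p * \<bar>t\<bar>\<^sup>2 \<le> \<bar>t\<bar> ^ p * \<bar>t\<bar>\<^sup>2" by (intro mult_right_mono power_mono) auto
    then have "\<bar>s\<bar> ^ p * \<bar>t\<bar>\<^sup>2 \<le> \<bar>t\<bar> ^ (p + 2)" unfolding power_add .
    moreover have "0 \<le> \<bar>s\<bar> ^ (p + 2)" by simp
    ultimately show ?thesis unfolding power2_abs by linarith
  next
    case False
    then have "\<bar>s\<bar> ^ p * \<bar>t\<bar>\<^sup>2 \<le> \<bar>s\<bar> ^ p * \<bar>s\<bar>\<^sup>2" by (intro mult_left_mono power_mono) auto
    then have "\<bar>s\<bar> ^ p * \<bar>t\<bar>\<^sup>2 \<le> \<bar>s\<bar> ^ (p + 2)" unfolding power_add .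
    moreover have "0 \<le> \<bar>t\<bar> ^ (p + 2)" by simp
    ultimately show ?thesis unfolding power2_abs by linarith
  qed
  have iq: "integrable M (\<lambda>\<omega>. \<bar>Q \<epsilon> x \<omega>\<bar> ^ (p + 2))" for x
    unfolding scaled_potential_def using assms by (intro integrable_q_power) auto
  have mq: "(LINT \<omega>|M. \<bar>Q \<epsilon> x \<omega>\<bar> ^ (p + 2)) = moment (p + 2)" for x
    unfolding scaled_potential_def by (rule moment_eq)
  have i: "integrable M (\<lambda>\<omega>. \<bar>Q \<epsilon> x \<omega>\<bar> ^ p * (Q \<epsilon> y \<omega>)\<^sup>2)" for y
    by (rule Bochner_Integration.integrable_bound[OF Bochner_Integration.integrable_add[OF iq[of x] iq[of y]]])
      (use b in \<open>auto intro!: AE_I2\<close>)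
  have i2: "(LINT \<omega>|M. \<bar>Q \<epsilon> x \<omega>\<bar> ^ p * (Q \<epsilon> y \<omega>)\<^sup>2) \<le> 2 * moment (p + 2)" for y
  proof -
    have "(LINT \<omega>|M. \<bar>Q \<epsilon> x \<omega>\<bar> ^ p * (Q \<epsilon> y \<omega>)\<^sup>2)
        \<le> (LINT \<omega>|M. \<bar>Q \<epsilon> x \<omega>\<bar> ^ (p + 2) + \<bar>Q \<epsilon> y \<omega>\<bar> ^ (p + 2))"
      by (intro integral_mono i Bochner_Integration.integrable_add iq b)
    also have "\<dots> = 2 * moment (p + 2)" using iq mq by simp
    finally show ?thesis .
  qed
  have pos: "0 \<le> (LINT \<omega>|M. \<bar>Q \<epsilon> x \<omega>\<bar> ^ p * (Q \<epsilon> y \<omega>)\<^sup>2)" for y by simp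
  have im: "(\<lambda>y. LINT \<omega>|M. \<bar>Q \<epsilon> x \<omega>\<bar> ^ p * (Q \<epsilon> y \<omega>)\<^sup>2) \<in> borel_measurable N"
    by (rule borel_measurable_lebesgue_integral) (simp add: case_prod_beta')
  have im': "integrable N (\<lambda>y. indicator A y * (LINT \<omega>|M. \<bar>Q \<epsilon> x \<omega>\<bar> ^ p * (Q \<epsilon> y \<omega>)\<^sup>2))"
    by (rule Bochner_Integration.integrable_bound[of N "\<lambda>_. 2 * moment (p + 2)"])
      (use i2 pos im moment_nonneg in \<open>auto intro!: AE_I2 simp: indicator_def\<close>)
  show int: "integrable (N \<Otimes>\<^sub>M M) (\<lambda>(y, \<omega>). indicator A y * (\<bar>Q \<epsilon> x \<omega>\<bar> ^ p * (Q \<epsilon> y \<omega>)\<^sup>2))"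
  proof (rule NM.Fubini_integrable)
    show "integrable N (\<lambda>y. LINT \<omega>|M. norm (case (y, \<omega>) of (y, \<omega>) \<Rightarrow> indicator A y * (\<bar>Q \<epsilon> x \<omega>\<bar> ^ p * (Q \<epsilon> y \<omega>)\<^sup>2)))"
      using im' by (simp add: abs_mult)
  qed (use i in \<open>auto simp: case_prod_beta'\<close>)
  have "(LINT \<omega>|M. LINT y|N. indicator A y * (\<bar>Q \<epsilon> x \<omega>\<bar> ^ p * (Q \<epsilon> y \<omega>)\<^sup>2))
      = (LINT y|N. LINT \<omega>|M. indicator A y * (\<bar>Q \<epsilon> x \<omega>\<bar> ^ p * (Q \<epsilon> y \<omega>)\<^sup>2))"
    by (rule NM.Fubini_integral[OF int])
  also have "\<dots> = (LINT y|N. indicator A y * (LINT \<omega>|M. \<bar>Q \<epsilon> x \<omega>\<bar> ^ p * (Q \<epsilon> y \<omega>)\<^sup>2))" by simp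
  also have "\<dots> \<le> (LINT y|N. indicator A y * (2 * moment (p + 2)))"
  proof (intro integral_mono im')
    show "integrable N (\<lambda>y. indicator A y * (2 * moment (p + 2)))"
      by (intro integrable_mult_left integrable_real_indicator) (auto simp: less_top[symmetric])
  qed (use i2 in \<open>auto simp: indicator_def\<close>)
  also have "\<dots> = measure N A * (2 * moment (p + 2))" 
    using sets.sets_into_space[OF assms(2)] by (simp add: Int_absorb2)
  finally show "(LINT \<omega>|M. LINT y|N. indicator A y * (\<bar>Q \<epsilon> x \<omega>\<bar> ^ p * (Q \<epsilon> y \<omega>)\<^sup>2))
      \<le> measure N A * (2 * moment (p + 2))" .
qed

lemma AE_square_integrable_Q: "AE \<omega> in M. square_integrable N (scaled_potential q \<epsilon> \<omega>)"
proof -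
  have "AE \<omega> in M. integrable N (\<lambda>y. indicator (space N) y * (\<bar>Q \<epsilon> 0 \<omega>\<bar> ^ 0 * (Q \<epsilon> y \<omega>)\<^sup>2))"
    using NM.AE_integrable_snd[OF integrable_weighted_Q_power2(1)[of 0 "space N" \<epsilon> 0]] by simp
  then show ?thesis using AE_space
  proof eventually_elim
    case (elim \<omega>)
    then have "integrable N (\<lambda>y. (Q \<epsilon> y \<omega>)\<^sup>2)"
      by (subst Bochner_Integration.integrable_cong[OF refl, of _ _ "\<lambda>y. indicator (space N) y * (\<bar>Q \<epsilon> 0 \<omega>\<bar> ^ 0 * (Q \<epsilon> y \<omega>)\<^sup>2)"])
        (auto simp: indicator_def)
    then show ?case using elim by (simp add: square_integrable_def)
  qed
qed

text \<open>Cauchy-Schwarz in the space variable, path by path, without exploiting cancellation in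
  \<open>q\<close>. The support \<open>A\<close> is tracked because its measure is what makes the
  contribution of a small ball small.\<close>

lemma osc_weighted:
  assumes g: "square_integrable N g" and A [measurable]: "A \<in> sets N" and gA: "\<And>x. x \<in> D \<Longrightarrow> x \<notin> A \<Longrightarrow> g x = 0"
    and p: "p \<le> 4"
  shows "integrable M (\<lambda>\<omega>. \<bar>Q \<epsilon> x \<omega>\<bar> ^ p * (osc \<epsilon> g \<omega>)\<^sup>2)"
    and "(LINT \<omega>|M. \<bar>Q \<epsilon> x \<omega>\<bar> ^ p * (osc \<epsilon> g \<omega>)\<^sup>2)
      \<le> (LINT x|N. (g x)\<^sup>2) * (measure N A * (2 * moment (p + 2)))"
proof -
  have [measurable]: "g \<in> borel_measurable N" using g by simp
  let ?F = "\<lambda>\<omega>. LINT y|N. indicator A y * (\<bar>Q \<epsilon> x \<omega>\<bar> ^ p * (Q \<epsilon> y \<omega>)\<^sup>2)"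
  have le: "AE \<omega> in M. \<bar>Q \<epsilon> x \<omega>\<bar> ^ p * (osc \<epsilon> g \<omega>)\<^sup>2 \<le> (LINT x|N. (g x)\<^sup>2) * ?F \<omega>"
    using AE_square_integrable_Q[of \<epsilon>] AE_space
  proof eventually_elim
    case (elim \<omega>)
    have sq: "square_integrable N (\<lambda>y. indicator A y * Q \<epsilon> y \<omega>)"
      by (rule square_integrable_mult_bounded[OF elim(1), of _ 1]) (auto simp: indicator_def)
    have "osc \<epsilon> g \<omega> = (LINT y|N. g y * (indicator A y * Q \<epsilon> y \<omega>))"
      unfolding osc_def by (rule Bochner_Integration.integral_cong) (use gA in \<open>auto simp: indicator_def\<close>)
    then have "\<bar>osc \<epsilon> g \<omega>\<bar>\<^sup>2 \<le> (norm2 N g * norm2 N (\<lambda>y. indicator A y * Q \<epsilon> y \<omega>))\<^sup>2"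
      using abs_integral_mult_le_norm2[OF g sq] by (intro power_mono) auto
    also have "\<dots> = (LINT x|N. (g x)\<^sup>2) * (LINT y|N. indicator A y * (Q \<epsilon> y \<omega>)\<^sup>2)"
    proof -
      have "(\<lambda>y. (indicator A y * Q \<epsilon> y \<omega>)\<^sup>2) = (\<lambda>y. indicator A y * (Q \<epsilon> y \<omega>)\<^sup>2)"
        by (auto simp: indicator_def)
      then show ?thesis by (simp add: power_mult_distrib norm2_power2)
    qed
    finally have "\<bar>Q \<epsilon> x \<omega>\<bar> ^ p * \<bar>osc \<epsilon> g \<omega>\<bar>\<^sup>2
        \<le> \<bar>Q \<epsilon> x \<omega>\<bar> ^ p * ((LINT x|N. (g x)\<^sup>2) * (LINT y|N. indicator A y * (Q \<epsilon> y \<omega>)\<^sup>2))"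
      by (rule mult_left_mono) simp
    moreover have "?F \<omega> = \<bar>Q \<epsilon> x \<omega>\<bar> ^ p * (LINT y|N. indicator A y * (Q \<epsilon> y \<omega>)\<^sup>2)"
      by (subst mult.left_commute) simp
    ultimately show ?case by (simp add: mult_ac)
  qed
  have i: "integrable M ?F"
    using NM.integrable_snd[OF integrable_weighted_Q_power2(1)[OF p A]] by simp
  show int: "integrable M (\<lambda>\<omega>. \<bar>Q \<epsilon> x \<omega>\<bar> ^ p * (osc \<epsilon> g \<omega>)\<^sup>2)"
  proof (rule Bochner_Integration.integrable_bound[OF integrable_mult_right[OF i, of "LINT x|N. (g x)\<^sup>2"]])
    show "AE \<omega> in M. norm (\<bar>Q \<epsilon> x \<omega>\<bar> ^ p * (osc \<epsilon> g \<omega>)\<^sup>2) \<le> norm ((LINT x|N. (g x)\<^sup>2) * ?F \<omega>)"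
      using le by eventually_elim (simp add: abs_mult)
  qed measurable
  have "(LINT \<omega>|M. \<bar>Q \<epsilon> x \<omega>\<bar> ^ p * (osc \<epsilon> g \<omega>)\<^sup>2) \<le> (LINT \<omega>|M. (LINT x|N. (g x)\<^sup>2) * ?F \<omega>)"
    by (rule integral_mono_AE[OF int integrable_mult_right[OF i] le])
  also have "\<dots> = (LINT x|N. (g x)\<^sup>2) * (LINT \<omega>|M. ?F \<omega>)" by simp
  also have "\<dots> \<le> (LINT x|N. (g x)\<^sup>2) * (measure N A * (2 * moment (p + 2)))"
    by (intro mult_left_mono integrable_weighted_Q_power2(2) p A) simp
  finally show "(LINT \<omega>|M. \<bar>Q \<epsilon> x \<omega>\<bar> ^ p * (osc \<epsilon> g \<omega>)\<^sup>2)
      \<le> (LINT x|N. (g x)\<^sup>2) * (measure N A * (2 * moment (p + 2)))" .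
qed

lemma square_integrable_osc:
  assumes g: "square_integrable N g"
  shows "square_integrable M (osc \<epsilon> g)"
  using osc_weighted(1)[OF g, of "space N" 0 \<epsilon>] osc_measurable[OF square_integrable_measurable[OF g]]
  by (simp add: square_integrable_def)

lemma expectation_Q_osc:
  assumes g: "integrable N g"
  shows "(LINT \<omega>|M. Q \<epsilon> x \<omega> * osc \<epsilon> g \<omega>) = (LINT y|N. g y * correlation M q ((x - y) /\<^sub>R \<epsilon>))"
proof -
  have "(LINT \<omega>|M. Q \<epsilon> x \<omega> * osc \<epsilon> g \<omega>) = (LINT \<omega>|M. osc \<epsilon> g \<omega> * Q \<epsilon> x \<omega>)"
    by (simp add: mult.commute)
  also have "\<dots> = (LINT y|N. g y * (LINT \<omega>|M. Q \<epsilon> y \<omega> * Q \<epsilon> x \<omega>))"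
    using osc_scaleR(2)[OF g, of "\<lambda>\<omega>. Q \<epsilon> x \<omega>" \<epsilon>] square_integrable_abs[OF square_integrable_Q] by simp
  also have "\<dots> = (LINT y|N. g y * correlation M q ((x - y) /\<^sub>R \<epsilon>))"
    by (simp add: scaled_potential_def correlation_eq scaleR_diff_right)
  finally show ?thesis .
qed

lemma integrable_correlation_scaled:
  assumes "0 < \<epsilon>"
  shows "integrable N (\<lambda>y. \<bar>correlation M q ((x - y) /\<^sub>R \<epsilon>)\<bar>)"
    and "(LINT y|N. \<bar>correlation M q ((x - y) /\<^sub>R \<epsilon>)\<bar>) \<le> \<epsilon> ^ DIM('a) * corr_mass"
proof -
  have m: "(\<lambda>y. \<bar>correlation M q ((x - y) /\<^sub>R \<epsilon>)\<bar>) \<in> borel_measurable N"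
    by (intro measurable_restrict_space1) simp
  have "(\<integral>\<^sup>+y. ennreal \<bar>correlation M q ((x - y) /\<^sub>R \<epsilon>)\<bar> \<partial>N)
      \<le> (\<integral>\<^sup>+y. ennreal \<bar>correlation M q ((x - y) /\<^sub>R \<epsilon>)\<bar> \<partial>lborel)"
    using D_sets by (auto simp: nn_integral_restrict_space indicator_def intro!: nn_integral_mono)
  then have le: "(\<integral>\<^sup>+y. ennreal \<bar>correlation M q ((x - y) /\<^sub>R \<epsilon>)\<bar> \<partial>N) \<le> ennreal (\<epsilon> ^ DIM('a) * corr_mass)"
    unfolding nn_integral_correlation_scaled[OF assms] .
  then have f: "(\<integral>\<^sup>+y. ennreal \<bar>correlation M q ((x - y) /\<^sub>R \<epsilon>)\<bar> \<partial>N) < \<infinity>"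
    by (rule le_less_trans) simp
  then show int: "integrable N (\<lambda>y. \<bar>correlation M q ((x - y) /\<^sub>R \<epsilon>)\<bar>)"
    using m by (intro integrableI_bounded) auto
  show "(LINT y|N. \<bar>correlation M q ((x - y) /\<^sub>R \<epsilon>)\<bar>) \<le> \<epsilon> ^ DIM('a) * corr_mass"
    using le nn_integral_eq_integral[OF int] assms corr_mass_nonneg by (simp add: ennreal_le_iff)
qed

text \<open>Schur's test for the covariance kernel; the factor \<open>\<epsilon> ^ DIM('a)\<close> is the Jacobian.\<close>

lemma osc_variance:
  assumes g: "square_integrable N g" and \<epsilon>: "0 < \<epsilon>"
  shows "(LINT \<omega>|M. (osc \<epsilon> g \<omega>)\<^sup>2) \<le> \<epsilon> ^ DIM('a) * corr_mass * (LINT x|N. (g x)\<^sup>2)"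
proof -
  have [measurable]: "g \<in> borel_measurable N" using g by simp
  define k where "k x y = \<bar>correlation M q ((x - y) /\<^sub>R \<epsilon>)\<bar>" for x y
  define c where "c = \<epsilon> ^ DIM('a) * corr_mass"
  have k_sym: "k x y = k y x" for x y
    using correlation_minus[of "(x - y) /\<^sub>R \<epsilon>"] by (simp add: k_def algebra_simps)
  have k_int: "integrable N (k x)" "(LINT y|N. k x y) \<le> c" for x
    unfolding k_def c_def using integrable_correlation_scaled[OF \<epsilon>] by auto
  have id: "(\<lambda>x. x) \<in> measurable N borel" by (intro measurable_restrict_space1) simp
  have rho_meas [measurable]: "(\<lambda>p. correlation M q ((fst p - snd p) /\<^sub>R \<epsilon>)) \<in> borel_measurable (N \<Otimes>\<^sub>M N)"
    using measurable_compose[OF measurable_fst id, of N] measurable_compose[OF measurable_snd id, of N]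
    by measurable
  then have [measurable]: "(\<lambda>p. k (fst p) (snd p)) \<in> borel_measurable (N \<Otimes>\<^sub>M N)"
    unfolding k_def by measurable
  have i1: "integrable (N \<Otimes>\<^sub>M N) (\<lambda>(x, y). (g x)\<^sup>2 * k x y)"
  proof (rule NN.Fubini_integrable)
    have kpos: "0 \<le> k x y" for x y by (simp add: k_def)
    have km: "(\<lambda>x. LINT y|N. k x y) \<in> borel_measurable N"
      by (rule N.borel_measurable_lebesgue_integral) (simp add: case_prod_beta')
    show "integrable N (\<lambda>x. LINT y|N. norm (case (x, y) of (x, y) \<Rightarrow> (g x)\<^sup>2 * k x y))"
    proof (rule Bochner_Integration.integrable_bound[OF integrable_mult_left[OF square_integrable_power2[OF g], of c]])
      show "AE x in N. norm (LINT y|N. norm (case (x, y) of (x, y) \<Rightarrow> (g x)\<^sup>2 * k x y)) \<le> norm ((g x)\<^sup>2 * c)"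
      proof (rule AE_I2)
        fix x
        have "(LINT y|N. norm (case (x, y) of (x, y) \<Rightarrow> (g x)\<^sup>2 * k x y)) = (g x)\<^sup>2 * (LINT y|N. k x y)"
          using kpos by (simp add: abs_mult)
        moreover have "\<bar>(g x)\<^sup>2 * (LINT y|N. k x y)\<bar> \<le> \<bar>(g x)\<^sup>2 * c\<bar>"
          using k_int(2)[of x] Bochner_Integration.integral_nonneg[of N "k x"] kpos by (auto simp: abs_mult intro!: mult_left_mono)
        ultimately show "norm (LINT y|N. norm (case (x, y) of (x, y) \<Rightarrow> (g x)\<^sup>2 * k x y)) \<le> norm ((g x)\<^sup>2 * c)"
          by simp
      qed
      show "(\<lambda>x. LINT y|N. norm (case (x, y) of (x, y) \<Rightarrow> (g x)\<^sup>2 * k x y)) \<in> borel_measurable N"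
        using km kpos by (simp add: abs_mult)
    qed
  qed (use k_int in \<open>auto simp: case_prod_beta'\<close>)
  have i2: "integrable (N \<Otimes>\<^sub>M N) (\<lambda>(x, y). (g y)\<^sup>2 * k x y)"
    using NN.integrable_product_swap[OF i1] by (simp add: case_prod_beta' k_sym)
  have e2: "(LINT p|(N \<Otimes>\<^sub>M N). (\<lambda>(x, y). (g y)\<^sup>2 * k x y) p) = (LINT p|(N \<Otimes>\<^sub>M N). (\<lambda>(x, y). (g x)\<^sup>2 * k x y) p)"
    using NN.integral_product_swap[of "\<lambda>(x, y). (g x)\<^sup>2 * k x y"] by (simp add: case_prod_beta' k_sym)
  have e1: "(LINT p|(N \<Otimes>\<^sub>M N). (\<lambda>(x, y). (g x)\<^sup>2 * k x y) p) \<le> c * (LINT x|N. (g x)\<^sup>2)"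
  proof -
    have "(LINT p|(N \<Otimes>\<^sub>M N). (\<lambda>(x, y). (g x)\<^sup>2 * k x y) p) = (LINT x|N. LINT y|N. (g x)\<^sup>2 * k x y)"
      using NN.integral_fst'[OF i1] by simp
    also have "\<dots> = (LINT x|N. (g x)\<^sup>2 * (LINT y|N. k x y))" by simp
    also have "\<dots> \<le> (LINT x|N. (g x)\<^sup>2 * c)"
      by (intro integral_mono mult_left_mono k_int integrable_mult_left square_integrable_power2 g)
        (use NN.integrable_fst'[OF i1] in \<open>auto\<close>)
    finally show ?thesis by (simp add: mult.commute)
  qed
  let ?f = "\<lambda>(x, y). g x * (g y * correlation M q ((x - y) /\<^sub>R \<epsilon>))"
  let ?h = "\<lambda>p. ((\<lambda>(x, y). (g x)\<^sup>2 * k x y) p + (\<lambda>(x, y). (g y)\<^sup>2 * k x y) p) / 2"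
  have le: "\<bar>?f p\<bar> \<le> ?h p" for p
  proof (cases p)
    case (Pair x y)
    have "2 * (\<bar>g x\<bar> * \<bar>g y\<bar>) \<le> (g x)\<^sup>2 + (g y)\<^sup>2"
      using zero_le_power2[of "\<bar>g x\<bar> - \<bar>g y\<bar>"] by (simp add: power2_diff)
    then have "2 * (\<bar>g x\<bar> * \<bar>g y\<bar>) * k x y \<le> ((g x)\<^sup>2 + (g y)\<^sup>2) * k x y"
      by (rule mult_right_mono) (simp add: k_def)
    then show ?thesis using Pair by (simp add: abs_mult k_def algebra_simps)
  qed
  have ih: "integrable (N \<Otimes>\<^sub>M N) ?h" using i1 i2 by auto
  have if': "integrable (N \<Otimes>\<^sub>M N) ?f"
  proof (rule Bochner_Integration.integrable_bound[OF ih])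
    show "AE p in N \<Otimes>\<^sub>M N. norm (?f p) \<le> norm (?h p)"
      unfolding real_norm_def by (intro AE_I2 order_trans[OF le abs_ge_self])
  qed (simp add: case_prod_beta')
  have "(LINT \<omega>|M. (osc \<epsilon> g \<omega>)\<^sup>2) = (LINT x|N. g x * (LINT \<omega>|M. Q \<epsilon> x \<omega> * osc \<epsilon> g \<omega>))"
    using osc_scaleR(2)[OF N.square_integrable_integrable[OF g], of "osc \<epsilon> g" \<epsilon>]
      square_integrable_abs[OF square_integrable_osc[OF g]] by (simp add: power2_eq_square)
  also have "\<dots> = (LINT x|N. LINT y|N. g x * (g y * correlation M q ((x - y) /\<^sub>R \<epsilon>)))"
    using expectation_Q_osc[OF N.square_integrable_integrable[OF g]] by simp
  also have "\<dots> = (LINT p|(N \<Otimes>\<^sub>M N). ?f p)" using NN.integral_fst'[OF if'] by simp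
  also have "\<dots> \<le> (LINT p|(N \<Otimes>\<^sub>M N). ?h p)"
    by (intro integral_mono if' ih order_trans[OF abs_ge_self le])
  also have "\<dots> = (LINT p|(N \<Otimes>\<^sub>M N). (\<lambda>(x, y). (g x)\<^sup>2 * k x y) p)"
    using i1 i2 e2 by simp
  also have "\<dots> \<le> c * (LINT x|N. (g x)\<^sup>2)" by (rule e1)
  finally show ?thesis by (simp add: c_def)
qed

end

section \<open>Mixing\<close>

context random_field begin

lemma sigma_generated_subalgebra: "subalgebra M (sigma_generated M q S)"
  unfolding subalgebra_def
proof
  show "space (sigma_generated M q S) = space M"
    by (simp add: sigma_generated_def)
  show "sets (sigma_generated M q S) \<subseteq> sets M"
    unfolding sigma_generated_def
  proof (rule sets_image_in_sets[OF refl])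
    show "(\<lambda>\<omega>. \<lambda>x\<in>S. q x \<omega>) \<in> measurable M (\<Pi>\<^sub>M x\<in>S. borel)"
      by (intro measurable_restrict) measurable
  qed
qed

lemma q_sigma_generated:
  assumes "x \<in> S"
  shows "q x \<in> borel_measurable (sigma_generated M q S)"
proof -
  have 1: "(\<lambda>\<omega>. \<lambda>x\<in>S. q x \<omega>) \<in> measurable (sigma_generated M q S) (\<Pi>\<^sub>M x\<in>S. borel)"
    unfolding sigma_generated_def
    by (rule measurable_vimage_algebra1) (auto simp: space_PiM)
  have "(\<lambda>\<omega>. (\<lambda>x\<in>S. q x \<omega>) x) \<in> borel_measurable (sigma_generated M q S)"
    by (rule measurable_compose[OF 1 measurable_component_singleton[OF assms]])
  then show ?thesis using assms by simp
qed

end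

text \<open>An oscillatory integral is not literally measurable with respect to the \<open>\<sigma>\<close>-algebra of the
  values of \<open>q\<close> on the relevant set, but it agrees almost surely with its conditional expectation:
  the residual is orthogonal to every \<open>q x\<close>, hence to the integral.\<close>

lemma (in random_field_on) osc_version:
  assumes g: "square_integrable N g" and S: "\<And>x. x \<in> D \<Longrightarrow> g x \<noteq> 0 \<Longrightarrow> x /\<^sub>R \<epsilon> \<in> S"
  obtains J where "J \<in> borel_measurable (sigma_generated M q S)" "AE \<omega> in M. osc \<epsilon> g \<omega> = J \<omega>"
proof -
  define F where "F = sigma_generated M q S"
  interpret F: finite_measure_subalgebra M F
    by unfold_locales (simp add: F_def sigma_generated_subalgebra)
  define J where "J = real_cond_exp M F (osc \<epsilon> g)"
  have JF: "J \<in> borel_measurable F" unfolding J_def by simp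
  have [measurable]: "J \<in> borel_measurable M" by (rule measurable_from_subalg[OF F.subalg JF])
  have [measurable]: "osc \<epsilon> g \<in> borel_measurable M" using osc_measurable g by simp
  note osq = square_integrable_osc[OF g, of \<epsilon>]
  have oi: "integrable M (osc \<epsilon> g)" by (rule square_integrable_integrable[OF osq])
  have cv: "convex_on UNIV (\<lambda>x::real. x\<^sup>2)" using convex_power2 by simp
  \<comment> \<open>Conditional Jensen for the square: it makes \<open>J\<close> square integrable
    and so admissible as a test function in \<open>orth\<close>.\<close>
  have "AE \<omega> in M. (J \<omega>)\<^sup>2 \<le> real_cond_exp M F (\<lambda>\<omega>. (osc \<epsilon> g \<omega>)\<^sup>2) \<omega>"
    unfolding J_def
    by (rule F.real_cond_exp_jensens_inequality(2)[OF oi _ _ square_integrable_power2[OF osq] cv]) auto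
  then have J_sq: "square_integrable M J"
    unfolding square_integrable_def
    by (intro conjI Bochner_Integration.integrable_bound[OF F.real_cond_exp_int(1)[OF square_integrable_power2[OF osq]]])
      (auto elim!: eventually_mono)
  define d where "d \<omega> = osc \<epsilon> g \<omega> - J \<omega>" for \<omega>
  have d_sq: "square_integrable M d" unfolding d_def by (intro square_integrable_diff osq J_sq)
  have orth: "(LINT \<omega>|M. h \<omega> * d \<omega>) = 0" if hF: "h \<in> borel_measurable F" and h: "square_integrable M h" for h
  proof -
    have 1: "integrable M (\<lambda>\<omega>. h \<omega> * osc \<epsilon> g \<omega>)" by (rule square_integrable_mult_integrable[OF h osq])
    have "(LINT \<omega>|M. h \<omega> * J \<omega>) = (LINT \<omega>|M. h \<omega> * osc \<epsilon> g \<omega>)"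
      unfolding J_def by (rule F.real_cond_exp_intg(2)[OF 1 hF]) measurable
    then show ?thesis using 1 square_integrable_mult_integrable[OF h J_sq]
      by (simp add: d_def right_diff_distrib)
  qed
  have "(LINT \<omega>|M. osc \<epsilon> g \<omega> * d \<omega>) = (LINT x|N. g x * (LINT \<omega>|M. Q \<epsilon> x \<omega> * d \<omega>))"
    using osc_scaleR(2)[OF N.square_integrable_integrable[OF g], of d \<epsilon>] d_sq square_integrable_abs[OF d_sq]
    by simp
  also have "\<dots> = (LINT x|N. 0)"
  proof (rule Bochner_Integration.integral_cong[OF refl])
    fix x assume "x \<in> space N"
    then show "g x * (LINT \<omega>|M. Q \<epsilon> x \<omega> * d \<omega>) = 0"
      using orth[OF _ square_integrable_Q[of \<epsilon> x]] S[of x] q_sigma_generated[of "x /\<^sub>R \<epsilon>" S]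
      by (cases "g x = 0") (auto simp: scaled_potential_def F_def)
  qed
  finally have "(LINT \<omega>|M. osc \<epsilon> g \<omega> * d \<omega>) = 0" by simp
  moreover have "(d \<omega>)\<^sup>2 = osc \<epsilon> g \<omega> * d \<omega> - J \<omega> * d \<omega>" for \<omega>
    by (simp add: d_def power2_eq_square algebra_simps)
  ultimately have "(LINT \<omega>|M. (d \<omega>)\<^sup>2) = 0"
    using orth[OF JF J_sq] square_integrable_mult_integrable[OF osq d_sq]
      square_integrable_mult_integrable[OF J_sq d_sq] by simp
  then have "AE \<omega> in M. d \<omega> = 0" by (intro norm2_eq_0_AE d_sq) (simp add: norm2_def)
  then show ?thesis using that[of J] JF by (auto simp: F_def d_def elim!: eventually_mono)
qed

text \<open>On the interval from L/2 to L the integrand is at least (L/2)^(d-1) times the root of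
  \<phi>(L), so (L/2)^d times that root is at most the total integral. Squaring gives the rate
  L^(-2d).\<close>

lemma antimono_integrable_decay:
  fixes \<phi> :: "real \<Rightarrow> real"
  assumes pos: "\<And>r. 0 \<le> r \<Longrightarrow> 0 \<le> \<phi> r" and mono: "antimono_on {0..} \<phi>"
    and int: "set_integrable lborel {0..} (\<lambda>r. r ^ (d - 1) * sqrt (\<phi> r))" and d: "0 < d"
  obtains C where "0 \<le> C" "\<And>L. 0 < L \<Longrightarrow> \<phi> L \<le> C / L ^ (2 * d)"
proof -
  define I where "I = (LINT r|lborel. indicator {0..} r * (r ^ (d - 1) * sqrt (\<phi> r)))"
  have int': "integrable lborel (\<lambda>r. indicator {0..} r * (r ^ (d - 1) * sqrt (\<phi> r)))"
    using int by (simp add: set_integrable_def)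
  have "\<phi> L \<le> (I\<^sup>2 * 4 ^ d) / L ^ (2 * d)" if L: "0 < L" for L
  proof -
    let ?c = "(L / 2) ^ (d - 1) * sqrt (\<phi> L)"
    have c: "0 \<le> ?c" using L pos[of L] by simp
    have i: "integrable lborel (\<lambda>r. indicator {L / 2..L} r * ?c)"
      by (intro integrable_mult_left integrable_real_indicator) (auto simp: emeasure_lborel_Icc_eq)
    have "(LINT r|lborel. indicator {L / 2..L} r * ?c) \<le> I"
      unfolding I_def
    proof (rule integral_mono[OF i int'])
      fix r :: real
      show "indicator {L / 2..L} r * ?c \<le> indicator {0..} r * (r ^ (d - 1) * sqrt (\<phi> r))"
      proof (cases "r \<in> {L / 2..L}")
        case True
        then have "(L / 2) ^ (d - 1) \<le> r ^ (d - 1)" using L by (intro power_mono) auto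
        moreover have "\<phi> L \<le> \<phi> r" using True L monotone_onD[OF mono, of r L] by auto
        ultimately have "?c \<le> r ^ (d - 1) * sqrt (\<phi> r)"
          using True L pos[of L] by (intro mult_mono) auto
        then show ?thesis using True L by simp
      next
        case False
        then show ?thesis using pos[of r] by (auto simp: indicator_def)
      qed
    qed
    moreover have "(LINT r|lborel. indicator {L / 2..L} r * ?c) = (L / 2) * ?c"
      using L by simp
    moreover have "(L / 2) * ?c = (L / 2) ^ d * sqrt (\<phi> L)"
      using d by (cases d) (auto simp only: power_Suc mult.assoc diff_Suc_1)
    ultimately have "(L / 2) ^ d * sqrt (\<phi> L) \<le> I" by (simp only:)
    then have "((L / 2) ^ d * sqrt (\<phi> L))\<^sup>2 \<le> I\<^sup>2"
      using L pos[of L] by (intro power_mono) auto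
    moreover have "((L / 2) ^ d * sqrt (\<phi> L))\<^sup>2 = L ^ (2 * d) / 4 ^ d * \<phi> L"
    proof -
      have "((L / 2) ^ d)\<^sup>2 = ((L / 2)\<^sup>2) ^ d" by (simp only: power_mult[symmetric] mult.commute[of d 2])
      also have "\<dots> = L ^ (2 * d) / 4 ^ d" by (simp add: power_divide power_mult)
      finally show ?thesis using L pos[of L] by (simp add: power_mult_distrib)
    qed
    ultimately have "L ^ (2 * d) / 4 ^ d * \<phi> L \<le> I\<^sup>2" by (simp only:)
    then show ?thesis using L by (simp add: field_simps)
  qed
  then show ?thesis using that[of "I\<^sup>2 * 4 ^ d"] by simp
qed

locale mixing_field_on = random_field_on M q D
  for M :: "'w measure" and q :: "'a::euclidean_space \<Rightarrow> 'w \<Rightarrow> real" and D +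
  assumes q_mixing: "strongly_mixing M q"
begin

text \<open>Monotonicity absorbs the factor 2 in front of \<open>setdist S T\<close>. From here on
  mixing is a polynomial covariance rate in the separation \<open>L\<close>.\<close>

lemma mixing_decay:
  obtains C where "0 \<le> C"
    "\<And>L S T \<zeta> \<xi>. 0 < L \<Longrightarrow> S \<in> sets borel \<Longrightarrow> T \<in> sets borel \<Longrightarrow> L \<le> setdist S T \<Longrightarrow>
      \<zeta> \<in> borel_measurable (sigma_generated M q S) \<Longrightarrow> \<xi> \<in> borel_measurable (sigma_generated M q T) \<Longrightarrow>
      square_integrable M \<zeta> \<Longrightarrow> square_integrable M \<xi> \<Longrightarrow>
      \<bar>(LINT \<omega>|M. \<zeta> \<omega> * \<xi> \<omega>) - (LINT \<omega>|M. \<zeta> \<omega>) * (LINT \<omega>|M. \<xi> \<omega>)\<bar>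
        \<le> C / L ^ (2 * DIM('a)) * (norm2 M \<zeta> * norm2 M \<xi>)"
proof -
  obtain \<phi> :: "real \<Rightarrow> real" where pos: "\<And>r. 0 \<le> r \<Longrightarrow> 0 \<le> \<phi> r" and mono: "antimono_on {0..} \<phi>"
    and int: "set_integrable lborel {0..} (\<lambda>r. r ^ (DIM('a) - 1) * sqrt (\<phi> r))"
    and mix: "\<forall>S\<in>sets borel. \<forall>T\<in>sets borel.
        \<forall>\<zeta>\<in>borel_measurable (sigma_generated M q S). \<forall>\<xi>\<in>borel_measurable (sigma_generated M q T).
          integrable M (\<lambda>\<omega>. (\<zeta> \<omega>)\<^sup>2) \<longrightarrow> integrable M (\<lambda>\<omega>. (\<xi> \<omega>)\<^sup>2) \<longrightarrow>
          \<bar>LINT \<omega>|M. (\<zeta> \<omega> - (LINT w|M. \<zeta> w)) * (\<xi> \<omega> - (LINT w|M. \<xi> w))\<bar>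
            \<le> \<phi> (2 * setdist S T) * sqrt ((LINT \<omega>|M. (\<zeta> \<omega>)\<^sup>2) * (LINT \<omega>|M. (\<xi> \<omega>)\<^sup>2))"
    using q_mixing unfolding strongly_mixing_def by (elim exE conjE) (rule that, simp_all)
  obtain C where C: "0 \<le> C" "\<And>L. 0 < L \<Longrightarrow> \<phi> L \<le> C / L ^ (2 * DIM('a))"
    using antimono_integrable_decay[OF pos mono int] DIM_positive by blast
  show ?thesis
  proof (rule that[OF C(1)])
    fix L :: real and S T :: "'a set" and \<zeta> \<xi>
    assume L: "0 < L" "L \<le> setdist S T" and ST: "S \<in> sets borel" "T \<in> sets borel"
      and m: "\<zeta> \<in> borel_measurable (sigma_generated M q S)" "\<xi> \<in> borel_measurable (sigma_generated M q T)"
      and sq: "square_integrable M \<zeta>" "square_integrable M \<xi>"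
    note i = square_integrable_integrable[OF sq(1)] square_integrable_integrable[OF sq(2)]
      square_integrable_mult_integrable[OF sq]
    have "\<phi> (2 * setdist S T) \<le> \<phi> L"
      using monotone_onD[OF mono, of L "2 * setdist S T"] L by auto
    also have "\<dots> \<le> C / L ^ (2 * DIM('a))" by (rule C(2)[OF L(1)])
    finally have phi: "\<phi> (2 * setdist S T) \<le> C / L ^ (2 * DIM('a))" .
    have "(LINT \<omega>|M. \<zeta> \<omega> * \<xi> \<omega>) - (LINT \<omega>|M. \<zeta> \<omega>) * (LINT \<omega>|M. \<xi> \<omega>)
        = (LINT \<omega>|M. (\<zeta> \<omega> - (LINT w|M. \<zeta> w)) * (\<xi> \<omega> - (LINT w|M. \<xi> w)))"
      using i by (simp add: algebra_simps prob_space)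
    then have "\<bar>(LINT \<omega>|M. \<zeta> \<omega> * \<xi> \<omega>) - (LINT \<omega>|M. \<zeta> \<omega>) * (LINT \<omega>|M. \<xi> \<omega>)\<bar>
        \<le> \<phi> (2 * setdist S T) * (norm2 M \<zeta> * norm2 M \<xi>)"
      using mix[rule_format, OF ST m] sq by (simp add: norm2_def real_sqrt_mult square_integrable_power2)
    also have "\<dots> \<le> C / L ^ (2 * DIM('a)) * (norm2 M \<zeta> * norm2 M \<xi>)"
      by (intro mult_right_mono phi) simp
    finally show "\<bar>(LINT \<omega>|M. \<zeta> \<omega> * \<xi> \<omega>) - (LINT \<omega>|M. \<zeta> \<omega>) * (LINT \<omega>|M. \<xi> \<omega>)\<bar>
        \<le> C / L ^ (2 * DIM('a)) * (norm2 M \<zeta> * norm2 M \<xi>)" .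
  qed
qed

text \<open>Mixing concerns real variables, so the exponential is split into cosine and sine, at the
  cost of a factor 2. Separate versions \<open>\<zeta>'\<close> and \<open>Y'\<close> appear because
  oscillatory integrals are measurable for the generated \<sigma>-algebras only up to null
  sets.\<close>

lemma mixing_iexp:
  obtains C where "0 \<le> C"
    "\<And>L S T \<zeta> \<zeta>' Y Y' t. 0 < L \<Longrightarrow> S \<in> sets borel \<Longrightarrow> T \<in> sets borel \<Longrightarrow> L \<le> setdist S T \<Longrightarrow>
      \<zeta>' \<in> borel_measurable (sigma_generated M q S) \<Longrightarrow> Y' \<in> borel_measurable (sigma_generated M q T) \<Longrightarrow>
      square_integrable M \<zeta> \<Longrightarrow> Y \<in> borel_measurable M \<Longrightarrow>
      AE \<omega> in M. \<zeta> \<omega> = \<zeta>' \<omega> \<Longrightarrow> AE \<omega> in M. Y \<omega> = Y' \<omega> \<Longrightarrow>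
      cmod ((LINT \<omega>|M. \<zeta> \<omega> *\<^sub>R iexp (t * Y \<omega>)) - (LINT \<omega>|M. \<zeta> \<omega>) *\<^sub>R (LINT \<omega>|M. iexp (t * Y \<omega>)))
        \<le> C / L ^ (2 * DIM('a)) * norm2 M \<zeta>"
proof -
  obtain C where C: "0 \<le> C"
    and mix: "\<And>L S T \<zeta> \<xi>. 0 < L \<Longrightarrow> S \<in> sets borel \<Longrightarrow> T \<in> sets borel \<Longrightarrow> L \<le> setdist S T \<Longrightarrow>
      \<zeta> \<in> borel_measurable (sigma_generated M q S) \<Longrightarrow> \<xi> \<in> borel_measurable (sigma_generated M q T) \<Longrightarrow>
      square_integrable M \<zeta> \<Longrightarrow> square_integrable M \<xi> \<Longrightarrow>
      \<bar>(LINT \<omega>|M. \<zeta> \<omega> * \<xi> \<omega>) - (LINT \<omega>|M. \<zeta> \<omega>) * (LINT \<omega>|M. \<xi> \<omega>)\<bar>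
        \<le> C / L ^ (2 * DIM('a)) * (norm2 M \<zeta> * norm2 M \<xi>)"
    by (rule mixing_decay) blast
  show ?thesis
  proof (rule that[of "2 * C"])
    show "0 \<le> 2 * C" using C by simp
    fix L :: real and S T :: "'a set" and \<zeta> \<zeta>' Y Y' :: "'w \<Rightarrow> real" and t :: real
    assume L: "0 < L" and ST: "S \<in> sets borel" "T \<in> sets borel" "L \<le> setdist S T"
      and z'm: "\<zeta>' \<in> borel_measurable (sigma_generated M q S)"
      and Y'm: "Y' \<in> borel_measurable (sigma_generated M q T)"
      and zsq: "square_integrable M \<zeta>" and Ym [measurable]: "Y \<in> borel_measurable M"
      and ae: "AE \<omega> in M. \<zeta> \<omega> = \<zeta>' \<omega>" "AE \<omega> in M. Y \<omega> = Y' \<omega>"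
    have [measurable]: "\<zeta> \<in> borel_measurable M" using zsq by simp
    have [measurable]: "\<zeta>' \<in> borel_measurable M" "Y' \<in> borel_measurable M"
      using measurable_from_subalg[OF sigma_generated_subalgebra z'm]
        measurable_from_subalg[OF sigma_generated_subalgebra Y'm] by auto
    have z'sq: "square_integrable M \<zeta>'" by (rule square_integrable_cong_AE[OF zsq _ ae(1)]) measurable
    have nz: "norm2 M \<zeta>' = norm2 M \<zeta>" by (rule norm2_cong_AE) (use ae in \<open>auto elim!: eventually_mono\<close>)
    have part: "\<bar>(LINT \<omega>|M. \<zeta> \<omega> * h (Y \<omega>)) - (LINT \<omega>|M. \<zeta> \<omega>) * (LINT \<omega>|M. h (Y \<omega>))\<bar>
        \<le> C / L ^ (2 * DIM('a)) * norm2 M \<zeta>"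
      if [measurable]: "h \<in> borel_measurable borel" and h: "\<And>y. \<bar>h y\<bar> \<le> 1" for h :: "real \<Rightarrow> real"
    proof -
      have hsq: "square_integrable M (\<lambda>\<omega>. h (Y' \<omega>))"
        by (rule square_integrable_bounded[where B=1]) (use h in auto)
      have hn: "norm2 M (\<lambda>\<omega>. h (Y' \<omega>)) \<le> 1"
      proof -
        have "norm2 M (\<lambda>\<omega>. h (Y' \<omega>)) \<le> norm2 M (\<lambda>\<omega>. 1)"
          by (rule norm2_mono) (use h in \<open>auto simp: square_integrable_def\<close>)
        then show ?thesis by (simp add: norm2_def prob_space)
      qed
      have "(LINT \<omega>|M. \<zeta> \<omega> * h (Y \<omega>)) = (LINT \<omega>|M. \<zeta>' \<omega> * h (Y' \<omega>))"
        "(LINT \<omega>|M. \<zeta> \<omega>) = (LINT \<omega>|M. \<zeta>' \<omega>)" "(LINT \<omega>|M. h (Y \<omega>)) = (LINT \<omega>|M. h (Y' \<omega>))"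
        by (rule integral_cong_AE; use ae in \<open>auto elim!: eventually_elim2\<close>)+
      moreover have "\<bar>(LINT \<omega>|M. \<zeta>' \<omega> * h (Y' \<omega>)) - (LINT \<omega>|M. \<zeta>' \<omega>) * (LINT \<omega>|M. h (Y' \<omega>))\<bar>
          \<le> C / L ^ (2 * DIM('a)) * (norm2 M \<zeta>' * norm2 M (\<lambda>\<omega>. h (Y' \<omega>)))"
        by (rule mix[OF L ST z'm measurable_compose[OF Y'm] z'sq hsq]) measurable
      moreover have "\<dots> \<le> C / L ^ (2 * DIM('a)) * (norm2 M \<zeta>' * 1)"
        using C L by (intro mult_left_mono hn) auto
      ultimately show ?thesis by (simp add: nz)
    qed
    have zi: "integrable M \<zeta>" by (rule square_integrable_integrable[OF zsq])
    have i1: "integrable M (\<lambda>\<omega>. \<zeta> \<omega> *\<^sub>R iexp (t * Y \<omega>))"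
      by (rule Bochner_Integration.integrable_bound[OF zi]) auto
    have i2: "integrable M (\<lambda>\<omega>. iexp (t * Y \<omega>))" by (rule integrable_iexp) auto
    let ?E = "(LINT \<omega>|M. \<zeta> \<omega> *\<^sub>R iexp (t * Y \<omega>)) - (LINT \<omega>|M. \<zeta> \<omega>) *\<^sub>R (LINT \<omega>|M. iexp (t * Y \<omega>))"
    have "Re ?E = (LINT \<omega>|M. \<zeta> \<omega> * cos (t * Y \<omega>)) - (LINT \<omega>|M. \<zeta> \<omega>) * (LINT \<omega>|M. cos (t * Y \<omega>))"
      using integral_Re[OF i1] integral_Re[OF i2] by (simp add: Re_exp Im_exp)
    then have re: "\<bar>Re ?E\<bar> \<le> C / L ^ (2 * DIM('a)) * norm2 M \<zeta>"
      using part[of "\<lambda>y. cos (t * y)"] by simp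
    have "Im ?E = (LINT \<omega>|M. \<zeta> \<omega> * sin (t * Y \<omega>)) - (LINT \<omega>|M. \<zeta> \<omega>) * (LINT \<omega>|M. sin (t * Y \<omega>))"
      using integral_Im[OF i1] integral_Im[OF i2] by (simp add: Re_exp Im_exp)
    then have im: "\<bar>Im ?E\<bar> \<le> C / L ^ (2 * DIM('a)) * norm2 M \<zeta>"
      using part[of "\<lambda>y. sin (t * y)"] by simp
    show "cmod ?E \<le> 2 * C / L ^ (2 * DIM('a)) * norm2 M \<zeta>"
      using cmod_le[of ?E] re im by simp
  qed
qed

end

section \<open>The Stein equation for characteristic functions\<close>

lemma cmod_iexp_diff_le: "cmod (iexp x - iexp y) \<le> \<bar>x - y\<bar>"
proof -
  have "iexp x - iexp y = iexp y * (iexp (x - y) - 1)"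
    by (simp add: algebra_simps flip: exp_add)
  then have "cmod (iexp x - iexp y) = cmod (iexp (x - y) - 1)" by (simp add: norm_mult)
  also have "\<dots> \<le> \<bar>x - y\<bar>" using iexp_approx1[of "x - y" 0] by simp
  finally show ?thesis .
qed

lemma cmod_iexp_taylor: "cmod (iexp x - iexp y - \<i> * (x - y) * iexp y) \<le> (x - y)\<^sup>2 / 2"
proof -
  have "iexp x - iexp y - \<i> * (x - y) * iexp y = iexp y * (iexp (x - y) - (1 + \<i> * (x - y)))"
    by (simp add: algebra_simps flip: exp_add)
  then have "cmod (iexp x - iexp y - \<i> * (x - y) * iexp y) = cmod (iexp (x - y) - (1 + \<i> * (x - y)))"
    by (simp add: norm_mult)
  also have "\<dots> \<le> (x - y)\<^sup>2 / 2" using iexp_approx1[of "x - y" 1] by (simp add: power2_eq_square)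
  finally show ?thesis .
qed

context prob_space begin

lemma cmod_integral_le_norm2:
  assumes f: "square_integrable M f" and g: "square_integrable M g" and [measurable]: "h \<in> borel_measurable M"
    and le: "\<And>\<omega>. cmod (h \<omega>) \<le> c * \<bar>f \<omega> * g \<omega>\<bar>" and c: "0 \<le> c"
  shows "cmod (LINT \<omega>|M. h \<omega>) \<le> c * (norm2 M f * norm2 M g)"
proof -
  have i: "integrable M (\<lambda>\<omega>. c * \<bar>f \<omega> * g \<omega>\<bar>)"
    using square_integrable_mult_integrable[OF f g] by auto
  have "integrable M h" by (rule Bochner_Integration.integrable_bound[OF i]) (use le c in auto)
  then have "cmod (LINT \<omega>|M. h \<omega>) \<le> (LINT \<omega>|M. c * \<bar>f \<omega> * g \<omega>\<bar>)"
    using i le by (intro order_trans[OF integral_norm_bound integral_mono]) auto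
  also have "\<dots> \<le> c * (norm2 M f * norm2 M g)"
    using integral_abs_mult_le_norm2[OF f g] c by (simp add: mult_left_mono)
  finally show ?thesis .
qed

text \<open>In the application \<open>\<zeta>\<close> is the field at one point, and
  \<open>X1\<close>, \<open>X2\<close> are the parts of \<open>Y\<close> coming from a ball around
  it and from the ball of twice the radius. Two radii occur because after the first order expansion
  the factor \<open>\<zeta> * X1\<close> itself occupies the smaller ball and is separated only from
  \<open>Y - X2\<close>.\<close>

lemma stein_expansion:
  fixes \<zeta> Y X1 X2 :: "'a \<Rightarrow> real" and t :: real
  assumes \<zeta>: "square_integrable M \<zeta>" and Y [measurable]: "Y \<in> borel_measurable M"
    and X1: "square_integrable M X1" and X2: "square_integrable M X2"
    and \<zeta>X: "square_integrable M (\<lambda>\<omega>. \<zeta> \<omega> * X1 \<omega>)"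
    and c1: "cmod (LINT \<omega>|M. \<zeta> \<omega> *\<^sub>R iexp (t * (Y \<omega> - X1 \<omega>))) \<le> c1"
    and c2: "cmod ((LINT \<omega>|M. (\<zeta> \<omega> * X1 \<omega>) *\<^sub>R iexp (t * (Y \<omega> - X2 \<omega>)))
       - (LINT \<omega>|M. \<zeta> \<omega> * X1 \<omega>) *\<^sub>R (LINT \<omega>|M. iexp (t * (Y \<omega> - X2 \<omega>)))) \<le> c2"
    and b: "norm2 M (\<lambda>\<omega>. \<zeta> \<omega> * X1 \<omega>) \<le> b" and a: "norm2 M X1 \<le> a" "norm2 M X2 \<le> a"
  shows "cmod ((LINT \<omega>|M. \<zeta> \<omega> *\<^sub>R iexp (t * Y \<omega>))
      - (\<i> * (t * (LINT \<omega>|M. \<zeta> \<omega> * X1 \<omega>))) * (LINT \<omega>|M. iexp (t * Y \<omega>)))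
    \<le> c1 + \<bar>t\<bar> * c2 + 4 * t\<^sup>2 * (a * b)"
proof -
  have [measurable]: "\<zeta> \<in> borel_measurable M" "X1 \<in> borel_measurable M" "X2 \<in> borel_measurable M"
    using \<zeta> X1 X2 by auto
  define Z where "Z \<omega> = iexp (t * Y \<omega>)" for \<omega>
  define Z1 where "Z1 \<omega> = iexp (t * (Y \<omega> - X1 \<omega>))" for \<omega>
  define Z2 where "Z2 \<omega> = iexp (t * (Y \<omega> - X2 \<omega>))" for \<omega>
  have [measurable]: "Z \<in> borel_measurable M" "Z1 \<in> borel_measurable M" "Z2 \<in> borel_measurable M"
    unfolding Z_def Z1_def Z2_def by auto
  have Zn: "cmod (Z \<omega>) = 1" "cmod (Z1 \<omega>) = 1" "cmod (Z2 \<omega>) = 1" for \<omega>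
    by (simp_all add: Z_def Z1_def Z2_def)
  have iz: "integrable M Z" "integrable M Z1" "integrable M Z2"
    unfolding Z_def Z1_def Z2_def by (rule integrable_iexp; simp)+
  have si: "integrable M (\<lambda>\<omega>. f \<omega> *\<^sub>R H \<omega>)"
    if "square_integrable M f" "H \<in> borel_measurable M" "\<And>\<omega>. cmod (H \<omega>) = 1" for f and H :: "'a \<Rightarrow> complex"
    using that by (intro Bochner_Integration.integrable_bound[OF square_integrable_integrable[OF that(1)]]) auto
  have A: "integrable M (\<lambda>\<omega>. \<zeta> \<omega> *\<^sub>R Z \<omega>)" and B: "integrable M (\<lambda>\<omega>. \<zeta> \<omega> *\<^sub>R Z1 \<omega>)"
    and C: "integrable M (\<lambda>\<omega>. (\<zeta> \<omega> * X1 \<omega>) *\<^sub>R Z1 \<omega>)" and C': "integrable M (\<lambda>\<omega>. (\<zeta> \<omega> * X1 \<omega>) *\<^sub>R Z2 \<omega>)"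
    by (intro si \<zeta> \<zeta>X Zn; measurable)+
  have ba: "0 \<le> b" "0 \<le> a" using b a norm2_nonneg order_trans by blast+
  define m where "m = (LINT \<omega>|M. \<zeta> \<omega> * X1 \<omega>)"
  have m: "\<bar>m\<bar> \<le> b"
  proof -
    have "\<bar>LINT \<omega>|M. (\<zeta> \<omega> * X1 \<omega>) * 1\<bar> \<le> norm2 M (\<lambda>\<omega>. \<zeta> \<omega> * X1 \<omega>) * norm2 M (\<lambda>_. 1)"
      by (intro abs_integral_mult_le_norm2 \<zeta>X) (simp add: square_integrable_def)
    then show ?thesis using b by (simp add: m_def norm2_def prob_space)
  qed
  \<comment> \<open>The errors of the chain: Taylor remainder of second order (\<open>T2\<close>),
    passage from \<open>X1\<close> to \<open>X2\<close> in the exponent (\<open>T3\<close>),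
    decoupling (\<open>T4\<close>), return to the full exponential (\<open>T5\<close>).\<close>
  define T2 where "T2 = (LINT \<omega>|M. \<zeta> \<omega> *\<^sub>R (Z \<omega> - Z1 \<omega> - \<i> * (t * X1 \<omega>) * Z1 \<omega>))"
  define T3 where "T3 = (LINT \<omega>|M. (\<zeta> \<omega> * X1 \<omega>) *\<^sub>R (Z1 \<omega> - Z2 \<omega>))"
  define T4 where "T4 = (LINT \<omega>|M. (\<zeta> \<omega> * X1 \<omega>) *\<^sub>R Z2 \<omega>) - m *\<^sub>R (LINT \<omega>|M. Z2 \<omega>)"
  define T5 where "T5 = (LINT \<omega>|M. Z2 \<omega> - Z \<omega>)"
  have T2: "T2 = (LINT \<omega>|M. \<zeta> \<omega> *\<^sub>R Z \<omega>) - (LINT \<omega>|M. \<zeta> \<omega> *\<^sub>R Z1 \<omega>)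
      - \<i> * t * (LINT \<omega>|M. (\<zeta> \<omega> * X1 \<omega>) *\<^sub>R Z1 \<omega>)"
  proof -
    have "\<zeta> \<omega> *\<^sub>R (Z \<omega> - Z1 \<omega> - \<i> * (t * X1 \<omega>) * Z1 \<omega>)
        = \<zeta> \<omega> *\<^sub>R Z \<omega> - \<zeta> \<omega> *\<^sub>R Z1 \<omega> - (\<i> * t) * ((\<zeta> \<omega> * X1 \<omega>) *\<^sub>R Z1 \<omega>)" for \<omega>
      by (simp add: scaleR_conv_of_real algebra_simps)
    then have "T2 = (LINT \<omega>|M. \<zeta> \<omega> *\<^sub>R Z \<omega> - \<zeta> \<omega> *\<^sub>R Z1 \<omega> - (\<i> * t) * ((\<zeta> \<omega> * X1 \<omega>) *\<^sub>R Z1 \<omega>))"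
      unfolding T2_def by presburger
    then show ?thesis
      by (simp only: Bochner_Integration.integral_diff[OF Bochner_Integration.integrable_diff[OF A B] integrable_mult_right[OF C]]
          Bochner_Integration.integral_diff[OF A B] integral_mult_right_zero)
  qed
  have T3: "T3 = (LINT \<omega>|M. (\<zeta> \<omega> * X1 \<omega>) *\<^sub>R Z1 \<omega>) - (LINT \<omega>|M. (\<zeta> \<omega> * X1 \<omega>) *\<^sub>R Z2 \<omega>)"
    unfolding T3_def scaleR_diff_right by (rule Bochner_Integration.integral_diff[OF C C'])
  have T5: "T5 = (LINT \<omega>|M. Z2 \<omega>) - (LINT \<omega>|M. Z \<omega>)"
    unfolding T5_def using iz by simp
  have eq: "(LINT \<omega>|M. \<zeta> \<omega> *\<^sub>R Z \<omega>) - (\<i> * (t * m)) * (LINT \<omega>|M. Z \<omega>)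
      = (LINT \<omega>|M. \<zeta> \<omega> *\<^sub>R Z1 \<omega>) + T2 + (\<i> * t) * T3 + (\<i> * t) * T4 + (\<i> * t) * m * T5"
    unfolding T2 T3 T4_def T5 by (simp add: scaleR_conv_of_real algebra_simps)
  have n2: "cmod T2 \<le> t\<^sup>2 / 2 * (b * a)"
  proof -
    have "cmod T2 \<le> t\<^sup>2 / 2 * (norm2 M (\<lambda>\<omega>. \<zeta> \<omega> * X1 \<omega>) * norm2 M X1)"
      unfolding T2_def
    proof (rule cmod_integral_le_norm2[OF \<zeta>X X1])
      fix \<omega>
      have "cmod (Z \<omega> - Z1 \<omega> - \<i> * (t * X1 \<omega>) * Z1 \<omega>) \<le> (t * X1 \<omega>)\<^sup>2 / 2"
        using cmod_iexp_taylor[of "t * Y \<omega>" "t * (Y \<omega> - X1 \<omega>)"]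
        by (simp add: Z_def Z1_def right_diff_distrib)
      then have "\<bar>\<zeta> \<omega>\<bar> * cmod (Z \<omega> - Z1 \<omega> - \<i> * (t * X1 \<omega>) * Z1 \<omega>) \<le> \<bar>\<zeta> \<omega>\<bar> * ((t * X1 \<omega>)\<^sup>2 / 2)"
        by (rule mult_left_mono) simp
      also have "\<dots> = t\<^sup>2 / 2 * \<bar>\<zeta> \<omega> * X1 \<omega> * X1 \<omega>\<bar>"
        by (simp add: abs_mult power_mult_distrib power2_eq_square)
      finally show "cmod (\<zeta> \<omega> *\<^sub>R (Z \<omega> - Z1 \<omega> - \<i> * (t * X1 \<omega>) * Z1 \<omega>)) \<le> t\<^sup>2 / 2 * \<bar>\<zeta> \<omega> * X1 \<omega> * X1 \<omega>\<bar>"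
        by simp
    qed (auto simp del: of_real_mult)
    also have "\<dots> \<le> t\<^sup>2 / 2 * (b * a)" using ba by (intro mult_left_mono mult_mono b a) auto
    finally show ?thesis .
  qed
  have n3: "cmod T3 \<le> \<bar>t\<bar> * (b * (2 * a))"
  proof -
    note d = square_integrable_diff[OF X2 X1]
    have "cmod T3 \<le> \<bar>t\<bar> * (norm2 M (\<lambda>\<omega>. \<zeta> \<omega> * X1 \<omega>) * norm2 M (\<lambda>\<omega>. X2 \<omega> - X1 \<omega>))"
      unfolding T3_def
    proof (rule cmod_integral_le_norm2[OF \<zeta>X d])
      fix \<omega>
      have "cmod (Z1 \<omega> - Z2 \<omega>) \<le> \<bar>t * (Y \<omega> - X1 \<omega>) - t * (Y \<omega> - X2 \<omega>)\<bar>"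
        unfolding Z1_def Z2_def by (rule cmod_iexp_diff_le)
      also have "\<dots> = \<bar>t\<bar> * \<bar>X2 \<omega> - X1 \<omega>\<bar>" by (simp add: algebra_simps flip: abs_mult)
      finally have "\<bar>\<zeta> \<omega> * X1 \<omega>\<bar> * cmod (Z1 \<omega> - Z2 \<omega>) \<le> \<bar>\<zeta> \<omega> * X1 \<omega>\<bar> * (\<bar>t\<bar> * \<bar>X2 \<omega> - X1 \<omega>\<bar>)"
        by (rule mult_left_mono) simp
      then show "cmod ((\<zeta> \<omega> * X1 \<omega>) *\<^sub>R (Z1 \<omega> - Z2 \<omega>)) \<le> \<bar>t\<bar> * \<bar>\<zeta> \<omega> * X1 \<omega> * (X2 \<omega> - X1 \<omega>)\<bar>"
        by (simp add: abs_mult mult_ac)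
    qed auto
    also have "\<dots> \<le> \<bar>t\<bar> * (b * (2 * a))"
      using norm2_triangle_diff[OF X2 X1] ba a by (intro mult_left_mono mult_mono b) auto
    finally show ?thesis .
  qed
  have n5: "cmod T5 \<le> \<bar>t\<bar> * a"
  proof -
    have s1: "square_integrable M (\<lambda>_. 1)" by (simp add: square_integrable_def)
    have "cmod T5 \<le> \<bar>t\<bar> * (norm2 M (\<lambda>_. 1) * norm2 M X2)"
      unfolding T5_def
    proof (rule cmod_integral_le_norm2[OF s1 X2])
      fix \<omega>
      have "cmod (Z2 \<omega> - Z \<omega>) \<le> \<bar>t * (Y \<omega> - X2 \<omega>) - t * Y \<omega>\<bar>"
        unfolding Z_def Z2_def by (rule cmod_iexp_diff_le)
      then show "cmod (Z2 \<omega> - Z \<omega>) \<le> \<bar>t\<bar> * \<bar>1 * X2 \<omega>\<bar>" by (simp add: algebra_simps flip: abs_mult)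
    qed auto
    also have "\<dots> \<le> \<bar>t\<bar> * a" using a by (simp add: norm2_def prob_space mult_left_mono)
    finally show ?thesis .
  qed
  have "cmod ((LINT \<omega>|M. \<zeta> \<omega> *\<^sub>R Z \<omega>) - (\<i> * (t * m)) * (LINT \<omega>|M. Z \<omega>))
      \<le> cmod (LINT \<omega>|M. \<zeta> \<omega> *\<^sub>R Z1 \<omega>) + cmod T2 + \<bar>t\<bar> * cmod T3 + \<bar>t\<bar> * cmod T4 + \<bar>t\<bar> * \<bar>m\<bar> * cmod T5"
    unfolding eq by (intro order_trans[OF norm_triangle_ineq] add_mono) (auto simp: norm_mult)
  also have "\<dots> \<le> c1 + t\<^sup>2 / 2 * (b * a) + \<bar>t\<bar> * (\<bar>t\<bar> * (b * (2 * a))) + \<bar>t\<bar> * c2 + \<bar>t\<bar> * b * (\<bar>t\<bar> * a)"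
    using c1 c2 n2 n3 n5 m ba
    by (intro add_mono mult_left_mono mult_mono) (auto simp: Z1_def Z2_def T4_def m_def)
  \<comment> \<open>The coefficient is 1/2 + 2 + 1, from \<open>T2\<close>, \<open>T3\<close> and
    \<open>T5\<close>; it is then rounded up to 4.\<close>
  also have "\<dots> = c1 + \<bar>t\<bar> * c2 + 7 / 2 * t\<^sup>2 * (a * b)"
    by (simp add: power2_eq_square algebra_simps flip: power2_abs)
  also have "\<dots> \<le> c1 + \<bar>t\<bar> * c2 + 4 * t\<^sup>2 * (a * b)"
    using ba by (intro add_left_mono mult_right_mono) auto
  finally show ?thesis by (simp add: Z_def m_def)
qed

text \<open>The quadratic Taylor bound for the exponential makes the error of the difference
  quotient at most half the second moment of \<open>Y\<close> times
  \<open>\<bar>s - t\<bar>\<close>.\<close>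

lemma char_fun_has_vector_derivative:
  assumes Y: "square_integrable M Y"
  shows "((\<lambda>t. LINT \<omega>|M. iexp (t * Y \<omega>)) has_vector_derivative
    (\<i> * (LINT \<omega>|M. Y \<omega> *\<^sub>R iexp (t * Y \<omega>)))) (at t)"
  unfolding has_vector_derivative_def
proof (rule has_derivativeI_sandwich[where e=1 and H="\<lambda>s. (LINT \<omega>|M. (Y \<omega>)\<^sup>2) / 2 * \<bar>s - t\<bar>"])
  have [measurable]: "Y \<in> borel_measurable M" using Y by simp
  show "bounded_linear (\<lambda>x. x *\<^sub>R (\<i> * (LINT \<omega>|M. Y \<omega> *\<^sub>R iexp (t * Y \<omega>))))"
    by (rule bounded_linear_scaleR_left)
  have "((\<lambda>s. (LINT \<omega>|M. (Y \<omega>)\<^sup>2) / 2 * \<bar>s - t\<bar>) \<longlongrightarrow> (LINT \<omega>|M. (Y \<omega>)\<^sup>2) / 2 * \<bar>t - t\<bar>) (at t)"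
    by (intro tendsto_intros)
  then show "((\<lambda>s. (LINT \<omega>|M. (Y \<omega>)\<^sup>2) / 2 * \<bar>s - t\<bar>) \<longlongrightarrow> 0) (at t)" by simp
  fix s :: real assume s: "s \<noteq> t"
  let ?R = "\<lambda>\<omega>. iexp (s * Y \<omega>) - iexp (t * Y \<omega>) - \<i> * (s * Y \<omega> - t * Y \<omega>) * iexp (t * Y \<omega>)"
  have i0: "integrable M (\<lambda>\<omega>. iexp (s * Y \<omega>))" for s by (rule integrable_iexp) auto
  have i1: "integrable M (\<lambda>\<omega>. Y \<omega> *\<^sub>R iexp (t * Y \<omega>))"
    by (rule Bochner_Integration.integrable_bound[OF square_integrable_integrable[OF Y]]) auto
  have "(LINT \<omega>|M. iexp (s * Y \<omega>)) - (LINT \<omega>|M. iexp (t * Y \<omega>))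
      - (s - t) *\<^sub>R (\<i> * (LINT \<omega>|M. Y \<omega> *\<^sub>R iexp (t * Y \<omega>)))
      = (LINT \<omega>|M. iexp (s * Y \<omega>) - iexp (t * Y \<omega>) - (\<i> * (s - t)) * (Y \<omega> *\<^sub>R iexp (t * Y \<omega>)))"
    by (simp only: Bochner_Integration.integral_diff[OF Bochner_Integration.integrable_diff[OF i0 i0] integrable_mult_right[OF i1]]
        Bochner_Integration.integral_diff[OF i0 i0] integral_mult_right_zero) (simp add: scaleR_conv_of_real)
  also have "\<dots> = (LINT \<omega>|M. ?R \<omega>)"
    by (rule Bochner_Integration.integral_cong) (simp_all add: scaleR_conv_of_real algebra_simps)
  finally have e: "(LINT \<omega>|M. iexp (s * Y \<omega>)) - (LINT \<omega>|M. iexp (t * Y \<omega>))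
      - (s - t) *\<^sub>R (\<i> * (LINT \<omega>|M. Y \<omega> *\<^sub>R iexp (t * Y \<omega>))) = (LINT \<omega>|M. ?R \<omega>)" .
  have "cmod (LINT \<omega>|M. ?R \<omega>) \<le> (s - t)\<^sup>2 / 2 * (norm2 M Y * norm2 M Y)"
  proof (rule cmod_integral_le_norm2[OF Y Y])
    fix \<omega>
    have "cmod (?R \<omega>) \<le> (s * Y \<omega> - t * Y \<omega>)\<^sup>2 / 2" using cmod_iexp_taylor[of "s * Y \<omega>" "t * Y \<omega>"] by simp
    also have "\<dots> = (s - t)\<^sup>2 / 2 * \<bar>Y \<omega> * Y \<omega>\<bar>"
      by (simp only: left_diff_distrib[symmetric] power_mult_distrib) (simp add: power2_eq_square)
    finally show "cmod (?R \<omega>) \<le> (s - t)\<^sup>2 / 2 * \<bar>Y \<omega> * Y \<omega>\<bar>" .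
  qed auto
  also have "\<dots> = (LINT \<omega>|M. (Y \<omega>)\<^sup>2) / 2 * (\<bar>s - t\<bar> * \<bar>s - t\<bar>)"
  proof -
    have "norm2 M Y * norm2 M Y = (LINT \<omega>|M. (Y \<omega>)\<^sup>2)"
      by (simp only: norm2_power2[symmetric] power2_eq_square[of "norm2 M Y"])
    moreover have "(s - t)\<^sup>2 = \<bar>s - t\<bar> * \<bar>s - t\<bar>" by (metis power2_abs power2_eq_square)
    ultimately show ?thesis by simp
  qed
  finally have "cmod (LINT \<omega>|M. ?R \<omega>) / \<bar>s - t\<bar> \<le> (LINT \<omega>|M. (Y \<omega>)\<^sup>2) / 2 * \<bar>s - t\<bar>"
    using s by (subst pos_divide_le_eq) (simp_all only: mult.assoc zero_less_abs_iff right_minus_eq not_False_eq_True)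
  then show "norm ((LINT \<omega>|M. iexp (s * Y \<omega>)) - (LINT \<omega>|M. iexp (t * Y \<omega>))
      - (s - t) *\<^sub>R (\<i> * (LINT \<omega>|M. Y \<omega> *\<^sub>R iexp (t * Y \<omega>)))) / norm (s - t)
      \<le> (LINT \<omega>|M. (Y \<omega>)\<^sup>2) / 2 * \<bar>s - t\<bar>"
    unfolding e by simp
qed simp

end

text \<open>Integrating factor: \<open>exp (v * s\<^sup>2 / 2)\<close> times \<open>\<psi> s\<close>
  has a derivative of size \<delta> up to a constant. One factor
  \<open>exp (\<bar>v\<bar> * T\<^sup>2 / 2)\<close> is paid for that derivative and one for undoing
  the multiplication; the absolute value admits either sign of \<open>v\<close>.\<close>

lemma gaussian_ode_stability:
  fixes \<psi> \<psi>' :: "real \<Rightarrow> complex"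
  assumes der: "\<And>t. (\<psi> has_vector_derivative \<psi>' t) (at t)" and \<psi>0: "\<psi> 0 = 1"
    and le: "\<And>t. \<bar>t\<bar> \<le> T \<Longrightarrow> cmod (\<psi>' t + (t * v) *\<^sub>R \<psi> t) \<le> \<delta>" and t: "\<bar>t\<bar> \<le> T"
  shows "cmod (\<psi> t - of_real (exp (- v * t\<^sup>2 / 2))) \<le> exp (\<bar>v\<bar> * T\<^sup>2) * \<delta> * T"
proof -
  define h where "h s = exp (v * s\<^sup>2 / 2) *\<^sub>R \<psi> s" for s
  have T: "0 \<le> T" using t by simp
  have bnd: "exp (w * s\<^sup>2 / 2) \<le> exp (\<bar>v\<bar> * T\<^sup>2 / 2)" if "\<bar>s\<bar> \<le> T" "\<bar>w\<bar> = \<bar>v\<bar>" for s w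
  proof -
    have "\<bar>s\<bar>\<^sup>2 \<le> T\<^sup>2" using that by (intro power_mono) auto
    then have "w * s\<^sup>2 \<le> \<bar>v\<bar> * T\<^sup>2" using that by (intro mult_mono) auto
    then show ?thesis by simp
  qed
  have hd: "(h has_vector_derivative exp (v * s\<^sup>2 / 2) *\<^sub>R (\<psi>' s + (s * v) *\<^sub>R \<psi> s)) (at s)" for s
  proof -
    have "((\<lambda>s. exp (v * s\<^sup>2 / 2)) has_vector_derivative (s * v) * exp (v * s\<^sup>2 / 2)) (at s)"
      unfolding has_real_derivative_iff_has_vector_derivative[symmetric]
      by (auto intro!: derivative_eq_intros)
    from has_vector_derivative_scaleR[OF _ der[of s], of "\<lambda>s. exp (v * s\<^sup>2 / 2)"] this
    show ?thesis
      unfolding h_def has_real_derivative_iff_has_vector_derivative[symmetric]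
      by (simp add: scaleR_add_right mult.commute)
  qed
  have \<delta>: "0 \<le> \<delta>" using le[OF t] norm_ge_zero order_trans by blast
  have "norm (h t - h 0) \<le> (exp (\<bar>v\<bar> * T\<^sup>2 / 2) * \<delta>) * norm (t - 0)"
  proof (rule differentiable_bound[of "{-T..T}"])
    fix s assume s: "s \<in> {-T..T}"
    show "(h has_derivative (\<lambda>x. x *\<^sub>R (exp (v * s\<^sup>2 / 2) *\<^sub>R (\<psi>' s + (s * v) *\<^sub>R \<psi> s)))) (at s within {-T..T})"
      using hd[of s] unfolding has_vector_derivative_def by (rule has_derivative_at_withinI)
    have "norm (exp (v * s\<^sup>2 / 2) *\<^sub>R (\<psi>' s + (s * v) *\<^sub>R \<psi> s)) \<le> exp (\<bar>v\<bar> * T\<^sup>2 / 2) * \<delta>"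
      using s bnd[of s v] le[of s] by (auto intro!: mult_mono)
    then have "norm (x *\<^sub>R (exp (v * s\<^sup>2 / 2) *\<^sub>R (\<psi>' s + (s * v) *\<^sub>R \<psi> s)))
        \<le> exp (\<bar>v\<bar> * T\<^sup>2 / 2) * \<delta> * norm x" for x :: real
      unfolding norm_scaleR[of x] mult.commute[of "\<bar>x\<bar>"] real_norm_def by (rule mult_right_mono) simp
    then show "onorm (\<lambda>x. x *\<^sub>R (exp (v * s\<^sup>2 / 2) *\<^sub>R (\<psi>' s + (s * v) *\<^sub>R \<psi> s))) \<le> exp (\<bar>v\<bar> * T\<^sup>2 / 2) * \<delta>"
      using \<delta> by (intro onorm_bound) auto
  qed (use t T in auto)
  also have "\<dots> \<le> (exp (\<bar>v\<bar> * T\<^sup>2 / 2) * \<delta>) * T"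
    using t \<delta> by (intro mult_left_mono) auto
  finally have 1: "cmod (h t - 1) \<le> (exp (\<bar>v\<bar> * T\<^sup>2 / 2) * \<delta>) * T"
    by (simp add: h_def \<psi>0)
  have "exp (- v * t\<^sup>2 / 2) * exp (v * t\<^sup>2 / 2) = 1" by (simp flip: exp_add)
  then have "\<psi> t - of_real (exp (- v * t\<^sup>2 / 2)) = exp (- v * t\<^sup>2 / 2) *\<^sub>R (h t - 1)"
    unfolding h_def scaleR_diff_right scaleR_scaleR by (simp only: scaleR_one) (simp add: scaleR_conv_of_real)
  then have "cmod (\<psi> t - of_real (exp (- v * t\<^sup>2 / 2))) = exp (- v * t\<^sup>2 / 2) * cmod (h t - 1)" by simp
  also have "\<dots> \<le> exp (\<bar>v\<bar> * T\<^sup>2 / 2) * ((exp (\<bar>v\<bar> * T\<^sup>2 / 2) * \<delta>) * T)"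
    using bnd[OF t, of "- v"] 1 by (intro mult_mono) auto
  also have "\<dots> = exp (\<bar>v\<bar> * T\<^sup>2 / 2 + \<bar>v\<bar> * T\<^sup>2 / 2) * \<delta> * T"
    unfolding exp_add by (simp only: mult.assoc)
  also have "\<dots> = exp (\<bar>v\<bar> * T\<^sup>2) * \<delta> * T" by simp
  finally show ?thesis .
qed

section \<open>Central limit theorem for oscillatory integrals\<close>

context random_field_on begin

definition fluct :: "real \<Rightarrow> ('a \<Rightarrow> real) \<Rightarrow> 'w \<Rightarrow> real" where
  "fluct \<epsilon> g \<omega> = \<epsilon> powr (- real DIM('a) / 2) * osc \<epsilon> g \<omega>"

lemma fluct_measurable [measurable]: "g \<in> borel_measurable N \<Longrightarrow> fluct \<epsilon> g \<in> borel_measurable M"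
  unfolding fluct_def[abs_def] by (intro borel_measurable_times borel_measurable_const osc_measurable)

lemma square_integrable_fluct: "square_integrable N g \<Longrightarrow> square_integrable M (fluct \<epsilon> g)"
  unfolding fluct_def[abs_def] by (intro square_integrable_cmult square_integrable_osc)

lemma norm2_fluct:
  assumes g: "square_integrable N g" and \<epsilon>: "0 < \<epsilon>"
  shows "norm2 M (fluct \<epsilon> g) \<le> sqrt corr_mass * norm2 N g"
proof (rule power2_le_imp_le)
  have e: "(\<epsilon> powr (- real DIM('a) / 2))\<^sup>2 * \<epsilon> ^ DIM('a) = 1"
    unfolding powr_realpow[OF \<epsilon>, symmetric] power2_eq_square powr_add[symmetric] using \<epsilon> by simp
  have "(norm2 M (fluct \<epsilon> g))\<^sup>2 = (\<epsilon> powr (- real DIM('a) / 2))\<^sup>2 * (LINT \<omega>|M. (osc \<epsilon> g \<omega>)\<^sup>2)"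
    by (simp add: norm2_power2 fluct_def power_mult_distrib)
  also have "\<dots> \<le> (\<epsilon> powr (- real DIM('a) / 2))\<^sup>2 * (\<epsilon> ^ DIM('a) * corr_mass * (LINT x|N. (g x)\<^sup>2))"
    by (intro mult_left_mono osc_variance g \<epsilon>) simp
  also have "\<dots> = ((\<epsilon> powr (- real DIM('a) / 2))\<^sup>2 * \<epsilon> ^ DIM('a)) * (corr_mass * (LINT x|N. (g x)\<^sup>2))"
    by (simp only: mult.assoc)
  also have "\<dots> = (sqrt corr_mass * norm2 N g)\<^sup>2"
    unfolding e by (simp add: power_mult_distrib norm2_power2 corr_mass_nonneg)
  finally show "(norm2 M (fluct \<epsilon> g))\<^sup>2 \<le> (sqrt corr_mass * norm2 N g)\<^sup>2" .
qed (simp add: corr_mass_nonneg)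

lemma fluct_add_AE:
  assumes "integrable N f" "integrable N g"
  shows "AE \<omega> in M. fluct \<epsilon> (\<lambda>x. f x + g x) \<omega> = fluct \<epsilon> f \<omega> + fluct \<epsilon> g \<omega>"
  using AE_integrable_Q[OF assms(1), of \<epsilon>] AE_integrable_Q[OF assms(2), of \<epsilon>]
  by eventually_elim (simp add: fluct_def osc_def distrib_right distrib_left)

section \<open>Splitting the fluctuation into the parts near to and far from a point\<close>

definition near :: "real \<Rightarrow> ('a \<Rightarrow> real) \<Rightarrow> 'a \<Rightarrow> 'a \<Rightarrow> real" where
  "near r f x y = (if dist x y \<le> r then f y else 0)"

definition far :: "real \<Rightarrow> ('a \<Rightarrow> real) \<Rightarrow> 'a \<Rightarrow> 'a \<Rightarrow> real" where
  "far r f x y = (if dist x y \<le> r then 0 else f y)"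

context
  fixes f :: "'a \<Rightarrow> real" and F :: real
  assumes f_meas [measurable]: "f \<in> borel_measurable N" and f_bd: "\<forall>x\<in>D. \<bar>f x\<bar> \<le> F"
    and F_nonneg: "0 \<le> F"
begin

lemmas f_bound = f_bd[rule_format]

lemma ident_measurable_N: "(\<lambda>x. x) \<in> measurable N borel"
  by (intro measurable_restrict_space1) simp

lemma near_measurable [measurable]:
  "near r f x \<in> borel_measurable N" "far r f x \<in> borel_measurable N"
  "(\<lambda>p. near r f (fst p) (snd p)) \<in> borel_measurable (N \<Otimes>\<^sub>M N)"
proof -
  note [measurable] = ident_measurable_N measurable_compose[OF measurable_fst ident_measurable_N, of N]
    measurable_compose[OF measurable_snd ident_measurable_N, of N]
  show "near r f x \<in> borel_measurable N" "far r f x \<in> borel_measurable N"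
    unfolding near_def[abs_def] far_def[abs_def] by measurable
  show "(\<lambda>p. near r f (fst p) (snd p)) \<in> borel_measurable (N \<Otimes>\<^sub>M N)"
    unfolding near_def by measurable
qed

lemma square_integrable_f: "square_integrable N f"
  by (rule N.square_integrable_bounded[where B=F]) (use f_bound in auto)

lemma square_integrable_near: "square_integrable N (near r f x)" "square_integrable N (far r f x)"
  by (rule N.square_integrable_bounded[where B=F];
      use f_bound F_nonneg in \<open>auto simp: near_def far_def\<close>)+

lemma cball_N [measurable]: "cball x r \<inter> D \<in> sets N"
  by (auto simp: sets_restrict_space D_sets[simplified])

lemma measure_cball_N:
  assumes "0 \<le> r"
  shows "measure N (cball x r \<inter> D) \<le> unit_ball_vol (real DIM('a)) * r ^ DIM('a)"
proof -
  have fm: "cball x r \<in> fmeasurable lborel"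
    by (rule fmeasurableI[OF _ emeasure_bounded_finite[OF bounded_cball]]) simp
  have "measure N (cball x r \<inter> D) = measure lborel (cball x r \<inter> D)"
    using D_sets by (intro measure_restrict_space) auto
  also have "\<dots> \<le> measure lborel (cball x r)"
    by (intro measure_mono_fmeasurable fm) (use D_sets in auto)
  also have "\<dots> = unit_ball_vol (real DIM('a)) * r ^ DIM('a)" by (rule content_cball[OF assms])
  finally show ?thesis .
qed

lemma integral_near_le:
  assumes "0 \<le> r"
  shows "(LINT y|N. (near r f x y)\<^sup>2) \<le> F\<^sup>2 * (unit_ball_vol (real DIM('a)) * r ^ DIM('a))"
proof -
  have "(LINT y|N. (near r f x y)\<^sup>2) \<le> (LINT y|N. indicator (cball x r \<inter> D) y * F\<^sup>2)"
  proof (rule integral_mono)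
    show "integrable N (\<lambda>y. indicator (cball x r \<inter> D) y * F\<^sup>2)"
      by (intro integrable_mult_left integrable_real_indicator) (auto simp: less_top[symmetric])
    show "(near r f x y)\<^sup>2 \<le> indicator (cball x r \<inter> D) y * F\<^sup>2" if "y \<in> space N" for y
      using that f_bound[of y] power_mono[of "\<bar>f y\<bar>" F 2] by (auto simp: near_def indicator_def)
  qed (rule square_integrable_power2[OF square_integrable_near(1)])
  also have "\<dots> = F\<^sup>2 * measure N (cball x r \<inter> D)" by (simp add: Int_commute)
  also have "\<dots> \<le> F\<^sup>2 * (unit_ball_vol (real DIM('a)) * r ^ DIM('a))"
    by (intro mult_left_mono measure_cball_N assms) simp
  finally show ?thesis .
qed

lemma norm2_fluct_near:
  assumes "0 \<le> r" "0 < \<epsilon>"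
  shows "norm2 M (fluct \<epsilon> (near r f x)) \<le> sqrt corr_mass * (F * sqrt (unit_ball_vol (real DIM('a)) * r ^ DIM('a)))"
proof -
  have "norm2 N (near r f x) \<le> sqrt (F\<^sup>2 * (unit_ball_vol (real DIM('a)) * r ^ DIM('a)))"
    unfolding norm2_def by (intro real_sqrt_le_mono integral_near_le assms)
  also have "\<dots> = F * sqrt (unit_ball_vol (real DIM('a)) * r ^ DIM('a))"
    using F_nonneg by (simp add: real_sqrt_mult)
  finally show ?thesis
    by (intro order_trans[OF norm2_fluct[OF square_integrable_near(1) assms(2)]] mult_left_mono)
      (simp_all add: corr_mass_nonneg)
qed

text \<open>In contrast to \<open>norm2_fluct_near\<close>, which rests on the variance bound, this
  one uses the crude pathwise estimate with \<open>p = 2\<close>. Cancellation is lost, so a factor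
  eps^(-d/2) remains against r^d, but a fourth moment suffices and no joint fourth order
  correlations have to be estimated.\<close>

lemma norm2_Q_fluct_near:
  assumes "0 \<le> r"
  shows "square_integrable M (\<lambda>\<omega>. Q \<epsilon> x \<omega> * fluct \<epsilon> (near r f x) \<omega>)"
    and "norm2 M (\<lambda>\<omega>. Q \<epsilon> x \<omega> * fluct \<epsilon> (near r f x) \<omega>)
      \<le> \<epsilon> powr (- real DIM('a) / 2) * (F * (unit_ball_vol (real DIM('a)) * r ^ DIM('a)) * sqrt (2 * moment 4))"
proof -
  let ?s = "\<epsilon> powr (- real DIM('a) / 2)" and ?A = "cball x r \<inter> D"
    and ?v = "unit_ball_vol (real DIM('a)) * r ^ DIM('a)"
  have e: "(Q \<epsilon> x \<omega> * fluct \<epsilon> (near r f x) \<omega>)\<^sup>2 = ?s\<^sup>2 * (\<bar>Q \<epsilon> x \<omega>\<bar> ^ 2 * (osc \<epsilon> (near r f x) \<omega>)\<^sup>2)" for \<omega>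
    by (simp add: fluct_def power_mult_distrib)
  have v: "0 \<le> ?v" using assms by simp
  have aux: "s\<^sup>2 * ((a\<^sup>2 * b) * (b * c)) = (s * (a * b * sqrt c))\<^sup>2" if "0 \<le> c" for s a b c :: real
    using that by (simp add: power_mult_distrib) (simp add: power2_eq_square)
  note w = osc_weighted[OF square_integrable_near(1)[of r x], of ?A 2 \<epsilon> x]
  have ns: "near r f x y = 0" if "y \<in> D" "y \<notin> ?A" for y using that by (auto simp: near_def)
  show "square_integrable M (\<lambda>\<omega>. Q \<epsilon> x \<omega> * fluct \<epsilon> (near r f x) \<omega>)"
    unfolding square_integrable_def e
    using w(1)[OF cball_N ns] by auto
  show "norm2 M (\<lambda>\<omega>. Q \<epsilon> x \<omega> * fluct \<epsilon> (near r f x) \<omega>) \<le> ?s * (F * ?v * sqrt (2 * moment 4))"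
  proof (rule power2_le_imp_le)
    have "(norm2 M (\<lambda>\<omega>. Q \<epsilon> x \<omega> * fluct \<epsilon> (near r f x) \<omega>))\<^sup>2
        = ?s\<^sup>2 * (LINT \<omega>|M. \<bar>Q \<epsilon> x \<omega>\<bar> ^ 2 * (osc \<epsilon> (near r f x) \<omega>)\<^sup>2)"
      unfolding norm2_power2 e by simp
    also have "\<dots> \<le> ?s\<^sup>2 * ((LINT y|N. (near r f x y)\<^sup>2) * (measure N ?A * (2 * moment (2 + 2))))"
      by (intro mult_left_mono w(2)[OF cball_N ns]) auto
    also have "\<dots> \<le> ?s\<^sup>2 * ((F\<^sup>2 * ?v) * (?v * (2 * moment 4)))"
      using assms moment_nonneg[of 4] v
      by (intro mult_left_mono mult_mono integral_near_le measure_cball_N mult_right_mono) auto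
    also have "\<dots> = (?s * (F * ?v * sqrt (2 * moment 4)))\<^sup>2"
      by (rule aux) (use moment_nonneg[of 4] in simp)
    finally show "(norm2 M (\<lambda>\<omega>. Q \<epsilon> x \<omega> * fluct \<epsilon> (near r f x) \<omega>))\<^sup>2 \<le> (?s * (F * ?v * sqrt (2 * moment 4)))\<^sup>2" .
    show "0 \<le> ?s * (F * ?v * sqrt (2 * moment 4))"
      using F_nonneg assms moment_nonneg[of 4] by (intro mult_nonneg_nonneg real_sqrt_ge_zero powr_ge_zero) auto
  qed
qed

lemma fluct_near_far:
  "AE \<omega> in M. fluct \<epsilon> f \<omega> - fluct \<epsilon> (near r f x) \<omega> = fluct \<epsilon> (far r f x) \<omega>"
proof -
  have "f = (\<lambda>y. near r f x y + far r f x y)" by (auto simp: near_def far_def)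
  then have "AE \<omega> in M. fluct \<epsilon> f \<omega> = fluct \<epsilon> (near r f x) \<omega> + fluct \<epsilon> (far r f x) \<omega>"
    using fluct_add_AE[of "near r f x" "far r f x" \<epsilon>] square_integrable_near N.square_integrable_integrable by metis
  then show ?thesis by eventually_elim simp
qed

text \<open>The coefficient produced by the expansion around \<open>x\<close>. The radius is
  \<open>L * \<epsilon>\<close>, so \<open>L\<close> is measured on the scale of the unscaled
  field.\<close>

definition local_cov :: "real \<Rightarrow> real \<Rightarrow> 'a \<Rightarrow> real" where
  "local_cov \<epsilon> L x = (LINT \<omega>|M. Q \<epsilon> x \<omega> * fluct \<epsilon> (near (L * \<epsilon>) f x) \<omega>)"

lemma local_cov_eq:
  "local_cov \<epsilon> L x = \<epsilon> powr (- real DIM('a) / 2)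
    * (LINT y|N. near (L * \<epsilon>) f x y * correlation M q ((x - y) /\<^sub>R \<epsilon>))"
proof -
  have "local_cov \<epsilon> L x = (LINT \<omega>|M. \<epsilon> powr (- real DIM('a) / 2) * (Q \<epsilon> x \<omega> * osc \<epsilon> (near (L * \<epsilon>) f x) \<omega>))"
    by (simp add: local_cov_def fluct_def mult_ac)
  then show ?thesis
    using expectation_Q_osc[OF N.square_integrable_integrable[OF square_integrable_near(1)]] by simp
qed

lemma local_cov_measurable [measurable]: "local_cov \<epsilon> L \<in> borel_measurable N"
proof -
  note [measurable] = measurable_compose[OF measurable_fst ident_measurable_N, of N]
    measurable_compose[OF measurable_snd ident_measurable_N, of N]
  have "(\<lambda>p. correlation M q ((fst p - snd p) /\<^sub>R \<epsilon>)) \<in> borel_measurable (N \<Otimes>\<^sub>M N)" by measurable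
  then have "(\<lambda>p. near (L * \<epsilon>) f (fst p) (snd p) * correlation M q ((fst p - snd p) /\<^sub>R \<epsilon>))
      \<in> borel_measurable (N \<Otimes>\<^sub>M N)"
    by (intro borel_measurable_times near_measurable)
  then have "(\<lambda>x. LINT y|N. near (L * \<epsilon>) f x y * correlation M q ((x - y) /\<^sub>R \<epsilon>)) \<in> borel_measurable N"
    by (intro N.borel_measurable_lebesgue_integral) (simp only: case_prod_beta')
  then have "(\<lambda>x. \<epsilon> powr (- real DIM('a) / 2)
      * (LINT y|N. near (L * \<epsilon>) f x y * correlation M q ((x - y) /\<^sub>R \<epsilon>))) \<in> borel_measurable N"
    by (intro borel_measurable_times borel_measurable_const)
  then show ?thesis unfolding local_cov_eq[symmetric] .
qed

text \<open>In the variable \<open>z = (x - y) / \<epsilon>\<close>, with \<open>f\<close> extended by zero.\<close>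

lemma local_cov_rescaled:
  assumes \<epsilon>: "0 < \<epsilon>"
  shows "\<epsilon> powr (- real DIM('a) / 2) * local_cov \<epsilon> L x
    = (LINT z|lborel. (if norm z \<le> L then indicator D (x - \<epsilon> *\<^sub>R z) * f (x - \<epsilon> *\<^sub>R z) else 0) * correlation M q z)"
proof -
  have [measurable]: "(\<lambda>y. indicator D y * f y) \<in> borel_measurable borel"
    using f_meas D_sets by (subst (asm) borel_measurable_restrict_space_iff) (auto simp: mult.commute)
  define g where "g y = (if dist x y \<le> L * \<epsilon> then indicator D y * f y else 0) * correlation M q ((x - y) /\<^sub>R \<epsilon>)" for y
  have [measurable]: "g \<in> borel_measurable borel" unfolding g_def by measurable
  have "(LINT y|N. near (L * \<epsilon>) f x y * correlation M q ((x - y) /\<^sub>R \<epsilon>)) = (LINT y|lborel. g y)"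
    using D_sets by (subst integral_restrict_space)
      (auto simp: g_def near_def indicator_def intro!: Bochner_Integration.integral_cong)
  also have "\<dots> = (LINT y|density (distr lborel borel (\<lambda>z. x + (- \<epsilon>) *\<^sub>R z)) (\<lambda>_. ennreal (\<bar>- \<epsilon>\<bar> ^ DIM('a))). g y)"
    using lborel_affine[of "- \<epsilon>" x] \<epsilon> by simp
  also have "\<dots> = (LINT z|lborel. \<epsilon> ^ DIM('a) * g (x - \<epsilon> *\<^sub>R z))"
    using \<epsilon> by (subst integral_density) (auto simp: integral_distr)
  also have "\<dots> = \<epsilon> ^ DIM('a) * (LINT z|lborel. g (x - \<epsilon> *\<^sub>R z))" by simp
  also have "(\<lambda>z. g (x - \<epsilon> *\<^sub>R z)) = (\<lambda>z. (if norm z \<le> L then indicator D (x - \<epsilon> *\<^sub>R z) * f (x - \<epsilon> *\<^sub>R z) else 0) * correlation M q z)"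
  proof
    fix z
    have "dist x (x - \<epsilon> *\<^sub>R z) = norm z * \<epsilon>" using \<epsilon> by (simp add: dist_norm)
    then show "g (x - \<epsilon> *\<^sub>R z) = (if norm z \<le> L then indicator D (x - \<epsilon> *\<^sub>R z) * f (x - \<epsilon> *\<^sub>R z) else 0) * correlation M q z"
      using \<epsilon> by (simp add: g_def)
  qed
  finally have eq: "(LINT y|N. near (L * \<epsilon>) f x y * correlation M q ((x - y) /\<^sub>R \<epsilon>)) = \<epsilon> ^ DIM('a) *
      (LINT z|lborel. (if norm z \<le> L then indicator D (x - \<epsilon> *\<^sub>R z) * f (x - \<epsilon> *\<^sub>R z) else 0) * correlation M q z)" .
  have e: "\<epsilon> powr (- real DIM('a) / 2) * \<epsilon> powr (- real DIM('a) / 2) * \<epsilon> ^ DIM('a) = 1"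
    unfolding powr_realpow[OF \<epsilon>, symmetric] powr_add[symmetric] using \<epsilon> by simp
  show ?thesis unfolding local_cov_eq eq mult.assoc[symmetric] e by simp
qed

lemma local_cov_rescaled_bound:
  assumes \<epsilon>: "0 < \<epsilon>"
  shows "\<bar>\<epsilon> powr (- real DIM('a) / 2) * local_cov \<epsilon> L x\<bar> \<le> F * corr_mass"
proof -
  let ?h = "\<lambda>z. (if norm z \<le> L then indicator D (x - \<epsilon> *\<^sub>R z) * f (x - \<epsilon> *\<^sub>R z) else 0) * correlation M q z"
  have "\<bar>LINT z|lborel. ?h z\<bar> \<le> (LINT z|lborel. \<bar>?h z\<bar>)" by (rule integral_abs_bound)
  also have "\<dots> \<le> (LINT z|lborel. F * \<bar>correlation M q z\<bar>)"
    by (rule integral_mono_AE')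
      (use q_correlation f_bound F_nonneg in \<open>auto simp: abs_mult indicator_def intro!: AE_I2 mult_right_mono\<close>)
  also have "\<dots> = F * corr_mass" by (simp add: corr_mass_def)
  finally show ?thesis unfolding local_cov_rescaled[OF \<epsilon>] .
qed

text \<open>For fixed \<open>z\<close> the point \<open>x - e k *\<^sub>R z\<close> eventually lies
  in the open set \<open>D\<close> and \<open>norm z \<le> L k\<close>, so the integrand converges
  by continuity of \<open>f\<close> at \<open>x\<close>; a multiple of the correlation function
  dominates.\<close>

lemma local_cov_limit:
  assumes D: "open D" and cont: "continuous_on D f" and x: "x \<in> D"
    and e: "\<And>k. 0 < e k" "e \<longlonglongrightarrow> 0" and L: "filterlim L at_top sequentially"
  shows "(\<lambda>k. e k powr (- real DIM('a) / 2) * local_cov (e k) (L k) x) \<longlonglongrightarrow> f x * (LINT z|lborel. correlation M q z)"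
proof -
  have [measurable]: "(\<lambda>y. indicator D y * f y) \<in> borel_measurable borel"
    using f_meas D_sets by (subst (asm) borel_measurable_restrict_space_iff) (auto simp: mult.commute)
  have m: "(\<lambda>z. indicator D (x - c *\<^sub>R z) * f (x - c *\<^sub>R z)) \<in> borel_measurable borel" for c
    by (rule measurable_compose[of "\<lambda>z. x - c *\<^sub>R z" borel borel]) measurable
  let ?h = "\<lambda>k z. (if norm z \<le> L k then indicator D (x - e k *\<^sub>R z) * f (x - e k *\<^sub>R z) else 0) * correlation M q z"
  have "(\<lambda>k. LINT z|lborel. ?h k z) \<longlonglongrightarrow> (LINT z|lborel. f x * correlation M q z)"
  proof (rule integral_dominated_convergence[where w="\<lambda>z. F * \<bar>correlation M q z\<bar>"])
    show "AE z in lborel. (\<lambda>k. ?h k z) \<longlonglongrightarrow> f x * correlation M q z"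
    proof (rule AE_I2)
      fix z
      have lim: "(\<lambda>k. x - e k *\<^sub>R z) \<longlonglongrightarrow> x"
      proof -
        have "(\<lambda>k. x - e k *\<^sub>R z) \<longlonglongrightarrow> x - 0 *\<^sub>R z" by (intro tendsto_intros e)
        then show ?thesis by simp
      qed
      have "isCont f x" using cont D x by (simp add: continuous_on_eq_continuous_at)
      then have fl: "(\<lambda>k. f (x - e k *\<^sub>R z)) \<longlonglongrightarrow> f x" by (rule isCont_tendsto_compose[OF _ lim])
      have ev1: "eventually (\<lambda>k. x - e k *\<^sub>R z \<in> D) sequentially" by (rule topological_tendstoD[OF lim D x])
      have ev2: "eventually (\<lambda>k. norm z \<le> L k) sequentially" using L by (auto simp: filterlim_at_top)
      have "(\<lambda>k. f (x - e k *\<^sub>R z) * correlation M q z) \<longlonglongrightarrow> f x * correlation M q z"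
        by (intro tendsto_intros fl)
      then show "(\<lambda>k. ?h k z) \<longlonglongrightarrow> f x * correlation M q z"
        by (rule Lim_transform_eventually) (use ev1 ev2 in eventually_elim, simp)
    qed
    show "AE z in lborel. norm (?h k z) \<le> F * \<bar>correlation M q z\<bar>" for k
      using f_bound F_nonneg by (auto simp: abs_mult indicator_def intro!: AE_I2 mult_right_mono)
    show "?h k \<in> borel_measurable lborel" for k using m[of "e k"] by measurable
  qed (use q_correlation in auto)
  then show ?thesis unfolding local_cov_rescaled[OF e(1)] by simp
qed

lemma local_cov_integral_limit:
  assumes D: "open D" and cont: "continuous_on D f"
    and e: "\<And>k. 0 < e k" "e \<longlonglongrightarrow> 0" and L: "filterlim L at_top sequentially"
  shows "(\<lambda>k. LINT x|N. f x * (e k powr (- real DIM('a) / 2) * local_cov (e k) (L k) x))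
    \<longlonglongrightarrow> (LINT z|lborel. correlation M q z) * (LINT x|N. (f x)\<^sup>2)"
proof -
  have "(\<lambda>k. LINT x|N. f x * (e k powr (- real DIM('a) / 2) * local_cov (e k) (L k) x))
    \<longlonglongrightarrow> (LINT x|N. f x * (f x * (LINT z|lborel. correlation M q z)))"
  proof (rule integral_dominated_convergence[where w="\<lambda>_. F * (F * corr_mass)"])
    show "AE x in N. (\<lambda>k. f x * (e k powr (- real DIM('a) / 2) * local_cov (e k) (L k) x))
        \<longlonglongrightarrow> f x * (f x * (LINT z|lborel. correlation M q z))"
      by (intro AE_I2 tendsto_mult tendsto_const local_cov_limit[OF D cont _ e L]) simp
    show "AE x in N. norm (f x * (e k powr (- real DIM('a) / 2) * local_cov (e k) (L k) x)) \<le> F * (F * corr_mass)" for k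
    proof (rule AE_I2)
      fix x assume "x \<in> space N"
      then have "\<bar>f x\<bar> * \<bar>e k powr (- real DIM('a) / 2) * local_cov (e k) (L k) x\<bar> \<le> F * (F * corr_mass)"
        using local_cov_rescaled_bound[OF e(1), of k "L k" x] f_bound[of x] F_nonneg
        by (intro mult_mono) simp_all
      then show "norm (f x * (e k powr (- real DIM('a) / 2) * local_cov (e k) (L k) x)) \<le> F * (F * corr_mass)"
        unfolding real_norm_def abs_mult[of "f x"] .
    qed
  qed auto
  moreover have "(\<lambda>x. f x * (f x * (LINT z|lborel. correlation M q z)))
      = (\<lambda>x. (LINT z|lborel. correlation M q z) * (f x)\<^sup>2)"
    by (auto simp: power2_eq_square)
  ultimately show ?thesis by simp
qed

end

end

context mixing_field_on begin

text \<open>The three error terms are the decoupling of the centred value at \<open>x\<close> from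
  everything beyond scaled distance \<open>L\<close>, the decoupling of its product with the near
  part across the shell between radii \<open>L\<close> and \<open>2 * L\<close>, and the Taylor
  terms. \<open>C\<close> is the mixing constant alone, so the estimate is uniform in
  \<open>x\<close> and can be integrated over \<open>D\<close>.\<close>

lemma stein_local:
  obtains C where "0 \<le> C"
    "\<And>f F \<epsilon> L x t. f \<in> borel_measurable N \<Longrightarrow> \<forall>x\<in>D. \<bar>f x\<bar> \<le> F \<Longrightarrow> 0 \<le> F \<Longrightarrow> 0 < \<epsilon> \<Longrightarrow> 0 < L \<Longrightarrow>
      cmod ((LINT \<omega>|M. Q \<epsilon> x \<omega> *\<^sub>R iexp (t * fluct \<epsilon> f \<omega>))
        - (\<i> * (t * local_cov f \<epsilon> L x)) * (LINT \<omega>|M. iexp (t * fluct \<epsilon> f \<omega>)))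
      \<le> C / L ^ (2 * DIM('a)) * sqrt (moment 2)
        + \<bar>t\<bar> * (C / L ^ (2 * DIM('a)) * (\<epsilon> powr (- real DIM('a) / 2)
            * (F * (unit_ball_vol (real DIM('a)) * (L * \<epsilon>) ^ DIM('a)) * sqrt (2 * moment 4))))
        + 4 * t\<^sup>2 * ((sqrt corr_mass * (F * sqrt (unit_ball_vol (real DIM('a)) * (2 * L * \<epsilon>) ^ DIM('a))))
          * (\<epsilon> powr (- real DIM('a) / 2)
            * (F * (unit_ball_vol (real DIM('a)) * (L * \<epsilon>) ^ DIM('a)) * sqrt (2 * moment 4))))"
proof -
  obtain C where C: "0 \<le> C" and
    mix: "\<And>L S T \<zeta> \<zeta>' Y Y' t. 0 < L \<Longrightarrow> S \<in> sets borel \<Longrightarrow> T \<in> sets borel \<Longrightarrow> L \<le> setdist S T \<Longrightarrow>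
      \<zeta>' \<in> borel_measurable (sigma_generated M q S) \<Longrightarrow> Y' \<in> borel_measurable (sigma_generated M q T) \<Longrightarrow>
      square_integrable M \<zeta> \<Longrightarrow> Y \<in> borel_measurable M \<Longrightarrow>
      AE \<omega> in M. \<zeta> \<omega> = \<zeta>' \<omega> \<Longrightarrow> AE \<omega> in M. Y \<omega> = Y' \<omega> \<Longrightarrow>
      cmod ((LINT \<omega>|M. \<zeta> \<omega> *\<^sub>R iexp (t * Y \<omega>)) - (LINT \<omega>|M. \<zeta> \<omega>) *\<^sub>R (LINT \<omega>|M. iexp (t * Y \<omega>)))
        \<le> C / L ^ (2 * DIM('a)) * norm2 M \<zeta>"
    by (rule mixing_iexp) blast
  show ?thesis
  proof (rule that[OF C])
    fix f :: "'a \<Rightarrow> real" and F \<epsilon> L t :: real and x :: 'a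
    assume fm [measurable]: "f \<in> borel_measurable N" and fb: "\<forall>x\<in>D. \<bar>f x\<bar> \<le> F" and F: "0 \<le> F"
      and \<epsilon>: "0 < \<epsilon>" and L: "0 < L"
    note f = fm fb F
    note near_sq = square_integrable_near[OF f]
    let ?v = "unit_ball_vol (real DIM('a))"
    let ?X1 = "fluct \<epsilon> (near (L * \<epsilon>) f x)" and ?X2 = "fluct \<epsilon> (near (2 * L * \<epsilon>) f x)"
    let ?b = "\<epsilon> powr (- real DIM('a) / 2) * (F * (?v * (L * \<epsilon>) ^ DIM('a)) * sqrt (2 * moment 4))"
    let ?a = "sqrt corr_mass * (F * sqrt (?v * (2 * L * \<epsilon>) ^ DIM('a)))"
    have r: "0 \<le> L * \<epsilon>" "0 \<le> 2 * L * \<epsilon>" using \<epsilon> L by auto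
    have bX: "norm2 M (\<lambda>\<omega>. Q \<epsilon> x \<omega> * ?X1 \<omega>) \<le> ?b" by (rule norm2_Q_fluct_near(2)[OF f r(1)])
    have a2: "norm2 M ?X2 \<le> ?a" by (rule norm2_fluct_near[OF f r(2) \<epsilon>])
    have a1: "norm2 M ?X1 \<le> ?a"
    proof (rule order_trans[OF norm2_fluct_near[OF f r(1) \<epsilon>]])
      show "sqrt corr_mass * (F * sqrt (?v * (L * \<epsilon>) ^ DIM('a))) \<le> ?a"
        using \<epsilon> L F corr_mass_nonneg by (intro mult_left_mono real_sqrt_le_mono power_mono) auto
    qed
    have dist_scaled: "dist (x /\<^sub>R \<epsilon>) (y /\<^sub>R \<epsilon>) = dist x y / \<epsilon>" for y
      using \<epsilon> by (simp add: dist_norm divide_inverse mult.commute flip: scaleR_diff_right)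
    have far_v: "\<exists>J. J \<in> borel_measurable (sigma_generated M q (- cball (x /\<^sub>R \<epsilon>) R)) \<and>
        (AE \<omega> in M. fluct \<epsilon> f \<omega> - fluct \<epsilon> (near (R * \<epsilon>) f x) \<omega> = J \<omega>)" for R
    proof -
      have S: "y /\<^sub>R \<epsilon> \<in> - cball (x /\<^sub>R \<epsilon>) R" if "far (R * \<epsilon>) f x y \<noteq> 0" for y
      proof -
        have "dist x y > R * \<epsilon>" using that by (auto simp: far_def split: if_splits)
        then have "R < dist (x /\<^sub>R \<epsilon>) (y /\<^sub>R \<epsilon>)"
          unfolding dist_scaled using \<epsilon> by (simp add: pos_less_divide_eq)
        then show ?thesis by simp
      qed
      obtain J where J: "J \<in> borel_measurable (sigma_generated M q (- cball (x /\<^sub>R \<epsilon>) R))"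
        "AE \<omega> in M. osc \<epsilon> (far (R * \<epsilon>) f x) \<omega> = J \<omega>"
        by (rule osc_version[OF near_sq(2) S])
      show ?thesis
      proof (intro exI[of _ "\<lambda>\<omega>. \<epsilon> powr (- real DIM('a) / 2) * J \<omega>"] conjI)
        show "AE \<omega> in M. fluct \<epsilon> f \<omega> - fluct \<epsilon> (near (R * \<epsilon>) f x) \<omega> = \<epsilon> powr (- real DIM('a) / 2) * J \<omega>"
          using fluct_near_far[OF f, of \<epsilon> "R * \<epsilon>" x] J(2) by eventually_elim (simp add: fluct_def)
      qed (intro borel_measurable_times borel_measurable_const J)
    qed
    have Ym: "(\<lambda>\<omega>. fluct \<epsilon> f \<omega> - fluct \<epsilon> (near r f x) \<omega>) \<in> borel_measurable M" for r
      by (intro borel_measurable_diff fluct_measurable fm near_measurable(1)[OF f])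
    \<comment> \<open>\<open>setdist\<close> to the empty set is 0, so the lower bounds on distances
      below rely on this complement being nonempty.\<close>
    have ne: "- cball (x /\<^sub>R \<epsilon>) R \<noteq> {}" for R
    proof
      assume "- cball (x /\<^sub>R \<epsilon>) R = {}"
      then have "cball (x /\<^sub>R \<epsilon>) R = UNIV" by blast
      then show False using bounded_cball[of "x /\<^sub>R \<epsilon>" R] not_bounded_UNIV by metis
    qed
    have c1: "cmod (LINT \<omega>|M. Q \<epsilon> x \<omega> *\<^sub>R iexp (t * (fluct \<epsilon> f \<omega> - ?X1 \<omega>))) \<le> C / L ^ (2 * DIM('a)) * sqrt (moment 2)"
    proof -
      obtain J where J: "J \<in> borel_measurable (sigma_generated M q (- cball (x /\<^sub>R \<epsilon>) L))"
        "AE \<omega> in M. fluct \<epsilon> f \<omega> - ?X1 \<omega> = J \<omega>" using far_v[of L] by (elim exE conjE)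
      have "L \<le> setdist {x /\<^sub>R \<epsilon>} (- cball (x /\<^sub>R \<epsilon>) L)"
        using ne by (intro le_setdistI) auto
      \<comment> \<open>Since \<open>q\<close> has mean zero, the product of expectations drops out
        and decoupling bounds the integral itself.\<close>
      from mix[OF L _ _ this _ J(1) square_integrable_Q[of \<epsilon> x] Ym _ J(2), of "\<lambda>\<omega>. Q \<epsilon> x \<omega>" t]
      show ?thesis
        using q_sigma_generated[of "x /\<^sub>R \<epsilon>" "{x /\<^sub>R \<epsilon>}"] q_mean norm2_Q
        by (simp add: scaled_potential_def)
    qed
    have c2: "cmod ((LINT \<omega>|M. (Q \<epsilon> x \<omega> * ?X1 \<omega>) *\<^sub>R iexp (t * (fluct \<epsilon> f \<omega> - ?X2 \<omega>)))
        - (LINT \<omega>|M. Q \<epsilon> x \<omega> * ?X1 \<omega>) *\<^sub>R (LINT \<omega>|M. iexp (t * (fluct \<epsilon> f \<omega> - ?X2 \<omega>))))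
        \<le> C / L ^ (2 * DIM('a)) * ?b"
    proof -
      obtain J where J: "J \<in> borel_measurable (sigma_generated M q (- cball (x /\<^sub>R \<epsilon>) (2 * L)))"
        "AE \<omega> in M. fluct \<epsilon> f \<omega> - ?X2 \<omega> = J \<omega>" using far_v[of "2 * L"] by (elim exE conjE)
      have S: "y /\<^sub>R \<epsilon> \<in> cball (x /\<^sub>R \<epsilon>) L" if "near (L * \<epsilon>) f x y \<noteq> 0" for y
      proof -
        have "dist x y \<le> L * \<epsilon>" using that by (auto simp: near_def split: if_splits)
        then have "dist (x /\<^sub>R \<epsilon>) (y /\<^sub>R \<epsilon>) \<le> L"
          unfolding dist_scaled using \<epsilon> by (simp add: pos_divide_le_eq)
        then show ?thesis by simp
      qed
      obtain J1 where J1: "J1 \<in> borel_measurable (sigma_generated M q (cball (x /\<^sub>R \<epsilon>) L))"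
        "AE \<omega> in M. osc \<epsilon> (near (L * \<epsilon>) f x) \<omega> = J1 \<omega>"
        by (rule osc_version[OF near_sq(1) S])
      let ?\<zeta> = "\<lambda>\<omega>. q (x /\<^sub>R \<epsilon>) \<omega> * (\<epsilon> powr (- real DIM('a) / 2) * J1 \<omega>)"
      have \<zeta>: "?\<zeta> \<in> borel_measurable (sigma_generated M q (cball (x /\<^sub>R \<epsilon>) L))"
        using L by (intro borel_measurable_times borel_measurable_const J1 q_sigma_generated) auto
      have \<zeta>ae: "AE \<omega> in M. Q \<epsilon> x \<omega> * ?X1 \<omega> = ?\<zeta> \<omega>"
        using J1(2) by eventually_elim (simp add: fluct_def scaled_potential_def)
      have sd: "L \<le> setdist (cball (x /\<^sub>R \<epsilon>) L) (- cball (x /\<^sub>R \<epsilon>) (2 * L))"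
      proof (rule le_setdistI)
        fix y z assume yz: "y \<in> cball (x /\<^sub>R \<epsilon>) L" "z \<in> - cball (x /\<^sub>R \<epsilon>) (2 * L)"
        then show "L \<le> dist y z" using dist_triangle[of "x /\<^sub>R \<epsilon>" z y] by auto
      qed (use ne L in auto)
      have "cmod ((LINT \<omega>|M. (Q \<epsilon> x \<omega> * ?X1 \<omega>) *\<^sub>R iexp (t * (fluct \<epsilon> f \<omega> - ?X2 \<omega>)))
        - (LINT \<omega>|M. Q \<epsilon> x \<omega> * ?X1 \<omega>) *\<^sub>R (LINT \<omega>|M. iexp (t * (fluct \<epsilon> f \<omega> - ?X2 \<omega>))))
        \<le> C / L ^ (2 * DIM('a)) * norm2 M (\<lambda>\<omega>. Q \<epsilon> x \<omega> * ?X1 \<omega>)"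
        by (rule mix[OF L _ _ sd \<zeta> J(1) norm2_Q_fluct_near(1)[OF f r(1)] Ym \<zeta>ae J(2)]) auto
      also have "\<dots> \<le> C / L ^ (2 * DIM('a)) * ?b" using C L by (intro mult_left_mono bX) auto
      finally show ?thesis .
    qed
    show "cmod ((LINT \<omega>|M. Q \<epsilon> x \<omega> *\<^sub>R iexp (t * fluct \<epsilon> f \<omega>))
        - (\<i> * (t * local_cov f \<epsilon> L x)) * (LINT \<omega>|M. iexp (t * fluct \<epsilon> f \<omega>)))
      \<le> C / L ^ (2 * DIM('a)) * sqrt (moment 2) + \<bar>t\<bar> * (C / L ^ (2 * DIM('a)) * ?b) + 4 * t\<^sup>2 * (?a * ?b)"
      unfolding local_cov_def[OF f]
      by (rule stein_expansion[OF square_integrable_Q fluct_measurable[OF fm] square_integrable_fluct[OF near_sq(1)]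
          square_integrable_fluct[OF near_sq(1)] norm2_Q_fluct_near(1)[OF f r(1)] c1 c2 bX a1 a2])
  qed
qed

end

text \<open>Power counting with L^(-2d) = p^(6d/10) and (L p)^d = p^(7d/10). The resulting exponents
  are 6d/10 - d/2 = d/10, then 6d/10 + 7d/10 - d = 3d/10, and (3/2)(7d/10) - d = d/20; all are
  positive.\<close>

lemma stein_error_asymptotics:
  fixes p C T V F w \<kappa> m :: real and d :: nat
  assumes p: "0 < p" and V: "0 \<le> V"
  defines "s \<equiv> p powr (- real d / 2)" and "L \<equiv> p powr (- 3 / 10)"
  shows "s * (C / L ^ (2 * d) * m + T * (C / L ^ (2 * d) * (s * (F * (V * (L * p) ^ d) * w)))
      + 4 * T\<^sup>2 * ((\<kappa> * (F * sqrt (V * (2 * L * p) ^ d))) * (s * (F * (V * (L * p) ^ d) * w))))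
    = C * m * p powr (real d / 10) + T * C * F * V * w * p powr (3 * real d / 10)
      + 4 * T\<^sup>2 * \<kappa> * F * sqrt (V * 2 ^ d) * F * V * w * p powr (real d / 20)"
proof -
  have pw: "(p powr x) ^ n = p powr (x * real n)" for x n
    using p by (simp add: powr_realpow[symmetric] powr_powr)
  have L2: "1 / L ^ (2 * d) = p powr (6 * real d / 10)"
    unfolding L_def pw by (simp add: powr_minus_divide[symmetric])
  have "L * p = p powr (- 3 / 10 + 1)" unfolding L_def powr_add using p by simp
  then have Lp: "(L * p) ^ d = p powr (7 * real d / 10)" by (simp add: pw)
  have 1: "s * (1 / L ^ (2 * d)) = p powr (real d / 10)"
    unfolding L2 s_def powr_add[symmetric] by (rule arg_cong[of _ _ "(powr) p"]) simp
  have 2: "s * (1 / L ^ (2 * d)) * (s * (L * p) ^ d) = p powr (3 * real d / 10)"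
    unfolding L2 Lp s_def powr_add[symmetric] by (rule arg_cong[of _ _ "(powr) p"]) simp
  have sq: "sqrt ((L * p) ^ d) = p powr (7 * real d / 20)"
    unfolding Lp powr_half_sqrt[symmetric, OF powr_ge_zero] powr_powr by simp
  have 3: "s * (s * (L * p) ^ d) * sqrt ((L * p) ^ d) = p powr (real d / 20)"
    unfolding sq unfolding Lp s_def powr_add[symmetric] by (rule arg_cong[of _ _ "(powr) p"]) simp
  have r: "sqrt (V * (2 * L * p) ^ d) = sqrt (V * 2 ^ d) * sqrt ((L * p) ^ d)"
    by (simp add: power_mult_distrib mult.assoc flip: real_sqrt_mult)
  have "s * (C / L ^ (2 * d) * m + T * (C / L ^ (2 * d) * (s * (F * (V * (L * p) ^ d) * w)))
      + 4 * T\<^sup>2 * ((\<kappa> * (F * sqrt (V * (2 * L * p) ^ d))) * (s * (F * (V * (L * p) ^ d) * w))))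
    = C * m * (s * (1 / L ^ (2 * d))) + T * C * F * V * w * (s * (1 / L ^ (2 * d)) * (s * (L * p) ^ d))
      + 4 * T\<^sup>2 * \<kappa> * F * sqrt (V * 2 ^ d) * F * V * w * (s * (s * (L * p) ^ d) * sqrt ((L * p) ^ d))"
    unfolding r divide_inverse by (simp only: distrib_left mult_1_left mult_ac)
  then show ?thesis unfolding 2 unfolding 1 3 .
qed

context mixing_field_on begin

text \<open>Integrating the local expansions against \<open>f\<close> reproduces the derivative of
  the characteristic function at the price of one more factor \<open>s k\<close>; hence
  \<open>s k * err k\<close> is what has to vanish. The error is uniform for arguments up to
  \<open>\<bar>t\<bar>\<close>, as the stability estimate requires.\<close>

lemma char_fluct_tendsto:
  assumes fm [measurable]: "f \<in> borel_measurable N" and fb: "\<forall>x\<in>D. \<bar>f x\<bar> \<le> F" and F: "0 \<le> F"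
    and D: "open D" and cont: "continuous_on D f" and e: "\<And>k. 0 < e k" "e \<longlonglongrightarrow> 0"
  shows "(\<lambda>k. LINT \<omega>|M. iexp (t * fluct (e k) f \<omega>)) \<longlonglongrightarrow>
    of_real (exp (- ((LINT z|lborel. correlation M q z) * (LINT x|N. (f x)\<^sup>2)) * t\<^sup>2 / 2))"
proof -
  note f = fm fb F
  define T where "T = \<bar>t\<bar>"
  define d where "d = DIM('a)"
  have d: "0 < d" by (simp add: d_def)
  define L where "L k = e k powr (- 3 / 10)" for k
  have L: "0 < L k" for k using e(1)[of k] by (simp add: L_def)
  have e_at: "filterlim e (at_right 0) sequentially"
    unfolding filterlim_at using e(2) e(1)[THEN less_imp_neq, symmetric] e(1) by (auto intro!: always_eventually)
  have L_top: "filterlim L at_top sequentially"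
  proof -
    have "filterlim (\<lambda>x::real. x powr (- 3 / 10)) at_top (at_right 0)" by real_asymp
    then show ?thesis unfolding L_def[abs_def] by (rule filterlim_compose[OF _ e_at])
  qed
  define V where "V = unit_ball_vol (real d)"
  have V: "0 \<le> V" by (simp add: V_def)
  obtain C where C: "0 \<le> C" and stein: "\<And>f F \<epsilon> L x t. f \<in> borel_measurable N \<Longrightarrow> \<forall>x\<in>D. \<bar>f x\<bar> \<le> F \<Longrightarrow> 0 \<le> F \<Longrightarrow> 0 < \<epsilon> \<Longrightarrow> 0 < L \<Longrightarrow>
      cmod ((LINT \<omega>|M. Q \<epsilon> x \<omega> *\<^sub>R iexp (t * fluct \<epsilon> f \<omega>))
        - (\<i> * (t * local_cov f \<epsilon> L x)) * (LINT \<omega>|M. iexp (t * fluct \<epsilon> f \<omega>)))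
      \<le> C / L ^ (2 * d) * sqrt (moment 2)
        + \<bar>t\<bar> * (C / L ^ (2 * d) * (\<epsilon> powr (- real d / 2)
            * (F * (V * (L * \<epsilon>) ^ d) * sqrt (2 * moment 4))))
        + 4 * t\<^sup>2 * ((sqrt corr_mass * (F * sqrt (V * (2 * L * \<epsilon>) ^ d)))
          * (\<epsilon> powr (- real d / 2) * (F * (V * (L * \<epsilon>) ^ d) * sqrt (2 * moment 4))))"
    unfolding d_def V_def by (rule stein_local) blast
  define s where "s k = e k powr (- real d / 2)" for k
  define err where "err k = C / L k ^ (2 * d) * sqrt (moment 2)
        + T * (C / L k ^ (2 * d) * (s k * (F * (V * (L k * e k) ^ d) * sqrt (2 * moment 4))))
        + 4 * T\<^sup>2 * ((sqrt corr_mass * (F * sqrt (V * (2 * L k * e k) ^ d)))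
          * (s k * (F * (V * (L k * e k) ^ d) * sqrt (2 * moment 4))))" for k
  have s: "0 < s k" for k using e(1)[of k] by (simp add: s_def)
  have T: "0 \<le> T" by (simp add: T_def)
  have s_err: "(\<lambda>k. s k * err k) \<longlonglongrightarrow> 0"
  proof -
    have pw: "(\<lambda>k. e k powr c) \<longlonglongrightarrow> 0" if "0 < c" for c
      by (rule tendsto_zero_powrI[OF e(2) tendsto_const]) (use that less_imp_le[OF e(1)] in auto)
    have "(\<lambda>k. C * sqrt (moment 2) * e k powr (real d / 10)
        + T * C * F * V * sqrt (2 * moment 4) * e k powr (3 * real d / 10)
        + 4 * T\<^sup>2 * sqrt corr_mass * F * sqrt (V * 2 ^ d) * F * V * sqrt (2 * moment 4) * e k powr (real d / 20))
      \<longlonglongrightarrow> C * sqrt (moment 2) * 0 + T * C * F * V * sqrt (2 * moment 4) * 0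
        + 4 * T\<^sup>2 * sqrt corr_mass * F * sqrt (V * 2 ^ d) * F * V * sqrt (2 * moment 4) * 0"
      by (intro tendsto_add tendsto_mult_left pw) (use d in auto)
    then show ?thesis
      unfolding err_def s_def L_def by (subst stein_error_asymptotics[OF e(1) V]) simp
  qed
  define \<psi> where "\<psi> k r = (LINT \<omega>|M. iexp (r * fluct (e k) f \<omega>))" for k r
  define \<psi>' where "\<psi>' k r = \<i> * (LINT \<omega>|M. fluct (e k) f \<omega> *\<^sub>R iexp (r * fluct (e k) f \<omega>))" for k r
  \<comment> \<open>The coefficient of the approximate Gaussian equation at stage \<open>k\<close>;
    only its limit is identified as a variance.\<close>
  define v where "v k = (LINT x|N. f x * (s k * local_cov f (e k) (L k) x))" for k
  define \<mu> where "\<mu> = measure N D"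
  define \<delta> where "\<delta> k = (F * \<mu>) * (s k * err k)" for k
  have fsq: "square_integrable N f" by (rule square_integrable_f[OF f])
  have der: "(\<psi> k has_vector_derivative \<psi>' k r) (at r)" for k r
    unfolding \<psi>_def[abs_def] \<psi>'_def by (rule char_fun_has_vector_derivative[OF square_integrable_fluct[OF fsq]])
  have ode: "cmod (\<psi>' k r + (r * v k) *\<^sub>R \<psi> k r) \<le> \<delta> k" if r: "\<bar>r\<bar> \<le> T" for k r
  proof -
    define Z where "Z \<omega> = iexp (r * fluct (e k) f \<omega>)" for \<omega>
    have [measurable]: "Z \<in> borel_measurable M" unfolding Z_def[abs_def] by measurable
    have Zsq: "square_integrable M (\<lambda>\<omega>. norm (Z \<omega>))" by (simp add: Z_def square_integrable_def)
    note fi = N.square_integrable_integrable[OF fsq]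
    define I where "I x = (LINT \<omega>|M. Q (e k) x \<omega> *\<^sub>R Z \<omega>)" for x
    define lc where "lc x = local_cov f (e k) (L k) x" for x
    define z where "z = (LINT \<omega>|M. Z \<omega>)"
    have iI: "integrable N (\<lambda>x. f x *\<^sub>R I x)"
      using NM.integrable_fst'[OF integrable_Q_scaleR[OF fi _ Zsq, of "e k"]]
      by (simp add: I_def flip: scaleR_scaleR)
    have lcm [measurable]: "lc \<in> borel_measurable N" unfolding lc_def[abs_def] by (rule local_cov_measurable[OF f])
    have ilc: "integrable N (\<lambda>x. f x * (s k * lc x))"
    proof (rule N.integrable_const_bound[where B="F * (F * corr_mass)"])
      show "AE x in N. norm (f x * (s k * lc x)) \<le> F * (F * corr_mass)"
        unfolding real_norm_def abs_mult[of "f _"] s_def lc_def d_def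
        using local_cov_rescaled_bound[OF f e(1)] fb F by (intro AE_I2 mult_mono) simp_all
    qed measurable
    have pt: "cmod (I x - (\<i> * (r * lc x)) * z) \<le> err k" for x
    proof -
      have "cmod (I x - (\<i> * (r * lc x)) * z) \<le> C / L k ^ (2 * d) * sqrt (moment 2)
        + \<bar>r\<bar> * (C / L k ^ (2 * d) * (s k * (F * (V * (L k * e k) ^ d) * sqrt (2 * moment 4))))
        + 4 * r\<^sup>2 * ((sqrt corr_mass * (F * sqrt (V * (2 * L k * e k) ^ d)))
          * (s k * (F * (V * (L k * e k) ^ d) * sqrt (2 * moment 4))))"
        unfolding I_def Z_def z_def lc_def s_def by (rule stein[OF f e(1) L])
      also have "\<dots> \<le> err k"
        unfolding err_def
      proof (intro add_mono mult_right_mono order_refl mult_left_mono)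
        show "r\<^sup>2 \<le> T\<^sup>2" using r power_mono[of "\<bar>r\<bar>" T 2] by simp
      qed (use r C V F L[of k] e(1)[of k] s[of k] moment_nonneg[of 2] moment_nonneg[of 4] corr_mass_nonneg in auto)
      finally show ?thesis .
    qed
    have err: "0 \<le> err k" by (rule order_trans[OF norm_ge_zero pt])
    have E1: "(LINT \<omega>|M. fluct (e k) f \<omega> *\<^sub>R Z \<omega>) = s k *\<^sub>R (LINT x|N. f x *\<^sub>R I x)"
    proof -
      have "(LINT \<omega>|M. fluct (e k) f \<omega> *\<^sub>R Z \<omega>) = (LINT \<omega>|M. s k *\<^sub>R (osc (e k) f \<omega> *\<^sub>R Z \<omega>))"
        by (simp add: fluct_def s_def d_def)
      also have "\<dots> = s k *\<^sub>R (LINT \<omega>|M. osc (e k) f \<omega> *\<^sub>R Z \<omega>)" by (rule integral_scaleR_right)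
      also have "(LINT \<omega>|M. osc (e k) f \<omega> *\<^sub>R Z \<omega>) = (LINT x|N. f x *\<^sub>R I x)"
        unfolding I_def by (rule osc_scaleR(2)[OF fi _ Zsq]) measurable
      finally show ?thesis .
    qed
    have E2: "(LINT x|N. (f x * (s k * lc x)) *\<^sub>R z) = v k *\<^sub>R z"
      using ilc by (simp add: v_def lc_def)
    \<comment> \<open>\<open>v k\<close> already contains the factor \<open>s k\<close>; dividing by
      it places the variance term under the same space integral as \<open>I x\<close>.\<close>
    have "\<psi>' k r + (r * v k) *\<^sub>R z = \<i> * s k * ((LINT x|N. f x *\<^sub>R I x) - (\<i> * r / s k) * (v k *\<^sub>R z))"
      unfolding \<psi>'_def Z_def[symmetric] E1 using s[of k] by (simp add: scaleR_conv_of_real algebra_simps)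
    also have "(LINT x|N. f x *\<^sub>R I x) - (\<i> * r / s k) * (v k *\<^sub>R z)
        = (LINT x|N. f x *\<^sub>R I x - (\<i> * r / s k) * ((f x * (s k * lc x)) *\<^sub>R z))"
      unfolding E2[symmetric]
      using Bochner_Integration.integral_diff[OF iI integrable_mult_right[OF integrable_scaleR_left[OF ilc]], of "\<i> * r / s k" z]
      by (simp only: integral_mult_right_zero)
    also have "(\<lambda>x. f x *\<^sub>R I x - (\<i> * r / s k) * ((f x * (s k * lc x)) *\<^sub>R z))
        = (\<lambda>x. f x *\<^sub>R (I x - (\<i> * (r * lc x)) * z))"
      using s[of k] by (auto simp: scaleR_conv_of_real algebra_simps)
    finally have eq: "\<psi>' k r + (r * v k) *\<^sub>R z = \<i> * s k * (LINT x|N. f x *\<^sub>R (I x - (\<i> * (r * lc x)) * z))" .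
    have "cmod (LINT x|N. f x *\<^sub>R (I x - (\<i> * (r * lc x)) * z)) \<le> (LINT x|N. F * err k)"
    proof (rule order_trans[OF integral_norm_bound integral_mono_AE'])
      show "AE x in N. norm (f x *\<^sub>R (I x - (\<i> * (r * lc x)) * z)) \<le> F * err k"
        unfolding norm_scaleR using fb F pt by (intro AE_I2 mult_mono) auto
    qed (use F err in auto)
    also have "\<dots> = F * \<mu> * err k" by (simp add: \<mu>_def)
    finally have "s k * cmod (LINT x|N. f x *\<^sub>R (I x - (\<i> * (r * lc x)) * z)) \<le> s k * (F * \<mu> * err k)"
      using s[of k] by (intro mult_left_mono) auto
    then show ?thesis
      unfolding \<psi>_def Z_def[symmetric] z_def[symmetric] eq \<delta>_def using s[of k] by (simp add: norm_mult mult_ac)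
  qed
  have \<psi>0: "\<psi> k 0 = 1" for k by (simp add: \<psi>_def prob_space)
  have close: "cmod (\<psi> k t - of_real (exp (- v k * t\<^sup>2 / 2))) \<le> exp (\<bar>v k\<bar> * T\<^sup>2) * \<delta> k * T" for k
    by (rule gaussian_ode_stability[OF der \<psi>0 ode]) (simp_all add: T_def)
  define c where "c = (LINT z|lborel. correlation M q z) * (LINT x|N. (f x)\<^sup>2)"
  have v_lim: "v \<longlonglongrightarrow> c"
    unfolding v_def[abs_def] s_def d_def c_def by (rule local_cov_integral_limit[OF f D cont e L_top])
  have \<delta>_lim: "\<delta> \<longlonglongrightarrow> (F * \<mu>) * 0" unfolding \<delta>_def[abs_def] by (intro tendsto_mult_left s_err)
  have "(\<lambda>k. exp (\<bar>v k\<bar> * T\<^sup>2) * \<delta> k * T) \<longlonglongrightarrow> exp (\<bar>c\<bar> * T\<^sup>2) * ((F * \<mu>) * 0) * T"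
    by (intro tendsto_intros v_lim \<delta>_lim)
  then have lim: "(\<lambda>k. exp (\<bar>v k\<bar> * T\<^sup>2) * \<delta> k * T) \<longlonglongrightarrow> 0" by simp
  have "(\<lambda>k. \<psi> k t - of_real (exp (- v k * t\<^sup>2 / 2))) \<longlonglongrightarrow> 0"
    by (rule Lim_null_comparison[OF always_eventually lim]) (intro allI close)
  moreover have "(\<lambda>k. of_real (exp (- v k * t\<^sup>2 / 2)) :: complex) \<longlonglongrightarrow> of_real (exp (- c * t\<^sup>2 / 2))"
    by (intro tendsto_intros v_lim) simp
  ultimately have "(\<lambda>k. (\<psi> k t - of_real (exp (- v k * t\<^sup>2 / 2))) + of_real (exp (- v k * t\<^sup>2 / 2)))
      \<longlonglongrightarrow> 0 + of_real (exp (- c * t\<^sup>2 / 2))" by (rule tendsto_add)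
  then show ?thesis by (simp add: \<psi>_def c_def)
qed

end

section \<open>Error terms\<close>

locale kernel_field = random_field_on M q D + GK: symmetric_kernel "lborel_on D" G K
  for M :: "'w measure" and q :: "'a::euclidean_space \<Rightarrow> 'w \<Rightarrow> real" and D G K +
  fixes u :: "'a \<Rightarrow> real" and B :: real
  assumes u_measurable [measurable]: "u \<in> borel_measurable (lborel_on D)"
    and u_bound: "\<And>x. x \<in> D \<Longrightarrow> \<bar>u x\<bar> \<le> B" and B_nonneg: "0 \<le> B"
begin

lemma u_bound_AE: "AE x in N. \<bar>u x\<bar> \<le> B"
  using u_bound by (intro AE_I2) simp

lemma integral_swap_bound:
  fixes A :: "'a \<Rightarrow> 'w \<Rightarrow> real"
  assumes [measurable]: "(\<lambda>p. A (fst p) (snd p)) \<in> borel_measurable (N \<Otimes>\<^sub>M M)"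
    and pos: "\<And>x \<omega>. 0 \<le> A x \<omega>"
    and int: "\<And>x. x \<in> D \<Longrightarrow> integrable M (A x)" and le: "\<And>x. x \<in> D \<Longrightarrow> (LINT \<omega>|M. A x \<omega>) \<le> c"
  shows "integrable M (\<lambda>\<omega>. LINT x|N. A x \<omega>)" and "(LINT \<omega>|M. LINT x|N. A x \<omega>) \<le> measure N D * c"
proof -
  have m: "(\<lambda>x. LINT \<omega>|M. A x \<omega>) \<in> borel_measurable N"
    by (rule borel_measurable_lebesgue_integral) (simp add: case_prod_beta')
  have iN: "integrable N (\<lambda>x. LINT \<omega>|M. A x \<omega>)"
    by (rule N.integrable_const_bound[where B=c]) (use le pos m in \<open>auto intro!: AE_I2\<close>)
  have i: "integrable (N \<Otimes>\<^sub>M M) (\<lambda>(x, \<omega>). A x \<omega>)"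
  proof (rule NM.Fubini_integrable)
    show "(\<lambda>(x, \<omega>). A x \<omega>) \<in> borel_measurable (N \<Otimes>\<^sub>M M)" by (simp add: case_prod_beta')
    show "integrable N (\<lambda>x. LINT \<omega>|M. norm (case (x, \<omega>) of (x, \<omega>) \<Rightarrow> A x \<omega>))"
      using iN pos by simp
  qed (use int in auto)
  show "integrable M (\<lambda>\<omega>. LINT x|N. A x \<omega>)" by (rule NM.integrable_snd[OF i])
  have "(LINT \<omega>|M. LINT x|N. A x \<omega>) = (LINT x|N. LINT \<omega>|M. A x \<omega>)" by (rule NM.Fubini_integral[OF i])
  also have "\<dots> \<le> (LINT x|N. c)" by (intro integral_mono iN) (use le in auto)
  finally show "(LINT \<omega>|M. LINT x|N. A x \<omega>) \<le> measure N D * c" by simp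
qed

lemma square_integrable_G_u:
  assumes "x \<in> D"
  shows "square_integrable N (\<lambda>y. G x y * u y)" and "(LINT y|N. (G x y * u y)\<^sup>2) \<le> B\<^sup>2 * K"
proof -
  have Gx: "square_integrable N (G x)" using GK.G_section[of x] assms by simp
  have ub: "AE x in N. \<bar>u x\<bar> \<le> B" using u_bound by (intro AE_I2) simp
  show "square_integrable N (\<lambda>y. G x y * u y)"
    using square_integrable_mult_bounded[OF Gx u_measurable ub] by (simp add: mult.commute)
  have "norm2 N (\<lambda>y. u y * G x y) \<le> B * norm2 N (G x)"
    by (rule norm2_mult_bounded_le[OF Gx u_measurable ub B_nonneg])
  also have "\<dots> \<le> B * sqrt K" using GK.norm2_G[of x] assms B_nonneg by (intro mult_left_mono) auto
  finally have "(norm2 N (\<lambda>y. u y * G x y))\<^sup>2 \<le> (B * sqrt K)\<^sup>2" by (intro power_mono) auto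
  then show "(LINT y|N. (G x y * u y)\<^sup>2) \<le> B\<^sup>2 * K"
    unfolding norm2_power2 using GK.K_nonneg by (simp add: power_mult_distrib mult.commute)
qed

lemma kop_Q_u: "GK.kop (\<lambda>y. Q \<epsilon> y \<omega> * u y) x = osc \<epsilon> (\<lambda>y. G x y * u y) \<omega>"
  by (simp add: GK.kop_def osc_def mult_ac)

lemma osc_G_u_measurable [measurable]:
  "(\<lambda>p. osc \<epsilon> (\<lambda>y. G (fst p) y * u y) (snd p)) \<in> borel_measurable (N \<Otimes>\<^sub>M M)"
proof -
  have 1: "(\<lambda>z. case_prod G (fst (fst z), snd z)) \<in> borel_measurable ((N \<Otimes>\<^sub>M M) \<Otimes>\<^sub>M N)"
    by measurable
  have 2: "(\<lambda>z. (\<lambda>p. Q \<epsilon> (fst p) (snd p)) (snd z, snd (fst z))) \<in> borel_measurable ((N \<Otimes>\<^sub>M M) \<Otimes>\<^sub>M N)"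
    by (rule measurable_compose[OF _ Q_measurable(1)]) measurable
  have 3: "(\<lambda>z. u (snd z)) \<in> borel_measurable ((N \<Otimes>\<^sub>M M) \<Otimes>\<^sub>M N)" by measurable
  have "(\<lambda>(p, y). G (fst p) y * u y * Q \<epsilon> y (snd p)) \<in> borel_measurable ((N \<Otimes>\<^sub>M M) \<Otimes>\<^sub>M N)"
    using borel_measurable_times[OF borel_measurable_times[OF 1 3] 2] by (simp add: case_prod_beta')
  then show ?thesis unfolding osc_def by (rule N.borel_measurable_lebesgue_integral)
qed

text \<open>The variance bound is applied to the row \<open>G x\<close> times \<open>u\<close>,
  uniformly in \<open>x\<close>. In the remainder this norm is multiplied by the norm of v - u,
  whose second moment is also of order eps^d, so the mean of the product is of order eps^d.\<close>

lemma expectation_norm2_kop_Q_u: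
  assumes \<epsilon>: "0 < \<epsilon>"
  shows "integrable M (\<lambda>\<omega>. (norm2 N (GK.kop (\<lambda>y. Q \<epsilon> y \<omega> * u y)))\<^sup>2)"
    and "(LINT \<omega>|M. (norm2 N (GK.kop (\<lambda>y. Q \<epsilon> y \<omega> * u y)))\<^sup>2)
      \<le> measure N D * (\<epsilon> ^ DIM('a) * corr_mass * (B\<^sup>2 * K))"
proof -
  have le: "(LINT \<omega>|M. (osc \<epsilon> (\<lambda>y. G x y * u y) \<omega>)\<^sup>2) \<le> \<epsilon> ^ DIM('a) * corr_mass * (B\<^sup>2 * K)" if "x \<in> D" for x
    by (rule order_trans[OF osc_variance[OF square_integrable_G_u(1)[OF that] \<epsilon>]])
      (use square_integrable_G_u(2)[OF that] \<epsilon> corr_mass_nonneg in \<open>auto intro!: mult_left_mono\<close>)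
  note sw = integral_swap_bound[of "\<lambda>x \<omega>. (osc \<epsilon> (\<lambda>y. G x y * u y) \<omega>)\<^sup>2", OF _ _ square_integrable_power2[OF square_integrable_osc[OF square_integrable_G_u(1)]] le]
  show "integrable M (\<lambda>\<omega>. (norm2 N (GK.kop (\<lambda>y. Q \<epsilon> y \<omega> * u y)))\<^sup>2)"
    unfolding norm2_power2 kop_Q_u by (rule sw(1)) auto
  show "(LINT \<omega>|M. (norm2 N (GK.kop (\<lambda>y. Q \<epsilon> y \<omega> * u y)))\<^sup>2)
      \<le> measure N D * (\<epsilon> ^ DIM('a) * corr_mass * (B\<^sup>2 * K))"
    unfolding norm2_power2 kop_Q_u by (rule sw(2)) auto
qed

text \<open>Writing g for the inner oscillatory integral, Q^2 g^2 is split as (Q^2 g) g. The first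
  factor is bounded crudely with \<open>p = 4\<close>, which consumes the sixth moment; the second
  brings the variance bound. The squared norm is thus only of order eps^(d/2), but any rate is
  enough, since the term is paired with v - u.\<close>

lemma expectation_norm2_Q_kop_Q_u:
  assumes \<epsilon>: "0 < \<epsilon>"
  defines "c \<equiv> sqrt (B\<^sup>2 * K * (measure N D * (2 * moment 6))) * sqrt (corr_mass * (B\<^sup>2 * K))"
  shows "integrable M (\<lambda>\<omega>. (norm2 N (\<lambda>x. Q \<epsilon> x \<omega> * GK.kop (\<lambda>y. Q \<epsilon> y \<omega> * u y) x))\<^sup>2)"
    and "(LINT \<omega>|M. (norm2 N (\<lambda>x. Q \<epsilon> x \<omega> * GK.kop (\<lambda>y. Q \<epsilon> y \<omega> * u y) x))\<^sup>2)
      \<le> measure N D * (c * sqrt (\<epsilon> ^ DIM('a)))"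
proof -
  let ?A = "\<lambda>x \<omega>. (Q \<epsilon> x \<omega>)\<^sup>2 * (osc \<epsilon> (\<lambda>y. G x y * u y) \<omega>)\<^sup>2"
  have e: "(Q \<epsilon> x \<omega> * GK.kop (\<lambda>y. Q \<epsilon> y \<omega> * u y) x)\<^sup>2 = ?A x \<omega>" for x \<omega>
    by (simp add: kop_Q_u power_mult_distrib)
  have int: "integrable M (?A x)" and le: "(LINT \<omega>|M. ?A x \<omega>) \<le> c * sqrt (\<epsilon> ^ DIM('a))" if x: "x \<in> D" for x
  proof -
    note gsq = square_integrable_G_u[OF x]
    let ?g = "osc \<epsilon> (\<lambda>y. G x y * u y)"
    have osq: "square_integrable M ?g" by (rule square_integrable_osc[OF gsq(1)])
    note w4 = osc_weighted[OF gsq(1) D_sets_N, of 4 \<epsilon> x]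
    have "(\<lambda>\<omega>. ((Q \<epsilon> x \<omega>)\<^sup>2 * ?g \<omega>)\<^sup>2) = (\<lambda>\<omega>. \<bar>Q \<epsilon> x \<omega>\<bar> ^ 4 * (?g \<omega>)\<^sup>2)"
      by (simp add: power_mult_distrib power_even_abs)
    then have 1: "square_integrable M (\<lambda>\<omega>. (Q \<epsilon> x \<omega>)\<^sup>2 * ?g \<omega>)"
      and 2: "norm2 M (\<lambda>\<omega>. (Q \<epsilon> x \<omega>)\<^sup>2 * ?g \<omega>) = sqrt (LINT \<omega>|M. \<bar>Q \<epsilon> x \<omega>\<bar> ^ 4 * (?g \<omega>)\<^sup>2)"
      using w4(1) osq by (auto simp: square_integrable_def norm2_def)
    have eq: "?A x = (\<lambda>\<omega>. ((Q \<epsilon> x \<omega>)\<^sup>2 * ?g \<omega>) * ?g \<omega>)" by (simp add: power2_eq_square mult_ac)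
    show "integrable M (?A x)" unfolding eq by (rule square_integrable_mult_integrable[OF 1 osq])
    have "(LINT \<omega>|M. \<bar>Q \<epsilon> x \<omega>\<bar> ^ 4 * (?g \<omega>)\<^sup>2) \<le> (LINT y|N. (G x y * u y)\<^sup>2) * (measure N D * (2 * moment 6))"
      using w4(2) by simp
    also have "\<dots> \<le> B\<^sup>2 * K * (measure N D * (2 * moment 6))"
      using moment_nonneg[of 6] by (intro mult_right_mono gsq(2)) auto
    finally have n1: "norm2 M (\<lambda>\<omega>. (Q \<epsilon> x \<omega>)\<^sup>2 * ?g \<omega>) \<le> sqrt (B\<^sup>2 * K * (measure N D * (2 * moment 6)))"
      unfolding 2 by (rule real_sqrt_le_mono)
    have "(LINT \<omega>|M. (?g \<omega>)\<^sup>2) \<le> (corr_mass * (B\<^sup>2 * K)) * \<epsilon> ^ DIM('a)"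
      using order_trans[OF osc_variance[OF gsq(1) \<epsilon>] mult_left_mono[OF gsq(2)]] \<epsilon> corr_mass_nonneg
      by (simp add: mult_ac)
    then have n2: "norm2 M ?g \<le> sqrt (corr_mass * (B\<^sup>2 * K)) * sqrt (\<epsilon> ^ DIM('a))"
      unfolding norm2_def real_sqrt_mult[symmetric] by (rule real_sqrt_le_mono)
    have "(LINT \<omega>|M. ?A x \<omega>) \<le> (LINT \<omega>|M. \<bar>((Q \<epsilon> x \<omega>)\<^sup>2 * ?g \<omega>) * ?g \<omega>\<bar>)"
      unfolding eq using square_integrable_mult_integrable[OF 1 osq] by (intro integral_mono) auto
    also have "\<dots> \<le> norm2 M (\<lambda>\<omega>. (Q \<epsilon> x \<omega>)\<^sup>2 * ?g \<omega>) * norm2 M ?g"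
      by (rule integral_abs_mult_le_norm2[OF 1 osq])
    also have "\<dots> \<le> sqrt (B\<^sup>2 * K * (measure N D * (2 * moment 6))) * (sqrt (corr_mass * (B\<^sup>2 * K)) * sqrt (\<epsilon> ^ DIM('a)))"
      using GK.K_nonneg moment_nonneg[of 6] by (intro mult_mono n1 n2 real_sqrt_ge_zero norm2_nonneg) auto
    finally show "(LINT \<omega>|M. ?A x \<omega>) \<le> c * sqrt (\<epsilon> ^ DIM('a))" by (simp add: c_def mult.assoc)
  qed
  note sw = integral_swap_bound[of ?A, OF _ _ int le]
  show "integrable M (\<lambda>\<omega>. (norm2 N (\<lambda>x. Q \<epsilon> x \<omega> * GK.kop (\<lambda>y. Q \<epsilon> y \<omega> * u y) x))\<^sup>2)"
    unfolding norm2_power2 e by (rule sw(1)) auto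
  show "(LINT \<omega>|M. (norm2 N (\<lambda>x. Q \<epsilon> x \<omega> * GK.kop (\<lambda>y. Q \<epsilon> y \<omega> * u y) x))\<^sup>2)
      \<le> measure N D * (c * sqrt (\<epsilon> ^ DIM('a)))"
    unfolding norm2_power2 e by (rule sw(2)) auto
qed

subsection \<open>The quadratic form\<close>

text \<open>The quadratic form with an arbitrary kernel in place of \<open>G\<close>, so that it can
  be studied through approximation of the kernel.\<close>

definition bil :: "real \<Rightarrow> ('a \<times> 'a \<Rightarrow> real) \<Rightarrow> 'w \<Rightarrow> real" where
  "bil \<epsilon> k \<omega> = (LINT p|(N \<Otimes>\<^sub>M N). k p * ((Q \<epsilon> (fst p) \<omega> * u (fst p)) * (Q \<epsilon> (snd p) \<omega> * u (snd p))))"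

sublocale P: finite_measure "N \<Otimes>\<^sub>M N"
  by (rule finite_measure_pair_measure) unfold_locales

lemma bil_measurable [measurable]:
  assumes [measurable]: "k \<in> borel_measurable (N \<Otimes>\<^sub>M N)"
  shows "bil \<epsilon> k \<in> borel_measurable M"
proof -
  have 1: "(\<lambda>z. (\<lambda>p. Q \<epsilon> (fst p) (snd p)) (fst (snd z), fst z)) \<in> borel_measurable (M \<Otimes>\<^sub>M (N \<Otimes>\<^sub>M N))"
    by (rule measurable_compose[OF _ Q_measurable(1)]) measurable
  have 2: "(\<lambda>z. (\<lambda>p. Q \<epsilon> (fst p) (snd p)) (snd (snd z), fst z)) \<in> borel_measurable (M \<Otimes>\<^sub>M (N \<Otimes>\<^sub>M N))"
    by (rule measurable_compose[OF _ Q_measurable(1)]) measurable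
  have 3: "(\<lambda>z. u (fst (snd z))) \<in> borel_measurable (M \<Otimes>\<^sub>M (N \<Otimes>\<^sub>M N))"
    "(\<lambda>z. u (snd (snd z))) \<in> borel_measurable (M \<Otimes>\<^sub>M (N \<Otimes>\<^sub>M N))"
    "(\<lambda>z. k (snd z)) \<in> borel_measurable (M \<Otimes>\<^sub>M (N \<Otimes>\<^sub>M N))" by measurable
  have "(\<lambda>(\<omega>, p). k p * ((Q \<epsilon> (fst p) \<omega> * u (fst p)) * (Q \<epsilon> (snd p) \<omega> * u (snd p)))) \<in> borel_measurable (M \<Otimes>\<^sub>M (N \<Otimes>\<^sub>M N))"
    using borel_measurable_times[OF 3(3) borel_measurable_times[OF borel_measurable_times[OF 1 3(1)] borel_measurable_times[OF 2 3(2)]]]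
    by (simp add: case_prod_beta')
  then show ?thesis unfolding bil_def[abs_def] by (rule NN.P.borel_measurable_lebesgue_integral)
qed

lemma AE_square_integrable_Q_u: "AE \<omega> in M. square_integrable N (\<lambda>x. Q \<epsilon> x \<omega> * u x)"
  using AE_square_integrable_Q[of \<epsilon>]
proof eventually_elim
  case (elim \<omega>)
  then show ?case
    using square_integrable_mult_bounded[OF elim u_measurable u_bound_AE] by (simp add: mult.commute)
qed

lemma square_integrable_tensor:
  assumes h: "square_integrable N h"
  shows "square_integrable (N \<Otimes>\<^sub>M N) (\<lambda>p. h (fst p) * h (snd p))"
proof -
  have [measurable]: "h \<in> borel_measurable N" using h by simp
  have "integrable (N \<Otimes>\<^sub>M N) (\<lambda>p. (h (fst p) * h (snd p))\<^sup>2)"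
  proof (rule NN.Fubini_integrable)
    show "integrable N (\<lambda>x. LINT y|N. norm ((h (fst (x, y)) * h (snd (x, y)))\<^sup>2))"
      using square_integrable_power2[OF h] by (simp add: power_mult_distrib)
    show "AE x in N. integrable N (\<lambda>y. (h (fst (x, y)) * h (snd (x, y)))\<^sup>2)"
      using square_integrable_power2[OF h] by (simp add: power_mult_distrib)
  qed measurable
  then show ?thesis by (simp add: square_integrable_def)
qed

lemma AE_integrable_bil:
  assumes k: "square_integrable (N \<Otimes>\<^sub>M N) k"
  shows "AE \<omega> in M. integrable (N \<Otimes>\<^sub>M N)
    (\<lambda>p. k p * ((Q \<epsilon> (fst p) \<omega> * u (fst p)) * (Q \<epsilon> (snd p) \<omega> * u (snd p))))"
  using AE_square_integrable_Q_u[of \<epsilon>]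
  by eventually_elim (rule square_integrable_mult_integrable[OF k square_integrable_tensor])

lemma bil_add_AE:
  assumes "square_integrable (N \<Otimes>\<^sub>M N) k" "square_integrable (N \<Otimes>\<^sub>M N) k'"
  shows "AE \<omega> in M. bil \<epsilon> (\<lambda>p. k p + k' p) \<omega> = bil \<epsilon> k \<omega> + bil \<epsilon> k' \<omega>"
  using AE_integrable_bil[OF assms(1), of \<epsilon>] AE_integrable_bil[OF assms(2), of \<epsilon>]
  by eventually_elim (simp add: bil_def distrib_right)

lemma bil_cmult: "bil \<epsilon> (\<lambda>p. c * k p) \<omega> = c * bil \<epsilon> k \<omega>"
  by (simp add: bil_def mult.assoc)

lemma bil_cong: "(\<And>p. p \<in> space (N \<Otimes>\<^sub>M N) \<Longrightarrow> k p = k' p) \<Longrightarrow> bil \<epsilon> k = bil \<epsilon> k'"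
  unfolding bil_def by (intro ext Bochner_Integration.integral_cong) auto

lemma bil_iterated_AE:
  assumes k: "square_integrable (N \<Otimes>\<^sub>M N) k"
  shows "AE \<omega> in M. bil \<epsilon> k \<omega> = (LINT x|N. (Q \<epsilon> x \<omega> * u x) * osc \<epsilon> (\<lambda>y. k (x, y) * u y) \<omega>)"
  using AE_integrable_bil[OF k, of \<epsilon>]
proof eventually_elim
  case (elim \<omega>)
  have "bil \<epsilon> k \<omega> = (LINT x|N. LINT y|N. k (x, y) * ((Q \<epsilon> x \<omega> * u x) * (Q \<epsilon> y \<omega> * u y)))"
    unfolding bil_def using NN.integral_fst'[OF elim] by simp
  also have "\<dots> = (LINT x|N. LINT y|N. (Q \<epsilon> x \<omega> * u x) * (k (x, y) * u y * Q \<epsilon> y \<omega>))"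
    by (simp add: mult_ac)
  finally show ?case by (simp add: osc_def)
qed

lemma square_integrable_section_AE:
  assumes k: "square_integrable (N \<Otimes>\<^sub>M N) k"
  shows "AE x in N. square_integrable N (\<lambda>y. k (x, y))"
  using NN.AE_integrable_fst'[OF square_integrable_power2[OF k]] AE_space
proof eventually_elim
  case (elim x)
  have "k \<in> borel_measurable (N \<Otimes>\<^sub>M N)" using k by simp
  from measurable_compose[OF measurable_Pair1'[OF elim(2)] this] show ?case
    using elim by (simp add: square_integrable_def)
qed

text \<open>Only the inner factor \<open>q\<close> contributes cancellation, the outer one being
  bounded by its second moment; so no more than eps^(d/2) is gained. The value of the estimate is
  its linearity in the norm of \<open>k\<close>, uniformly in \<epsilon>, which lets smallness pass
  to limits of kernels.\<close>

lemma bil_bound: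
  assumes k: "square_integrable (N \<Otimes>\<^sub>M N) k" and \<epsilon>: "0 < \<epsilon>"
  defines "c \<equiv> B\<^sup>2 * sqrt (moment 2) * sqrt corr_mass * sqrt (measure N D)"
  shows "integrable M (bil \<epsilon> k)"
    and "\<epsilon> powr (- real DIM('a) / 2) * (LINT \<omega>|M. \<bar>bil \<epsilon> k \<omega>\<bar>) \<le> c * norm2 (N \<Otimes>\<^sub>M N) k"
proof -
  have km [measurable]: "k \<in> borel_measurable (N \<Otimes>\<^sub>M N)" using k by simp
  let ?s = "\<epsilon> powr (- real DIM('a) / 2)"
  have s: "0 < ?s" using \<epsilon> by simp
  have se: "sqrt (\<epsilon> ^ DIM('a)) = 1 / ?s"
    unfolding powr_realpow[OF \<epsilon>, symmetric] powr_half_sqrt[symmetric, OF powr_ge_zero] powr_powr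
    by (simp add: powr_minus_divide)
  define r where "r x = (LINT y|N. (k (x, y))\<^sup>2)" for x
  have r_int: "integrable N r" unfolding r_def using NN.integrable_fst'[OF square_integrable_power2[OF k]] by simp
  have r_pos: "0 \<le> r x" for x by (simp add: r_def)
  have r_tot: "(LINT x|N. r x) = (norm2 (N \<Otimes>\<^sub>M N) k)\<^sup>2"
    unfolding norm2_power2 r_def using NN.integral_fst'[OF square_integrable_power2[OF k]] by simp
  have sr: "square_integrable N (\<lambda>x. sqrt (r x))" using r_int r_pos by (auto simp: square_integrable_def)
  have sr_le: "(LINT x|N. sqrt (r x)) \<le> sqrt (measure N D) * norm2 (N \<Otimes>\<^sub>M N) k"
  proof -
    have "(LINT x|N. \<bar>1 * sqrt (r x)\<bar>) \<le> norm2 N (\<lambda>_. 1) * norm2 N (\<lambda>x. sqrt (r x))"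
      by (rule integral_abs_mult_le_norm2[OF _ sr]) (simp add: square_integrable_def)
    also have "norm2 N (\<lambda>x. sqrt (r x)) = norm2 (N \<Otimes>\<^sub>M N) k"
      using r_pos r_tot by (simp add: norm2_def)
    finally show ?thesis using r_pos by (simp add: norm2_def)
  qed
  define a where "a x \<omega> = \<bar>(Q \<epsilon> x \<omega> * u x) * osc \<epsilon> (\<lambda>y. k (x, y) * u y) \<omega>\<bar>" for x \<omega>
  have am: "(\<lambda>p. ennreal (a (fst p) (snd p))) \<in> borel_measurable (N \<Otimes>\<^sub>M M)"
  proof -
    have 1: "(\<lambda>z. k (fst (fst z), snd z)) \<in> borel_measurable ((N \<Otimes>\<^sub>M M) \<Otimes>\<^sub>M N)" by measurable
    have 2: "(\<lambda>z. (\<lambda>p. Q \<epsilon> (fst p) (snd p)) (snd z, snd (fst z))) \<in> borel_measurable ((N \<Otimes>\<^sub>M M) \<Otimes>\<^sub>M N)"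
      by (rule measurable_compose[OF _ Q_measurable(1)]) measurable
    have 3: "(\<lambda>z. u (snd z)) \<in> borel_measurable ((N \<Otimes>\<^sub>M M) \<Otimes>\<^sub>M N)" by measurable
    have "(\<lambda>(p, y). k (fst p, y) * u y * Q \<epsilon> y (snd p)) \<in> borel_measurable ((N \<Otimes>\<^sub>M M) \<Otimes>\<^sub>M N)"
      using borel_measurable_times[OF borel_measurable_times[OF 1 3] 2] by (simp add: case_prod_beta')
    then have "(\<lambda>p. osc \<epsilon> (\<lambda>y. k (fst p, y) * u y) (snd p)) \<in> borel_measurable (N \<Otimes>\<^sub>M M)"
      unfolding osc_def by (rule N.borel_measurable_lebesgue_integral)
    then show ?thesis unfolding a_def by measurable
  qed
  have pt: "(\<integral>\<^sup>+\<omega>. ennreal (a x \<omega>) \<partial>M) \<le> ennreal (B\<^sup>2 * sqrt (moment 2) * sqrt corr_mass / ?s * sqrt (r x))"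
    if x: "x \<in> D" and kx: "square_integrable N (\<lambda>y. k (x, y))" for x
  proof -
    have ub: "AE x in N. \<bar>u x\<bar> \<le> B" using u_bound by (intro AE_I2) simp
    have g: "square_integrable N (\<lambda>y. k (x, y) * u y)"
      using square_integrable_mult_bounded[OF kx u_measurable ub] by (simp add: mult.commute)
    have gn: "norm2 N (\<lambda>y. k (x, y) * u y) \<le> B * sqrt (r x)"
      using norm2_mult_bounded_le[OF kx u_measurable ub B_nonneg] by (simp add: mult.commute norm2_def r_def)
    note osq = square_integrable_osc[OF g, of \<epsilon>]
    have "norm2 M (osc \<epsilon> (\<lambda>y. k (x, y) * u y)) \<le> sqrt (\<epsilon> ^ DIM('a) * corr_mass * (LINT y|N. (k (x, y) * u y)\<^sup>2))"
      unfolding norm2_def by (intro real_sqrt_le_mono osc_variance g \<epsilon>)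
    also have "\<dots> = 1 / ?s * sqrt corr_mass * norm2 N (\<lambda>y. k (x, y) * u y)"
      unfolding real_sqrt_mult se norm2_def ..
    also have "\<dots> \<le> 1 / ?s * sqrt corr_mass * (B * sqrt (r x))"
      using s corr_mass_nonneg by (intro mult_left_mono gn) auto
    finally have on: "norm2 M (osc \<epsilon> (\<lambda>y. k (x, y) * u y)) \<le> 1 / ?s * sqrt corr_mass * (B * sqrt (r x))" .
    have i: "integrable M (\<lambda>\<omega>. \<bar>Q \<epsilon> x \<omega> * osc \<epsilon> (\<lambda>y. k (x, y) * u y) \<omega>\<bar>)"
      using square_integrable_mult_integrable[OF square_integrable_Q osq] by auto
    have ae: "a x \<omega> = \<bar>u x\<bar> * \<bar>Q \<epsilon> x \<omega> * osc \<epsilon> (\<lambda>y. k (x, y) * u y) \<omega>\<bar>" for \<omega>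
      by (simp add: a_def abs_mult)
    have "(\<integral>\<^sup>+\<omega>. ennreal (a x \<omega>) \<partial>M) = ennreal (\<bar>u x\<bar> * (LINT \<omega>|M. \<bar>Q \<epsilon> x \<omega> * osc \<epsilon> (\<lambda>y. k (x, y) * u y) \<omega>\<bar>))"
      unfolding ae using i by (subst nn_integral_eq_integral) auto
    also have "\<dots> \<le> ennreal (B * (sqrt (moment 2) * (1 / ?s * sqrt corr_mass * (B * sqrt (r x)))))"
    proof (intro ennreal_leI mult_mono)
      have "(LINT \<omega>|M. \<bar>Q \<epsilon> x \<omega> * osc \<epsilon> (\<lambda>y. k (x, y) * u y) \<omega>\<bar>)
          \<le> sqrt (moment 2) * norm2 M (osc \<epsilon> (\<lambda>y. k (x, y) * u y))"
        using integral_abs_mult_le_norm2[OF square_integrable_Q osq, of \<epsilon> x] norm2_Q[of \<epsilon> x] by simp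
      also have "\<dots> \<le> sqrt (moment 2) * (1 / ?s * sqrt corr_mass * (B * sqrt (r x)))"
        using moment_nonneg[of 2] by (intro mult_left_mono on) auto
      finally show "(LINT \<omega>|M. \<bar>Q \<epsilon> x \<omega> * osc \<epsilon> (\<lambda>y. k (x, y) * u y) \<omega>\<bar>)
          \<le> sqrt (moment 2) * (1 / ?s * sqrt corr_mass * (B * sqrt (r x)))" .
    qed (use u_bound[OF x] B_nonneg in auto)
    also have "\<dots> = ennreal (B\<^sup>2 * sqrt (moment 2) * sqrt corr_mass / ?s * sqrt (r x))"
      by (rule arg_cong[of _ _ ennreal]) (simp add: power2_eq_square)
    finally show ?thesis .
  qed
  \<comment> \<open>Nonnegative integrals, since integrability of \<open>bil \<epsilon> k\<close> is
    itself a consequence of this bound.\<close>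
  have ai: "(\<integral>\<^sup>+\<omega>. ennreal \<bar>bil \<epsilon> k \<omega>\<bar> \<partial>M) \<le> ennreal (1 / ?s * (c * norm2 (N \<Otimes>\<^sub>M N) k))"
  proof -
    have "AE \<omega> in M. ennreal \<bar>bil \<epsilon> k \<omega>\<bar> \<le> (\<integral>\<^sup>+x. ennreal (a x \<omega>) \<partial>N)"
      using bil_iterated_AE[OF k, of \<epsilon>]
    proof eventually_elim
      case (elim \<omega>)
      show ?case
        unfolding elim a_def
        using integral_norm_bound_ennreal[of N "\<lambda>x. (Q \<epsilon> x \<omega> * u x) * osc \<epsilon> (\<lambda>y. k (x, y) * u y) \<omega>"]
        by (cases "integrable N (\<lambda>x. (Q \<epsilon> x \<omega> * u x) * osc \<epsilon> (\<lambda>y. k (x, y) * u y) \<omega>)")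
          (auto simp: not_integrable_integral_eq)
    qed
    then have "(\<integral>\<^sup>+\<omega>. ennreal \<bar>bil \<epsilon> k \<omega>\<bar> \<partial>M) \<le> (\<integral>\<^sup>+\<omega>. (\<integral>\<^sup>+x. ennreal (a x \<omega>) \<partial>N) \<partial>M)"
      by (rule nn_integral_mono_AE)
    also have "\<dots> = (\<integral>\<^sup>+x. (\<integral>\<^sup>+\<omega>. ennreal (a x \<omega>) \<partial>M) \<partial>N)"
      using am by (intro NM.Fubini') (simp add: case_prod_beta')
    also have "\<dots> \<le> (\<integral>\<^sup>+x. ennreal (B\<^sup>2 * sqrt (moment 2) * sqrt corr_mass / ?s * sqrt (r x)) \<partial>N)"
    proof (rule nn_integral_mono_AE)
      show "AE x in N. (\<integral>\<^sup>+\<omega>. ennreal (a x \<omega>) \<partial>M)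
          \<le> ennreal (B\<^sup>2 * sqrt (moment 2) * sqrt corr_mass / ?s * sqrt (r x))"
        using square_integrable_section_AE[OF k] AE_space by eventually_elim (rule pt, simp_all)
    qed
    also have "\<dots> = ennreal (B\<^sup>2 * sqrt (moment 2) * sqrt corr_mass / ?s * (LINT x|N. sqrt (r x)))"
      using N.square_integrable_integrable[OF sr] r_pos s B_nonneg moment_nonneg[of 2] corr_mass_nonneg
      by (subst nn_integral_eq_integral) (auto intro!: AE_I2)
    also have "\<dots> \<le> ennreal (B\<^sup>2 * sqrt (moment 2) * sqrt corr_mass / ?s * (sqrt (measure N D) * norm2 (N \<Otimes>\<^sub>M N) k))"
      using s B_nonneg moment_nonneg[of 2] corr_mass_nonneg by (intro ennreal_leI mult_left_mono sr_le) auto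
    also have "\<dots> = ennreal (1 / ?s * (c * norm2 (N \<Otimes>\<^sub>M N) k))"
      by (rule arg_cong[of _ _ ennreal]) (simp add: c_def mult_ac)
    finally show ?thesis .
  qed
  show int: "integrable M (bil \<epsilon> k)"
    by (rule integrableI_bounded) (use ai in \<open>auto intro: le_less_trans\<close>)
  have c0: "0 \<le> c" using B_nonneg moment_nonneg[of 2] corr_mass_nonneg by (simp add: c_def)
  have "(LINT \<omega>|M. \<bar>bil \<epsilon> k \<omega>\<bar>) \<le> 1 / ?s * (c * norm2 (N \<Otimes>\<^sub>M N) k)"
    using ai nn_integral_eq_integral[OF integrable_abs[OF int]] c0 s
    by (simp add: ennreal_le_iff)
  then show "?s * (LINT \<omega>|M. \<bar>bil \<epsilon> k \<omega>\<bar>) \<le> c * norm2 (N \<Otimes>\<^sub>M N) k"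
    using s by (simp add: field_simps)
qed

text \<open>On a rectangle the form factors into two oscillatory integrals. Both factors
  \<open>q\<close> now produce cancellation, and another power eps^(d/2) is gained.\<close>

lemma bil_rectangle:
  assumes A: "A \<in> sets N" "A' \<in> sets N" and \<epsilon>: "0 < \<epsilon>"
  shows "\<epsilon> powr (- real DIM('a) / 2) * (LINT \<omega>|M. \<bar>bil \<epsilon> (indicator (A \<times> A')) \<omega>\<bar>)
    \<le> \<epsilon> powr (real DIM('a) / 2) * (corr_mass * (norm2 N u)\<^sup>2)"
proof -
  have usq: "square_integrable N u"
    by (rule N.square_integrable_bounded[where B=B]) (use u_bound in auto)
  have Asq: "square_integrable N (\<lambda>x. indicator A x * u x)" if [measurable]: "A \<in> sets N" for A
    by (rule square_integrable_mult_bounded[OF usq, of _ 1]) (auto simp: indicator_def)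
  have An: "norm2 N (\<lambda>x. indicator A x * u x) \<le> norm2 N u" if [measurable]: "A \<in> sets N" for A
    by (rule norm2_mono[OF usq]) (auto simp: indicator_def)
  have k: "square_integrable (N \<Otimes>\<^sub>M N) (indicator (A \<times> A'))"
    by (rule P.square_integrable_bounded[where B=1]) (use A in \<open>auto simp: indicator_def\<close>)
  have e: "AE \<omega> in M. \<bar>bil \<epsilon> (indicator (A \<times> A')) \<omega>\<bar>
      = \<bar>osc \<epsilon> (\<lambda>x. indicator A x * u x) \<omega> * osc \<epsilon> (\<lambda>x. indicator A' x * u x) \<omega>\<bar>"
    using bil_iterated_AE[OF k, of \<epsilon>]
  proof eventually_elim
    case (elim \<omega>)
    have "osc \<epsilon> (\<lambda>y. indicator (A \<times> A') (x, y) * u y) \<omega> = indicator A x * osc \<epsilon> (\<lambda>y. indicator A' y * u y) \<omega>" for x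
      by (simp add: osc_def indicator_times mult.assoc)
    then have "bil \<epsilon> (indicator (A \<times> A')) \<omega>
        = (LINT x|N. (indicator A x * u x * Q \<epsilon> x \<omega>) * osc \<epsilon> (\<lambda>y. indicator A' y * u y) \<omega>)"
      unfolding elim by (simp add: mult_ac)
    then show ?case by (simp add: osc_def)
  qed
  have m: "(\<lambda>\<omega>. osc \<epsilon> (\<lambda>x. indicator A x * u x) \<omega>) \<in> borel_measurable M" if "A \<in> sets N" for A
    using square_integrable_osc[OF Asq[OF that]] by simp
  have "(LINT \<omega>|M. \<bar>bil \<epsilon> (indicator (A \<times> A')) \<omega>\<bar>)
      = (LINT \<omega>|M. \<bar>osc \<epsilon> (\<lambda>x. indicator A x * u x) \<omega> * osc \<epsilon> (\<lambda>x. indicator A' x * u x) \<omega>\<bar>)"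
    by (rule integral_cong_AE[OF _ _ e]) (use m A k in auto)
  also have "\<dots> \<le> norm2 M (osc \<epsilon> (\<lambda>x. indicator A x * u x)) * norm2 M (osc \<epsilon> (\<lambda>x. indicator A' x * u x))"
    by (intro integral_abs_mult_le_norm2 square_integrable_osc Asq A)
  finally have "\<epsilon> powr (- real DIM('a)) * (LINT \<omega>|M. \<bar>bil \<epsilon> (indicator (A \<times> A')) \<omega>\<bar>)
      \<le> \<epsilon> powr (- real DIM('a)) * (norm2 M (osc \<epsilon> (\<lambda>x. indicator A x * u x)) * norm2 M (osc \<epsilon> (\<lambda>x. indicator A' x * u x)))"
    by (rule mult_left_mono) simp
  also have "\<dots> = norm2 M (fluct \<epsilon> (\<lambda>x. indicator A x * u x)) * norm2 M (fluct \<epsilon> (\<lambda>x. indicator A' x * u x))"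
  proof -
    have "\<epsilon> powr (- real DIM('a)) = \<epsilon> powr (- real DIM('a) / 2) * \<epsilon> powr (- real DIM('a) / 2)"
      by (simp flip: powr_add)
    then show ?thesis unfolding fluct_def[abs_def] norm2_cmult by simp
  qed
  also have "\<dots> \<le> (sqrt corr_mass * norm2 N u) * (sqrt corr_mass * norm2 N u)"
    using A An corr_mass_nonneg
    by (intro mult_mono order_trans[OF norm2_fluct[OF Asq \<epsilon>] mult_left_mono]) auto
  also have "\<dots> = corr_mass * (norm2 N u)\<^sup>2" using corr_mass_nonneg by (simp add: power2_eq_square)
  finally have 1: "\<epsilon> powr (- real DIM('a)) * (LINT \<omega>|M. \<bar>bil \<epsilon> (indicator (A \<times> A')) \<omega>\<bar>) \<le> corr_mass * (norm2 N u)\<^sup>2" .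
  have "\<epsilon> powr (- real DIM('a) / 2) = \<epsilon> powr (real DIM('a) / 2) * \<epsilon> powr (- real DIM('a))"
    by (simp flip: powr_add)
  then have "\<epsilon> powr (- real DIM('a) / 2) * (LINT \<omega>|M. \<bar>bil \<epsilon> (indicator (A \<times> A')) \<omega>\<bar>)
      = \<epsilon> powr (real DIM('a) / 2) * (\<epsilon> powr (- real DIM('a)) * (LINT \<omega>|M. \<bar>bil \<epsilon> (indicator (A \<times> A')) \<omega>\<bar>))"
    by (simp only: mult.assoc)
  also have "\<dots> \<le> \<epsilon> powr (real DIM('a) / 2) * (corr_mass * (norm2 N u)\<^sup>2)"
    by (intro mult_left_mono 1) simp
  finally show ?thesis .
qed

end

section \<open>From product kernels to every square integrable kernel\<close>

context kernel_field begin

definition bil_small :: "(nat \<Rightarrow> real) \<Rightarrow> ('a \<times> 'a \<Rightarrow> real) \<Rightarrow> bool" where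
  "bil_small e k \<longleftrightarrow> square_integrable (N \<Otimes>\<^sub>M N) k \<and>
    (\<lambda>n. e n powr (- real DIM('a) / 2) * (LINT \<omega>|M. \<bar>bil (e n) k \<omega>\<bar>)) \<longlonglongrightarrow> 0"

context
  fixes e :: "nat \<Rightarrow> real"
  assumes e_pos: "\<And>n. 0 < e n" and e_lim: "e \<longlonglongrightarrow> 0"
begin

lemma bil_abs_add_le:
  assumes k: "square_integrable (N \<Otimes>\<^sub>M N) k" and k': "square_integrable (N \<Otimes>\<^sub>M N) k'" and \<epsilon>: "0 < \<epsilon>"
  shows "(LINT \<omega>|M. \<bar>bil \<epsilon> (\<lambda>p. k p + k' p) \<omega>\<bar>) \<le> (LINT \<omega>|M. \<bar>bil \<epsilon> k \<omega>\<bar>) + (LINT \<omega>|M. \<bar>bil \<epsilon> k' \<omega>\<bar>)"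
proof -
  note i = bil_bound(1)[OF k \<epsilon>] bil_bound(1)[OF k' \<epsilon>] bil_bound(1)[OF square_integrable_add[OF k k'] \<epsilon>]
  have "(LINT \<omega>|M. \<bar>bil \<epsilon> (\<lambda>p. k p + k' p) \<omega>\<bar>) \<le> (LINT \<omega>|M. \<bar>bil \<epsilon> k \<omega>\<bar> + \<bar>bil \<epsilon> k' \<omega>\<bar>)"
  proof (rule integral_mono_AE)
    show "AE \<omega> in M. \<bar>bil \<epsilon> (\<lambda>p. k p + k' p) \<omega>\<bar> \<le> \<bar>bil \<epsilon> k \<omega>\<bar> + \<bar>bil \<epsilon> k' \<omega>\<bar>"
      using bil_add_AE[OF k k', of \<epsilon>] by eventually_elim simp
  qed (use i in auto)
  then show ?thesis using i by simp
qed

lemma bil_small_add: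
  assumes k: "bil_small e k" and k': "bil_small e k'"
  shows "bil_small e (\<lambda>p. k p + k' p)"
proof -
  have sq: "square_integrable (N \<Otimes>\<^sub>M N) k" "square_integrable (N \<Otimes>\<^sub>M N) k'"
    and l: "(\<lambda>n. e n powr (- real DIM('a) / 2) * (LINT \<omega>|M. \<bar>bil (e n) k \<omega>\<bar>)) \<longlonglongrightarrow> 0"
    "(\<lambda>n. e n powr (- real DIM('a) / 2) * (LINT \<omega>|M. \<bar>bil (e n) k' \<omega>\<bar>)) \<longlonglongrightarrow> 0"
    using k k' by (auto simp: bil_small_def)
  have "(\<lambda>n. e n powr (- real DIM('a) / 2) * (LINT \<omega>|M. \<bar>bil (e n) (\<lambda>p. k p + k' p) \<omega>\<bar>)) \<longlonglongrightarrow> 0"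
  proof (rule Lim_null_comparison[OF always_eventually])
    show "\<forall>n. norm (e n powr (- real DIM('a) / 2) * (LINT \<omega>|M. \<bar>bil (e n) (\<lambda>p. k p + k' p) \<omega>\<bar>))
      \<le> e n powr (- real DIM('a) / 2) * (LINT \<omega>|M. \<bar>bil (e n) k \<omega>\<bar>) + e n powr (- real DIM('a) / 2) * (LINT \<omega>|M. \<bar>bil (e n) k' \<omega>\<bar>)"
      unfolding distrib_left[symmetric] using bil_abs_add_le[OF sq e_pos]
      by (auto simp: abs_mult intro!: mult_left_mono)
    show "(\<lambda>n. e n powr (- real DIM('a) / 2) * (LINT \<omega>|M. \<bar>bil (e n) k \<omega>\<bar>)
        + e n powr (- real DIM('a) / 2) * (LINT \<omega>|M. \<bar>bil (e n) k' \<omega>\<bar>)) \<longlonglongrightarrow> 0"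
      using tendsto_add[OF l] by simp
  qed
  then show ?thesis using square_integrable_add[OF sq] by (simp add: bil_small_def)
qed

lemma bil_small_cmult:
  assumes "bil_small e k"
  shows "bil_small e (\<lambda>p. c * k p)"
proof -
  have "(\<lambda>n. \<bar>c\<bar> * (e n powr (- real DIM('a) / 2) * (LINT \<omega>|M. \<bar>bil (e n) k \<omega>\<bar>))) \<longlonglongrightarrow> \<bar>c\<bar> * 0"
    using assms by (intro tendsto_mult_left) (simp add: bil_small_def)
  then show ?thesis using assms
    by (simp add: bil_small_def square_integrable_cmult bil_cmult abs_mult mult.left_commute)
qed

lemma bil_small_zero: "bil_small e (\<lambda>_. 0)"
  by (simp add: bil_small_def square_integrable_def bil_def)

lemma bil_small_sum:
  assumes "\<And>i. i \<in> I \<Longrightarrow> bil_small e (k i)"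
  shows "bil_small e (\<lambda>p. \<Sum>i\<in>I. k i p)"
  using assms by (induction I rule: infinite_finite_induct) (auto intro: bil_small_zero bil_small_add)

text \<open>The order of choices matters: first the kernel is approximated, with an error that
  \<open>bil_bound\<close> makes uniform in \<open>n\<close>, and only then does \<open>n\<close>
  grow.\<close>

lemma bil_small_closure:
  assumes kj: "\<And>j. bil_small e (k' j)" and k: "square_integrable (N \<Otimes>\<^sub>M N) k"
    and lim: "(\<lambda>j. norm2 (N \<Otimes>\<^sub>M N) (\<lambda>p. k p - k' j p)) \<longlonglongrightarrow> 0"
  shows "bil_small e k"
proof -
  define c where "c = B\<^sup>2 * sqrt (moment 2) * sqrt corr_mass * sqrt (measure N D)"
  define S where "S k n = e n powr (- real DIM('a) / 2) * (LINT \<omega>|M. \<bar>bil (e n) k \<omega>\<bar>)" for k n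
  have S0: "0 \<le> S k n" for k n by (simp add: S_def)
  have sq: "square_integrable (N \<Otimes>\<^sub>M N) (k' j)" and Sj: "S (k' j) \<longlonglongrightarrow> 0" for j
    using kj[of j] by (auto simp: bil_small_def S_def[abs_def])
  have le: "S k n \<le> S (k' j) n + c * norm2 (N \<Otimes>\<^sub>M N) (\<lambda>p. k p - k' j p)" for n j
  proof -
    note d = square_integrable_diff[OF k sq[of j]]
    have "S k n \<le> e n powr (- real DIM('a) / 2) *
        ((LINT \<omega>|M. \<bar>bil (e n) (k' j) \<omega>\<bar>) + (LINT \<omega>|M. \<bar>bil (e n) (\<lambda>p. k p - k' j p) \<omega>\<bar>))"
      unfolding S_def using bil_abs_add_le[OF sq[of j] d e_pos[of n]] by (intro mult_left_mono) auto
    also have "\<dots> \<le> S (k' j) n + c * norm2 (N \<Otimes>\<^sub>M N) (\<lambda>p. k p - k' j p)"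
      using bil_bound(2)[OF d e_pos[of n]] by (simp add: S_def distrib_left c_def)
    finally show ?thesis .
  qed
  have "S k \<longlonglongrightarrow> 0"
  proof (rule tendstoI)
    fix \<delta> :: real assume \<delta>: "0 < \<delta>"
    have "(\<lambda>j. c * norm2 (N \<Otimes>\<^sub>M N) (\<lambda>p. k p - k' j p)) \<longlonglongrightarrow> c * 0" by (intro tendsto_mult_left lim)
    then have "eventually (\<lambda>j. c * norm2 (N \<Otimes>\<^sub>M N) (\<lambda>p. k p - k' j p) < \<delta> / 2) sequentially"
      by (rule order_tendstoD) (use \<delta> in simp)
    then obtain j where j: "c * norm2 (N \<Otimes>\<^sub>M N) (\<lambda>p. k p - k' j p) < \<delta> / 2"
      by (auto simp: eventually_sequentially)
    have "eventually (\<lambda>n. S (k' j) n < \<delta> / 2) sequentially"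
      using Sj[of j] by (rule order_tendstoD) (use \<delta> in simp)
    then show "eventually (\<lambda>n. dist (S k n) 0 < \<delta>) sequentially"
    proof eventually_elim
      case (elim n)
      then show ?case using le[of n j] j S0[of k n] by simp
    qed
  qed
  then show ?thesis using k by (simp add: bil_small_def S_def[abs_def])
qed

lemma bil_small_dominated_limit:
  assumes kj: "\<And>j. bil_small e (k' j)" and w: "square_integrable (N \<Otimes>\<^sub>M N) w"
    and km [measurable]: "k \<in> borel_measurable (N \<Otimes>\<^sub>M N)"
    and bnd: "\<And>j p. p \<in> space (N \<Otimes>\<^sub>M N) \<Longrightarrow> \<bar>k' j p\<bar> \<le> w p"
    and lim: "\<And>p. p \<in> space (N \<Otimes>\<^sub>M N) \<Longrightarrow> (\<lambda>j. k' j p) \<longlonglongrightarrow> k p"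
  shows "bil_small e k"
proof (rule bil_small_closure[OF kj])
  have [measurable]: "k' j \<in> borel_measurable (N \<Otimes>\<^sub>M N)" for j using kj[of j] by (auto simp: bil_small_def)
  have kw: "\<bar>k p\<bar> \<le> w p" if "p \<in> space (N \<Otimes>\<^sub>M N)" for p
    using tendsto_rabs[OF lim[OF that]] by (rule LIMSEQ_le_const2) (use bnd[OF that] in auto)
  have wpos: "0 \<le> w p" if "p \<in> space (N \<Otimes>\<^sub>M N)" for p using bnd[OF that, of 0] by simp
  show "square_integrable (N \<Otimes>\<^sub>M N) k"
    by (rule square_integrable_bound[OF w km]) (use kw wpos in \<open>auto intro!: AE_I2\<close>)
  have "(\<lambda>j. LINT p|(N \<Otimes>\<^sub>M N). (k p - k' j p)\<^sup>2) \<longlonglongrightarrow> (LINT p|(N \<Otimes>\<^sub>M N). 0)"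
  proof (rule integral_dominated_convergence[where w="\<lambda>p. (2 * w p)\<^sup>2"])
    show "integrable (N \<Otimes>\<^sub>M N) (\<lambda>p. (2 * w p)\<^sup>2)"
      by (rule square_integrable_power2[OF square_integrable_cmult[OF w]])
    show "AE p in N \<Otimes>\<^sub>M N. (\<lambda>j. (k p - k' j p)\<^sup>2) \<longlonglongrightarrow> 0"
    proof (rule AE_I2)
      fix p assume "p \<in> space (N \<Otimes>\<^sub>M N)"
      then have "(\<lambda>j. (k p - k' j p)\<^sup>2) \<longlonglongrightarrow> (k p - k p)\<^sup>2" by (intro tendsto_intros lim)
      then show "(\<lambda>j. (k p - k' j p)\<^sup>2) \<longlonglongrightarrow> 0" by simp
    qed
    show "AE p in N \<Otimes>\<^sub>M N. norm ((k p - k' j p)\<^sup>2) \<le> (2 * w p)\<^sup>2" for j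
    proof (rule AE_I2)
      fix p assume p: "p \<in> space (N \<Otimes>\<^sub>M N)"
      have "\<bar>k p - k' j p\<bar> \<le> 2 * w p" using kw[OF p] bnd[OF p, of j] by linarith
      then have "\<bar>k p - k' j p\<bar>\<^sup>2 \<le> (2 * w p)\<^sup>2" by (rule power_mono) simp
      then show "norm ((k p - k' j p)\<^sup>2) \<le> (2 * w p)\<^sup>2" by simp
    qed
  qed auto
  then have "(\<lambda>j. sqrt (LINT p|(N \<Otimes>\<^sub>M N). (k p - k' j p)\<^sup>2)) \<longlonglongrightarrow> sqrt 0"
    by (intro tendsto_real_sqrt) simp
  then show "(\<lambda>j. norm2 (N \<Otimes>\<^sub>M N) (\<lambda>p. k p - k' j p)) \<longlonglongrightarrow> 0" by (simp add: norm2_def)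
qed

lemma bil_small_rectangle:
  assumes A: "A \<in> sets N" "A' \<in> sets N"
  shows "bil_small e (indicator (A \<times> A'))"
proof -
  have "(\<lambda>n. e n powr (real DIM('a) / 2)) \<longlonglongrightarrow> 0"
    by (rule tendsto_zero_powrI[OF e_lim tendsto_const]) (use less_imp_le[OF e_pos] in auto)
  then have l: "(\<lambda>n. e n powr (real DIM('a) / 2) * (corr_mass * (norm2 N u)\<^sup>2)) \<longlonglongrightarrow> 0"
    by (rule tendsto_mult_left_zero)
  have "(\<lambda>n. e n powr (- real DIM('a) / 2) * (LINT \<omega>|M. \<bar>bil (e n) (indicator (A \<times> A')) \<omega>\<bar>)) \<longlonglongrightarrow> 0"
    by (rule Lim_null_comparison[OF always_eventually l]) (use bil_rectangle[OF A e_pos] in \<open>simp add: abs_mult\<close>)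
  moreover have "square_integrable (N \<Otimes>\<^sub>M N) (indicator (A \<times> A'))"
    by (rule P.square_integrable_bounded[where B=1]) (use A in \<open>auto simp: indicator_def\<close>)
  ultimately show ?thesis by (simp add: bil_small_def)
qed

lemma bil_small_cong:
  assumes "bil_small e k" "\<And>p. p \<in> space (N \<Otimes>\<^sub>M N) \<Longrightarrow> k p = k' p"
  shows "bil_small e k'"
proof -
  have "k' \<in> borel_measurable (N \<Otimes>\<^sub>M N)"
    using assms by (subst measurable_cong[OF assms(2)[symmetric]]) (auto simp: bil_small_def)
  then have "square_integrable (N \<Otimes>\<^sub>M N) k'"
    by (rule square_integrable_cong_AE[OF conjunct1[OF assms(1)[unfolded bil_small_def]] _ AE_I2[OF assms(2)]])
  moreover have "bil \<epsilon> k = bil \<epsilon> k'" for \<epsilon> by (rule bil_cong[OF assms(2)])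
  ultimately show ?thesis using assms(1) by (simp add: bil_small_def)
qed

text \<open>Dynkin's argument: rectangles form a generator stable under intersection, and smallness
  survives complements and disjoint unions. The total measure is finite, so the constant 1 serves as
  majorant for the unions.\<close>

lemma bil_small_indicator:
  assumes S: "S \<in> sets (N \<Otimes>\<^sub>M N)"
  shows "bil_small e (indicator S)"
proof -
  let ?\<Omega> = "space N \<times> space N" and ?G = "{a \<times> b | a b. a \<in> sets N \<and> b \<in> sets N}"
  have sp: "space (N \<Otimes>\<^sub>M N) = ?\<Omega>" by (simp add: space_pair_measure)
  have sets: "sets (N \<Otimes>\<^sub>M N) = sigma_sets ?\<Omega> ?G" by (rule sets_pair_measure)
  show ?thesis
    using Int_stable_pair_measure_generator[of N N] pair_measure_closed[of N N] S[unfolded sets]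
  proof (induction rule: sigma_sets_induct_disjoint)
    case (basic A)
    then show ?case using bil_small_rectangle by auto
  next
    case empty
    show ?case using bil_small_zero by (simp add: indicator_def)
  next
    case (compl A)
    have "bil_small e (\<lambda>p. indicator ?\<Omega> p + (- 1) * indicator A p)"
      by (intro bil_small_add bil_small_cmult bil_small_rectangle compl) auto
    then show ?case by (rule bil_small_cong) (auto simp: sp indicator_def)
  next
    case (union A)
    have Am: "A i \<in> sets (N \<Otimes>\<^sub>M N)" for i using union(2) by (auto simp: sets)
    have "bil_small e (\<lambda>p. \<Sum>i<n. indicator (A i) p)" for n by (intro bil_small_sum union)
    moreover have "(\<lambda>p. \<Sum>i<n. indicator (A i) p) = (indicator (\<Union>i<n. A i) :: _ \<Rightarrow> real)" for n
      using union(1) by (subst indicator_UN_disjoint[symmetric]) (auto intro: disjoint_family_on_mono[of _ UNIV])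
    ultimately have fin: "bil_small e (indicator (\<Union>i<n. A i))" for n by metis
    show ?case
    proof (rule bil_small_dominated_limit[OF fin])
      show "square_integrable (N \<Otimes>\<^sub>M N) (\<lambda>_. 1)" by (simp add: square_integrable_def)
      show "indicator (\<Union> (range A)) \<in> borel_measurable (N \<Otimes>\<^sub>M N)" using Am by simp
      show "(\<lambda>n. indicator (\<Union>i<n. A i) p) \<longlonglongrightarrow> (indicator (\<Union> (range A)) p :: real)" for p
        by (rule LIMSEQ_indicator_UN)
    qed (simp add: indicator_def)
  qed
qed

lemma bil_small_all:
  assumes k: "square_integrable (N \<Otimes>\<^sub>M N) k"
  shows "bil_small e k"
proof -
  have km: "k \<in> borel_measurable (N \<Otimes>\<^sub>M N)" using k by simp
  obtain s where s: "\<And>i. simple_function (N \<Otimes>\<^sub>M N) (s i)"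
    "\<And>p. p \<in> space (N \<Otimes>\<^sub>M N) \<Longrightarrow> (\<lambda>i. s i p) \<longlonglongrightarrow> k p"
    "\<And>i p. p \<in> space (N \<Otimes>\<^sub>M N) \<Longrightarrow> dist (s i p) 0 \<le> 2 * dist (k p) 0"
    using borel_measurable_implies_sequence_metric[OF km, of 0] by blast
  have "bil_small e (s i)" for i
  proof -
    let ?\<Omega> = "space (N \<Otimes>\<^sub>M N)"
    have "bil_small e (\<lambda>p. \<Sum>y\<in>s i ` ?\<Omega>. y * indicator (s i -` {y} \<inter> ?\<Omega>) p)"
      by (intro bil_small_sum bil_small_cmult bil_small_indicator simple_functionD(2) s)
    then show ?thesis
    proof (rule bil_small_cong)
      fix p assume p: "p \<in> ?\<Omega>"
      have "(\<Sum>y\<in>s i ` ?\<Omega>. y * indicator (s i -` {y} \<inter> ?\<Omega>) p) = (\<Sum>y\<in>s i ` ?\<Omega>. if s i p = y then y else 0)"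
        using p by (intro sum.cong) (auto simp: indicator_def)
      also have "\<dots> = s i p" using p simple_functionD(1)[OF s(1)[of i]] by simp
      finally show "(\<Sum>y\<in>s i ` ?\<Omega>. y * indicator (s i -` {y} \<inter> ?\<Omega>) p) = s i p" .
    qed
  qed
  then show ?thesis
    by (rule bil_small_dominated_limit[OF _ square_integrable_cmult[OF square_integrable_abs[OF k], of 2] km])
      (use s in auto)
qed

end

text \<open>Uniform row bounds over a set of finite measure make \<open>G\<close> a Hilbert-Schmidt
  kernel, hence one to which the approximation applies.\<close>

lemma square_integrable_kernel: "square_integrable (N \<Otimes>\<^sub>M N) (case_prod G)"
proof -
  have m: "(\<lambda>x. LINT y|N. (G x y)\<^sup>2) \<in> borel_measurable N"
    by (rule N.borel_measurable_lebesgue_integral) (simp add: case_prod_beta')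
  have "integrable (N \<Otimes>\<^sub>M N) (\<lambda>p. (case_prod G p)\<^sup>2)"
  proof (rule NN.Fubini_integrable)
    show "integrable N (\<lambda>x. LINT y|N. norm ((case_prod G (x, y))\<^sup>2))"
      by (rule N.integrable_const_bound[where B=K]) (use GK.G_bound m in \<open>auto intro!: AE_I2\<close>)
    show "AE x in N. integrable N (\<lambda>y. (case_prod G (x, y))\<^sup>2)"
      using GK.G_integrable by (auto intro!: AE_I2)
  qed measurable
  then show ?thesis by (simp add: square_integrable_def)
qed

definition quad :: "real \<Rightarrow> 'w \<Rightarrow> real" where
  "quad \<epsilon> \<omega> = (LINT x|N. (Q \<epsilon> x \<omega> * u x) * GK.kop (\<lambda>y. Q \<epsilon> y \<omega> * u y) x)"

lemma bil_kernel_AE: "AE \<omega> in M. bil \<epsilon> (case_prod G) \<omega> = quad \<epsilon> \<omega>"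
  using bil_iterated_AE[OF square_integrable_kernel, of \<epsilon>] by (simp add: quad_def kop_Q_u)

end

section \<open>White noise and convergence in distribution\<close>

text \<open>The point mass \<open>s = 0\<close> is carried along in the facts about
  \<open>normal_law\<close> because \<sigma> = 0 is allowed.\<close>

lemma normal_law_second_moment:
  assumes "0 \<le> s"
  shows "integrable (normal_law 0 s) (\<lambda>x. x\<^sup>2)" and "(LINT x|normal_law 0 s. x\<^sup>2) = s\<^sup>2"
proof -
  have "has_bochner_integral (normal_law 0 s) (\<lambda>x. x\<^sup>2) (s\<^sup>2)"
  proof (cases "s = 0")
    case True
    interpret prob_space "return borel (0::real)" by (rule prob_space_return) simp
    have i: "integrable (return borel (0::real)) (\<lambda>x. x\<^sup>2)"
      by (rule integrable_const_bound[where B=0]) (auto simp: AE_return)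
    show ?thesis using True i by (simp add: normal_law_def has_bochner_integral_iff integral_return)
  next
    case False
    then have s: "0 < s" using assms by simp
    have "has_bochner_integral lborel (\<lambda>x. normal_density 0 s x * (x - 0) ^ (2 * 1)) (fact (2 * 1) / ((2 / s\<^sup>2) ^ 1 * fact 1))"
      by (rule normal_moment_even[OF s])
    then have "has_bochner_integral lborel (\<lambda>x. normal_density 0 s x *\<^sub>R x\<^sup>2) (s\<^sup>2)" by simp
    then show ?thesis using False unfolding normal_law_def
      by (simp add: has_bochner_integral_iff integrable_density integral_density)
  qed
  then show "integrable (normal_law 0 s) (\<lambda>x. x\<^sup>2)" "(LINT x|normal_law 0 s. x\<^sup>2) = s\<^sup>2"
    by (auto simp: has_bochner_integral_iff)
qed

lemma real_distribution_normal_law: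
  assumes "0 \<le> s"
  shows "real_distribution (normal_law 0 s)"
proof (intro real_distribution.intro real_distribution_axioms.intro)
  show "prob_space (normal_law 0 s)"
    using assms prob_space_normal_density[of s 0] prob_space_return[of "0::real" borel]
    by (cases "s = 0") (auto simp: normal_law_def)
  show "sets (normal_law 0 s) = sets borel" by (simp add: normal_law_def)
qed

lemma char_normal_law:
  assumes "0 \<le> s"
  shows "char (normal_law 0 s) t = of_real (exp (- s\<^sup>2 * t\<^sup>2 / 2))"
proof (cases "s = 0")
  case True
  then show ?thesis by (simp add: normal_law_def char_def integral_return)
next
  case False
  then have s: "0 < s" using assms by simp
  let ?M = "density lborel (normal_density 0 s)"
  interpret prob_space ?M by (rule prob_space_normal_density[OF s])
  have "distributed ?M lborel (\<lambda>x. x) (normal_density 0 s)"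
    unfolding distributed_def by (auto intro!: distr_id2)
  then have "distributed ?M lborel (\<lambda>x. (x - 0) / s) std_normal_density"
    using normal_standard_normal_convert[OF s, of "\<lambda>x. x" 0] by simp
  then have d: "distr ?M lborel (\<lambda>x. x / s) = std_normal_distribution"
    by (simp add: distributed_distr_eq_density)
  have "char ?M t = (LINT x|?M. iexp ((t * s) * (x / s)))" using s by (simp add: char_def)
  also have "\<dots> = (LINT x|distr ?M lborel (\<lambda>x. x / s). iexp ((t * s) * x))"
    by (rule integral_distr[symmetric]) auto
  also have "\<dots> = char std_normal_distribution (t * s)" unfolding d by (simp add: char_def)
  also have "\<dots> = of_real (exp (- s\<^sup>2 * t\<^sup>2 / 2))"
    unfolding char_std_normal_distribution by (simp add: power_mult_distrib mult.commute)
  finally show ?thesis using False by (simp add: normal_law_def)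
qed

lemma lborel_on_UNIV: "lborel_on UNIV = (lborel :: 'a::euclidean_space measure)"
  by (rule measure_eqI) (auto simp: sets_restrict_space emeasure_restrict_space)

lemma L2_UNIV_iff: "f \<in> L2 UNIV \<longleftrightarrow> square_integrable lborel f"
  by (simp add: L2_iff_square_integrable lborel_on_UNIV)

text \<open>\<open>white_noise\<close> only asserts that some standard deviation exists. It is
  identified by computing the second moment twice, from the Gaussian law and from the prescribed
  covariance.\<close>

lemma white_noise_law:
  assumes W: "white_noise N W" and f: "f \<in> L2 UNIV"
  shows "distr N borel (\<lambda>w. c * W f w) = normal_law 0 (\<bar>c\<bar> * norm2 lborel f)"
    and "square_integrable N (W f)"
proof -
  have Wm [measurable]: "W f \<in> borel_measurable N" using W f by (simp add: white_noise_def)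
  have fin: "finite {f} \<and> {f} \<subseteq> L2 UNIV" using f by simp
  have law: "\<exists>s\<ge>0. distr N borel (\<lambda>w. c * W f w) = normal_law 0 s" for c
    using W fin unfolding white_noise_def by (elim conjE allE[of _ "{f}"] allE[of _ "\<lambda>_. c"]) simp
  obtain s0 where s0: "0 \<le> s0" "distr N borel (W f) = normal_law 0 s0" using law[of 1] by auto
  have "integrable (distr N borel (W f)) (\<lambda>x. x\<^sup>2)"
    unfolding s0(2) by (rule normal_law_second_moment(1)[OF s0(1)])
  then have i: "integrable N (\<lambda>w. (W f w)\<^sup>2)" by (subst (asm) integrable_distr_eq) auto
  then show "square_integrable N (W f)" by (simp add: square_integrable_def)
  obtain s where s: "0 \<le> s" "distr N borel (\<lambda>w. c * W f w) = normal_law 0 s" using law[of c] by auto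
  have "s\<^sup>2 = (LINT x|distr N borel (\<lambda>w. c * W f w). x\<^sup>2)"
    unfolding s(2) using normal_law_second_moment(2)[OF s(1)] by simp
  also have "\<dots> = (LINT w|N. (c * W f w)\<^sup>2)" by (rule integral_distr) auto
  also have "(\<lambda>w. (c * W f w)\<^sup>2) = (\<lambda>w. c\<^sup>2 * (W f w * W f w))"
    by (simp add: power2_eq_square mult_ac)
  also have "(LINT w|N. c\<^sup>2 * (W f w * W f w)) = c\<^sup>2 * (LINT w|N. W f w * W f w)" by simp
  also have "(LINT w|N. W f w * W f w) = (norm2 lborel f)\<^sup>2"
    unfolding norm2_power2 unfolding power2_eq_square
    using W f by (simp add: white_noise_def L2_inner_def lborel_on_UNIV)
  also have "c\<^sup>2 * (norm2 lborel f)\<^sup>2 = (\<bar>c\<bar> * norm2 lborel f)\<^sup>2" by (simp add: power_mult_distrib)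
  finally have "s = \<bar>c\<bar> * norm2 lborel f" by (rule power2_eq_imp_eq) (use s(1) in auto)
  then show "distr N borel (\<lambda>w. c * W f w) = normal_law 0 (\<bar>c\<bar> * norm2 lborel f)" using s(2) by simp
qed

text \<open>Neither linearity of \<open>W\<close> nor its insensitivity to null sets is postulated
  in \<open>white_noise\<close>. Both come from the covariance: the second moment of
  \<open>W f - c * W g\<close> expands to zero.\<close>

lemma white_noise_scale_AE:
  assumes W: "white_noise N W" and f: "f \<in> L2 UNIV" and g: "g \<in> L2 UNIV"
    and fg: "AE x in lborel. f x = c * g x"
  shows "AE w in N. W f w = c * W g w"
proof -
  have fsq: "square_integrable lborel f" and gsq: "square_integrable lborel g"
    using f g by (auto simp: L2_UNIV_iff)
  then have [measurable]: "f \<in> borel_measurable borel" "g \<in> borel_measurable borel"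
    by (simp_all add: square_integrable_def)
  note Wf = white_noise_law(2)[OF W f] and Wg = white_noise_law(2)[OF W g]
  have cov: "(LINT w|N. W f w * W g w) = (LINT x|lborel. f x * g x)" if "f \<in> L2 UNIV" "g \<in> L2 UNIV" for f g
    using W that by (simp add: white_noise_def L2_inner_def lborel_on_UNIV)
  have ff: "(LINT x|lborel. f x * f x) = c\<^sup>2 * (LINT x|lborel. g x * g x)"
  proof -
    have "(LINT x|lborel. f x * f x) = (LINT x|lborel. c\<^sup>2 * (g x * g x))"
      by (rule integral_cong_AE) (use fg in \<open>auto elim!: eventually_mono simp: power2_eq_square\<close>)
    then show ?thesis by simp
  qed
  have fgi: "(LINT x|lborel. f x * g x) = c * (LINT x|lborel. g x * g x)"
  proof -
    have "(LINT x|lborel. f x * g x) = (LINT x|lborel. c * (g x * g x))"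
      by (rule integral_cong_AE) (use fg in \<open>auto elim!: eventually_mono\<close>)
    then show ?thesis by simp
  qed
  note d = square_integrable_diff[OF Wf square_integrable_cmult[OF Wg, of c]]
  have "(LINT w|N. (W f w - c * W g w)\<^sup>2)
      = (LINT w|N. W f w * W f w - 2 * c * (W f w * W g w) + c\<^sup>2 * (W g w * W g w))"
    by (rule Bochner_Integration.integral_cong) (simp_all add: power2_eq_square algebra_simps)
  also have "\<dots> = (LINT w|N. W f w * W f w) - 2 * c * (LINT w|N. W f w * W g w) + c\<^sup>2 * (LINT w|N. W g w * W g w)"
    using square_integrable_mult_integrable[OF Wf Wf] square_integrable_mult_integrable[OF Wf Wg]
      square_integrable_mult_integrable[OF Wg Wg] by simp
  also have "\<dots> = 0"
    unfolding cov[OF f f] cov[OF f g] cov[OF g g] ff fgi by (simp add: power2_eq_square)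
  finally have "norm2 N (\<lambda>w. W f w - c * W g w) = 0" by (simp add: norm2_def)
  then have "AE w in N. W f w - c * W g w = 0" by (rule norm2_eq_0_AE[OF d])
  then show ?thesis by eventually_elim simp
qed

text \<open>The mean of \<open>min 1 \<bar>X - Y\<bar>\<close> metrises convergence in probability.
  In the constant, \<open>\<bar>t\<bar>\<close> is the Lipschitz bound for small differences and 2
  the trivial bound for large ones.\<close>

lemma (in prob_space) char_distr_diff_le:
  assumes [measurable]: "X \<in> borel_measurable M" "Y \<in> borel_measurable M"
  shows "cmod ((LINT \<omega>|M. iexp (t * X \<omega>)) - (LINT \<omega>|M. iexp (t * Y \<omega>)))
    \<le> (2 + \<bar>t\<bar>) * (LINT \<omega>|M. min 1 \<bar>X \<omega> - Y \<omega>\<bar>)"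
proof -
  have i: "integrable M (\<lambda>\<omega>. iexp (t * X \<omega>))" "integrable M (\<lambda>\<omega>. iexp (t * Y \<omega>))"
    by (rule integrable_iexp; simp)+
  have im: "integrable M (\<lambda>\<omega>. min 1 \<bar>X \<omega> - Y \<omega>\<bar>)"
    by (rule integrable_const_bound[where B=1]) auto
  have le: "cmod (iexp (t * X \<omega>) - iexp (t * Y \<omega>)) \<le> (2 + \<bar>t\<bar>) * min 1 \<bar>X \<omega> - Y \<omega>\<bar>" for \<omega>
  proof (cases "\<bar>X \<omega> - Y \<omega>\<bar> \<le> 1")
    case True
    have "cmod (iexp (t * X \<omega>) - iexp (t * Y \<omega>)) \<le> \<bar>t * X \<omega> - t * Y \<omega>\<bar>" by (rule cmod_iexp_diff_le)
    also have "\<dots> = \<bar>t\<bar> * \<bar>X \<omega> - Y \<omega>\<bar>" by (simp flip: abs_mult right_diff_distrib)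
    also have "\<dots> \<le> (2 + \<bar>t\<bar>) * \<bar>X \<omega> - Y \<omega>\<bar>" by (rule mult_right_mono) auto
    finally show ?thesis using True by simp
  next
    case False
    have "cmod (iexp (t * X \<omega>) - iexp (t * Y \<omega>)) \<le> cmod (iexp (t * X \<omega>)) + cmod (iexp (t * Y \<omega>))"
      by (rule norm_triangle_ineq4)
    also have "\<dots> = 2" by (simp only: norm_exp_i_times)
    finally show ?thesis using False by simp
  qed
  have "cmod ((LINT \<omega>|M. iexp (t * X \<omega>)) - (LINT \<omega>|M. iexp (t * Y \<omega>)))
      = cmod (LINT \<omega>|M. iexp (t * X \<omega>) - iexp (t * Y \<omega>))"
    by (simp only: Bochner_Integration.integral_diff[OF i])
  also have "\<dots> \<le> (LINT \<omega>|M. cmod (iexp (t * X \<omega>) - iexp (t * Y \<omega>)))" by (rule integral_norm_bound)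
  also have "\<dots> \<le> (LINT \<omega>|M. (2 + \<bar>t\<bar>) * min 1 \<bar>X \<omega> - Y \<omega>\<bar>)"
    by (intro integral_mono le integrable_norm Bochner_Integration.integrable_diff i integrable_mult_right im)
  finally show ?thesis by simp
qed

text \<open>Slutsky's argument at the level of characteristic functions, closed by Levy's continuity
  theorem. The factor \<open>c\<close> lets both assertions on the eigenvalues share one family
  \<open>Y\<close>.\<close>

lemma (in prob_space) converges_in_distribution_perturb:
  fixes X Y :: "real \<Rightarrow> 'a \<Rightarrow> real"
  assumes \<epsilon>0: "0 < \<epsilon>0" and Xm: "\<And>\<epsilon>. 0 < \<epsilon> \<Longrightarrow> \<epsilon> < \<epsilon>0 \<Longrightarrow> X \<epsilon> \<in> borel_measurable M"
    and Ym: "\<And>\<epsilon>. Y \<epsilon> \<in> borel_measurable M"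
    and clt: "\<And>e t. (\<And>k. 0 < e k) \<Longrightarrow> (\<And>k. e k < \<epsilon>0) \<Longrightarrow> e \<longlonglongrightarrow> 0 \<Longrightarrow>
      (\<lambda>k. LINT \<omega>|M. iexp (t * Y (e k) \<omega>)) \<longlonglongrightarrow> of_real (exp (- v * t\<^sup>2 / 2))"
    and close: "\<And>e. (\<And>k. 0 < e k) \<Longrightarrow> (\<And>k. e k < \<epsilon>0) \<Longrightarrow> e \<longlonglongrightarrow> 0 \<Longrightarrow>
      (\<lambda>k. LINT \<omega>|M. min 1 \<bar>X (e k) \<omega> - c * Y (e k) \<omega>\<bar>) \<longlonglongrightarrow> 0"
    and Z: "distr N borel Z = normal_law 0 s" and s: "0 \<le> s" "s\<^sup>2 = c\<^sup>2 * v"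
  shows "converges_in_distribution M X N Z"
  unfolding converges_in_distribution_def
proof (intro allI impI)
  fix e :: "nat \<Rightarrow> real" assume e: "filterlim e (at_right 0) sequentially"
  then have e0: "e \<longlonglongrightarrow> 0" and ev: "eventually (\<lambda>k. 0 < e k) sequentially"
    by (auto simp: filterlim_at elim: eventually_mono)
  have ev2: "eventually (\<lambda>k. e k < \<epsilon>0) sequentially" by (rule order_tendstoD(2)[OF e0 \<epsilon>0])
  obtain k0 where k0: "\<And>k. k0 \<le> k \<Longrightarrow> 0 < e k \<and> e k < \<epsilon>0"
    using eventually_conj[OF ev ev2] by (auto simp: eventually_sequentially)
  \<comment> \<open>Measurability and estimates are available only between 0 and
    \<open>\<epsilon>0\<close>; dropping finitely many terms does not change the weak limit.\<close>
  define e' where "e' k = e (k + k0)" for k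
  have e': "0 < e' k" "e' k < \<epsilon>0" for k using k0[of "k + k0"] by (auto simp: e'_def)
  have e'0: "e' \<longlonglongrightarrow> 0" unfolding e'_def[abs_def] by (rule LIMSEQ_ignore_initial_segment[OF e0])
  note Xm' = Xm[OF e'(1) e'(2)]
  have rd: "real_distribution (distr M borel (X (e' k)))" for k
  proof -
    interpret P: prob_space "distr M borel (X (e' k))" by (rule prob_space_distr[OF Xm'])
    show ?thesis by unfold_locales auto
  qed
  have "weak_conv_m (\<lambda>k. distr M borel (X (e' k))) (normal_law 0 s)"
  proof (rule levy_continuity[OF rd real_distribution_normal_law[OF s(1)]])
    fix t
    have c: "char (distr M borel (X (e' k))) t = (LINT \<omega>|M. iexp (t * X (e' k) \<omega>))" for k
      unfolding char_def by (rule integral_distr[OF Xm']) simp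
    have lim1: "(\<lambda>k. LINT \<omega>|M. iexp (t * (c * Y (e' k) \<omega>))) \<longlonglongrightarrow> of_real (exp (- s\<^sup>2 * t\<^sup>2 / 2))"
      using clt[OF e' e'0, of "t * c"] by (simp add: mult.assoc s(2) power_mult_distrib mult_ac)
    have lim2: "(\<lambda>k. (LINT \<omega>|M. iexp (t * X (e' k) \<omega>)) - (LINT \<omega>|M. iexp (t * (c * Y (e' k) \<omega>)))) \<longlonglongrightarrow> 0"
    proof (rule Lim_null_comparison[OF always_eventually])
      show "\<forall>k. norm ((LINT \<omega>|M. iexp (t * X (e' k) \<omega>)) - (LINT \<omega>|M. iexp (t * (c * Y (e' k) \<omega>))))
          \<le> (2 + \<bar>t\<bar>) * (LINT \<omega>|M. min 1 \<bar>X (e' k) \<omega> - c * Y (e' k) \<omega>\<bar>)"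
        by (intro allI char_distr_diff_le Xm' borel_measurable_times borel_measurable_const Ym)
      show "(\<lambda>k. (2 + \<bar>t\<bar>) * (LINT \<omega>|M. min 1 \<bar>X (e' k) \<omega> - c * Y (e' k) \<omega>\<bar>)) \<longlonglongrightarrow> 0"
        using tendsto_mult_left[OF close[OF e' e'0], of "2 + \<bar>t\<bar>"] by simp
    qed
    show "(\<lambda>k. char (distr M borel (X (e' k))) t) \<longlonglongrightarrow> char (normal_law 0 s) t"
      unfolding c char_normal_law[OF s(1)] using tendsto_add[OF lim2 lim1] by simp
  qed
  then have "(\<lambda>k. cdf (distr M borel (X (e (k + k0)))) x) \<longlonglongrightarrow> cdf (distr N borel Z) x"
    if "isCont (cdf (distr N borel Z)) x" for x
    using that unfolding Z weak_conv_m_def weak_conv_def e'_def by blast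
  then show "weak_conv_m (\<lambda>k. distr M borel (X (e k))) (distr N borel Z)"
    unfolding weak_conv_m_def weak_conv_def by (auto intro: LIMSEQ_offset)
qed

section \<open>Expansion of the perturbed eigenvalue\<close>

text \<open>For unit vectors the inner product of \<open>v\<close> and \<open>u\<close> is 1 -
  n^2/2, so replacing it by 1 costs at most \<open>\<bar>l - \<Lambda>\<bar> * n\<close>. The other
  terms with \<open>n\<close> come from replacing \<open>v\<close> by \<open>u\<close> on the right.
  The inequality also serves the cutoff event, where the potential is zero.\<close>

lemma (in symmetric_kernel) eigenvalue_expansion:
  assumes V: "square_integrable N V" and u: "square_integrable N u" and ub: "AE x in N. \<bar>u x\<bar> \<le> B"
    and eig: "AE x in N. kop u x = \<Lambda> * u x" and u1: "norm2 N u = 1"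
    and v: "square_integrable N v" and v1: "norm2 N v = 1" and w: "square_integrable N w"
    and wv: "AE x in N. w x = l * v x"
    and eq: "AE x in N. w x = kop v x - kop (\<lambda>y. V y * kop v y) x + iter_kop V w x"
  defines "n \<equiv> norm2 N (\<lambda>x. v x - u x)"
  shows "\<bar>(l - \<Lambda>) + \<Lambda>\<^sup>2 * (LINT x|N. (u x)\<^sup>2 * V x)\<bar> \<le> \<bar>l - \<Lambda>\<bar> * n
    + \<bar>\<Lambda>\<bar> * (norm2 N (kop (\<lambda>y. V y * u y)) * n)
    + \<bar>l\<bar> * \<bar>\<Lambda>\<bar> * (\<bar>LINT x|N. (V x * u x) * kop (\<lambda>y. V y * u y) x\<bar>
        + norm2 N (\<lambda>x. V x * kop (\<lambda>y. V y * u y) x) * n)"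
proof -
  have [measurable]: "V \<in> borel_measurable N" "u \<in> borel_measurable N" "v \<in> borel_measurable N"
    using V u v by auto
  define g where "g = kop (\<lambda>y. V y * u y)"
  have Vu: "square_integrable N (\<lambda>x. V x * u x)"
    using square_integrable_mult_bounded[OF V _ ub] by (simp add: mult.commute)
  have g: "square_integrable N g" unfolding g_def by (rule square_integrable_kop[OF Vu])
  have Vg: "square_integrable N (\<lambda>x. V x * g x)"
    unfolding g_def by (rule square_integrable_mult_kop[OF V Vu])
  note vu = square_integrable_diff[OF v u]
  note i = square_integrable_mult_integrable
  define p where "p = (LINT x|N. v x * u x)"
  have "n\<^sup>2 = (LINT x|N. (v x)\<^sup>2 + (u x)\<^sup>2 - 2 * (v x * u x))"
    unfolding n_def norm2_power2 by (rule Bochner_Integration.integral_cong) (simp_all add: power2_diff)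
  also have "\<dots> = (norm2 N v)\<^sup>2 + (norm2 N u)\<^sup>2 - 2 * p"
    using v u i[OF v u] by (simp add: p_def norm2_power2 square_integrable_power2)
  finally have p: "1 - p = n\<^sup>2 / 2" using u1 v1 by simp
  have n2: "n \<le> 2" using norm2_triangle_diff[OF v u] u1 v1 by (simp add: n_def)
  have n0: "0 \<le> n" by (simp add: n_def)
  \<comment> \<open>\<open>n \<le> 2\<close> holds for any two unit vectors; it trades the quadratic
    term for a linear one, to which Cauchy-Schwarz over the probability space applies.\<close>
  have nn: "n\<^sup>2 / 2 \<le> n" using n2 n0 mult_right_mono[of n 2 n] by (simp add: power2_eq_square)
  have "(LINT x|N. (V x * u x) * kop v x) = (LINT x|N. g x * v x)"
    unfolding g_def using kop_adjoint[OF square_integrable_integrable[OF Vu] v] by simp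
  also have "\<dots> = (LINT x|N. g x * u x + g x * (v x - u x))" by (simp add: algebra_simps)
  also have "\<dots> = (LINT x|N. g x * u x) + (LINT x|N. g x * (v x - u x))"
    by (rule Bochner_Integration.integral_add[OF i[OF g u] i[OF g vu]])
  also have "(LINT x|N. g x * u x) = (LINT x|N. (V x * u x) * kop u x)"
    unfolding g_def by (rule kop_adjoint[OF square_integrable_integrable[OF Vu] u])
  also have "\<dots> = (LINT x|N. \<Lambda> * ((u x)\<^sup>2 * V x))"
    by (rule integral_cong_AE) (use eig in \<open>auto elim!: eventually_mono simp: power2_eq_square\<close>)
  finally have e1: "(LINT x|N. (V x * u x) * kop v x)
      = \<Lambda> * (LINT x|N. (u x)\<^sup>2 * V x) + (LINT x|N. g x * (v x - u x))" by simp
  have "(LINT x|N. v x * (V x * g x)) = (LINT x|N. (V x * u x) * g x + (V x * g x) * (v x - u x))"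
    by (simp add: algebra_simps)
  also have "\<dots> = (LINT x|N. (V x * u x) * g x) + (LINT x|N. (V x * g x) * (v x - u x))"
    by (rule Bochner_Integration.integral_add[OF i[OF Vu g] i[OF Vg vu]])
  finally have e2: "(LINT x|N. v x * (V x * g x)) = (LINT x|N. (V x * u x) * g x) + (LINT x|N. (V x * g x) * (v x - u x))" .
  have "(l - \<Lambda>) * p = - \<Lambda> * (\<Lambda> * (LINT x|N. (u x)\<^sup>2 * V x) + (LINT x|N. g x * (v x - u x)))
    + l * \<Lambda> * ((LINT x|N. (V x * u x) * g x) + (LINT x|N. (V x * g x) * (v x - u x)))"
    using eigenvalue_difference[OF V u ub eig v w wv eq] unfolding p_def[symmetric] g_def[symmetric] e1 e2 .
  moreover have "(l - \<Lambda>) = (l - \<Lambda>) * p + (l - \<Lambda>) * (n\<^sup>2 / 2)"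
    unfolding p[symmetric] by (simp add: algebra_simps)
  ultimately have expand: "(l - \<Lambda>) + \<Lambda>\<^sup>2 * (LINT x|N. (u x)\<^sup>2 * V x) = (l - \<Lambda>) * (n\<^sup>2 / 2) - \<Lambda> * (LINT x|N. g x * (v x - u x))
    + (l * \<Lambda>) * ((LINT x|N. (V x * u x) * g x) + (LINT x|N. (V x * g x) * (v x - u x)))"
    by (simp add: power2_eq_square algebra_simps)
  have h1: "\<bar>(l - \<Lambda>) * (n\<^sup>2 / 2)\<bar> \<le> \<bar>l - \<Lambda>\<bar> * n"
    using mult_left_mono[OF nn, of "\<bar>l - \<Lambda>\<bar>"] by (simp add: abs_mult)
  have h2: "\<bar>\<Lambda> * (LINT x|N. g x * (v x - u x))\<bar> \<le> \<bar>\<Lambda>\<bar> * (norm2 N g * n)"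
    unfolding abs_mult[of \<Lambda>] n_def by (intro mult_left_mono abs_integral_mult_le_norm2 g vu) simp
  have "\<bar>LINT x|N. (V x * g x) * (v x - u x)\<bar> \<le> norm2 N (\<lambda>x. V x * g x) * n"
    unfolding n_def by (rule abs_integral_mult_le_norm2[OF Vg vu])
  then have "\<bar>(LINT x|N. (V x * u x) * g x) + (LINT x|N. (V x * g x) * (v x - u x))\<bar>
      \<le> \<bar>LINT x|N. (V x * u x) * g x\<bar> + norm2 N (\<lambda>x. V x * g x) * n"
    by (rule order_trans[OF abs_triangle_ineq add_left_mono])
  then have h3: "\<bar>(l * \<Lambda>) * ((LINT x|N. (V x * u x) * g x) + (LINT x|N. (V x * g x) * (v x - u x)))\<bar>
      \<le> \<bar>l\<bar> * \<bar>\<Lambda>\<bar> * (\<bar>LINT x|N. (V x * u x) * g x\<bar> + norm2 N (\<lambda>x. V x * g x) * n)"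
    unfolding abs_mult[of "l * \<Lambda>"] abs_mult[of l] by (rule mult_left_mono) simp
  have tri: "\<bar>a - b + c\<bar> \<le> \<bar>a\<bar> + \<bar>b\<bar> + \<bar>c\<bar>" for a b c :: real by linarith
  show ?thesis
    using order_trans[OF tri add_mono[OF add_mono[OF h1 h2] h3]] unfolding expand g_def .
qed

text \<open>Serves to turn an almost everywhere bound on a continuous function into one at every
  point of an open set.\<close>

lemma open_AE_lborel_empty:
  fixes S :: "'a::euclidean_space set"
  assumes "open S" "AE x in lborel. x \<notin> S"
  shows "S = {}"
proof (rule ccontr)
  assume "S \<noteq> {}"
  then have "\<not> negligible S" by (rule open_not_negligible[OF assms(1)])
  moreover have "S \<in> null_sets lborel"
    using assms AE_iff_null_sets[of S lborel] by simp
  then have "S \<in> null_sets lebesgue" by (rule null_sets_completionI)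
  ultimately show False by (simp add: negligible_iff_null_sets)
qed

section \<open>Remainders along a sequence of scales\<close>

context kernel_field begin

text \<open>The common mechanism for all remainders that contain the norm of v - u: the root of the
  second moment of \<open>g\<close> compensates the normalisation exactly, so \<open>f\<close> may
  tend to zero at any rate.\<close>

lemma scaled_CS_tendsto:
  assumes e: "\<And>k. 0 < e k"
    and f: "\<And>k. square_integrable M (f k)" "\<And>k. (LINT \<omega>|M. (f k \<omega>)\<^sup>2) \<le> \<alpha> k" "\<alpha> \<longlonglongrightarrow> 0"
    and g: "\<And>k. square_integrable M (g k)" "\<And>k. (LINT \<omega>|M. (g k \<omega>)\<^sup>2) \<le> C * e k ^ DIM('a)"
  shows "(\<lambda>k. e k powr (- real DIM('a) / 2) * (LINT \<omega>|M. \<bar>f k \<omega> * g k \<omega>\<bar>)) \<longlonglongrightarrow> 0"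
proof (rule Lim_null_comparison[OF always_eventually])
  have se: "e k powr (- real DIM('a) / 2) * sqrt (e k ^ DIM('a)) = 1" for k
    unfolding powr_realpow[OF e, symmetric] powr_half_sqrt[symmetric, OF powr_ge_zero] powr_powr powr_add[symmetric]
    using e[of k] by simp
  show "\<forall>k. norm (e k powr (- real DIM('a) / 2) * (LINT \<omega>|M. \<bar>f k \<omega> * g k \<omega>\<bar>)) \<le> sqrt (\<alpha> k) * sqrt C"
  proof
    fix k
    have "0 \<le> \<alpha> k" using f(2)[of k] by (rule order_trans[rotated]) simp
    have "(LINT \<omega>|M. \<bar>f k \<omega> * g k \<omega>\<bar>) \<le> norm2 M (f k) * norm2 M (g k)"
      by (rule integral_abs_mult_le_norm2[OF f(1) g(1)])
    also have "\<dots> \<le> sqrt (\<alpha> k) * sqrt (C * e k ^ DIM('a))"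
      unfolding norm2_def using \<open>0 \<le> \<alpha> k\<close> by (intro mult_mono real_sqrt_le_mono f g) auto
    finally have "e k powr (- real DIM('a) / 2) * (LINT \<omega>|M. \<bar>f k \<omega> * g k \<omega>\<bar>)
        \<le> e k powr (- real DIM('a) / 2) * (sqrt (\<alpha> k) * sqrt (C * e k ^ DIM('a)))"
      by (rule mult_left_mono) simp
    also have "\<dots> = (e k powr (- real DIM('a) / 2) * sqrt (e k ^ DIM('a))) * (sqrt (\<alpha> k) * sqrt C)"
      by (simp only: real_sqrt_mult mult_ac)
    finally show "norm (e k powr (- real DIM('a) / 2) * (LINT \<omega>|M. \<bar>f k \<omega> * g k \<omega>\<bar>)) \<le> sqrt (\<alpha> k) * sqrt C"
      unfolding se by simp
  qed
  have "(\<lambda>k. sqrt (\<alpha> k) * sqrt C) \<longlonglongrightarrow> sqrt 0 * sqrt C" by (intro tendsto_intros f)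
  then show "(\<lambda>k. sqrt (\<alpha> k) * sqrt C) \<longlonglongrightarrow> 0" by simp
qed

lemma norm2_Q_square_integrable: "square_integrable M (\<lambda>\<omega>. norm2 N (\<lambda>x. c * Q \<epsilon> x \<omega>))"
proof -
  have m: "(\<lambda>\<omega>. LINT x|N. (Q \<epsilon> x \<omega>)\<^sup>2) \<in> borel_measurable M"
    by (rule N.borel_measurable_lebesgue_integral) (simp add: case_prod_beta')
  have "integrable M (\<lambda>\<omega>. LINT y|N. indicator D y * (\<bar>Q \<epsilon> 0 \<omega>\<bar> ^ 0 * (Q \<epsilon> y \<omega>)\<^sup>2))"
    by (rule NM.integrable_snd[OF integrable_weighted_Q_power2(1)]) auto
  moreover have "(LINT y|N. indicator D y * (\<bar>Q \<epsilon> 0 \<omega>\<bar> ^ 0 * (Q \<epsilon> y \<omega>)\<^sup>2)) = (LINT y|N. (Q \<epsilon> y \<omega>)\<^sup>2)" for \<omega>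
    by (rule Bochner_Integration.integral_cong) auto
  ultimately have i: "integrable M (\<lambda>\<omega>. LINT y|N. (Q \<epsilon> y \<omega>)\<^sup>2)" by simp
  have "square_integrable M (\<lambda>\<omega>. norm2 N (\<lambda>x. Q \<epsilon> x \<omega>))"
    unfolding square_integrable_def norm2_power2 using i m by (simp add: norm2_def)
  then show ?thesis unfolding norm2_cmult by (rule square_integrable_cmult)
qed

lemma square_integrable_of_power2:
  assumes "integrable M (\<lambda>\<omega>. (f \<omega>)\<^sup>2)" "\<And>\<omega>. 0 \<le> f \<omega>"
  shows "square_integrable M f"
proof -
  have "(\<lambda>\<omega>. sqrt ((f \<omega>)\<^sup>2)) \<in> borel_measurable M" using assms(1) by measurable
  then show ?thesis using assms by (simp add: square_integrable_def)
qed

text \<open>One integrable majorant \<open>R k\<close> covers three cases: the cutoff event, where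
  [H3] bounds the oscillatory integral; eigenvalues farther than 1 from \<Lambda>; and the rest,
  where the expansion applies with a bounded eigenvalue.\<close>

lemma eigenvalue_remainder_tendsto:
  fixes e :: "nat \<Rightarrow> real" and l n :: "nat \<Rightarrow> 'w \<Rightarrow> real" and \<Lambda> C :: real
  assumes e: "\<And>k. 0 < e k" "e \<longlonglongrightarrow> 0"
    and l: "\<And>k. square_integrable M (\<lambda>\<omega>. l k \<omega> - \<Lambda>)" "\<And>k. (LINT \<omega>|M. (l k \<omega> - \<Lambda>)\<^sup>2) \<le> C * e k ^ DIM('a)"
    and n: "\<And>k. square_integrable M (n k)" "\<And>k. (LINT \<omega>|M. (n k \<omega>)\<^sup>2) \<le> C * e k ^ DIM('a)" "\<And>k \<omega>. 0 \<le> n k \<omega>"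
    and cut: "\<And>k. A k \<in> sets M"
      "(\<lambda>k. LINT \<omega>|M. indicator (A k) \<omega> * norm2 N (\<lambda>x. e k powr (- real DIM('a) / 2) * Q (e k) x \<omega>)) \<longlonglongrightarrow> 0"
    and off: "\<And>k. AE \<omega> in M. \<omega> \<notin> A k \<longrightarrow>
      \<bar>(l k \<omega> - \<Lambda>) + \<Lambda>\<^sup>2 * osc (e k) (\<lambda>x. (u x)\<^sup>2) \<omega>\<bar> \<le> \<bar>l k \<omega> - \<Lambda>\<bar> * n k \<omega>
        + \<bar>\<Lambda>\<bar> * (norm2 N (GK.kop (\<lambda>y. Q (e k) y \<omega> * u y)) * n k \<omega>)
        + \<bar>l k \<omega>\<bar> * \<bar>\<Lambda>\<bar> * (\<bar>quad (e k) \<omega>\<bar>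
            + norm2 N (\<lambda>x. Q (e k) x \<omega> * GK.kop (\<lambda>y. Q (e k) y \<omega> * u y) x) * n k \<omega>)"
    and on: "\<And>k. AE \<omega> in M. \<omega> \<in> A k \<longrightarrow> \<bar>l k \<omega> - \<Lambda>\<bar> \<le> \<bar>l k \<omega> - \<Lambda>\<bar> * n k \<omega>"
  shows "(\<lambda>k. LINT \<omega>|M. min 1 \<bar>e k powr (- real DIM('a) / 2) * (l k \<omega> - \<Lambda>) + \<Lambda>\<^sup>2 * fluct (e k) (\<lambda>x. (u x)\<^sup>2) \<omega>\<bar>) \<longlonglongrightarrow> 0"
proof -
  define s where "s k = e k powr (- real DIM('a) / 2)" for k
  have s: "0 < s k" for k using e(1)[of k] by (simp add: s_def)
  define a where "a k \<omega> = norm2 N (GK.kop (\<lambda>y. Q (e k) y \<omega> * u y))" for k \<omega>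
  define b where "b k \<omega> = norm2 N (\<lambda>x. Q (e k) x \<omega> * GK.kop (\<lambda>y. Q (e k) y \<omega> * u y) x)" for k \<omega>
  define hk where "hk k \<omega> = indicator (A k) \<omega> * norm2 N (\<lambda>x. s k * Q (e k) x \<omega>)" for k \<omega>
  define \<beta> where "\<beta> k = bil (e k) (case_prod G)" for k
  define U where "U = norm2 N (\<lambda>x. (u x)\<^sup>2)"
  define c4 where "c4 = (\<bar>\<Lambda>\<bar> + 1) * \<bar>\<Lambda>\<bar>"
  have c4: "0 \<le> c4" by (simp add: c4_def)
  have ab0: "0 \<le> a k \<omega>" "0 \<le> b k \<omega>" for k \<omega> by (simp_all add: a_def b_def)
  have epow: "(\<lambda>k. c * e k ^ DIM('a)) \<longlonglongrightarrow> 0" for c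
  proof -
    have "(\<lambda>k. c * e k ^ DIM('a)) \<longlonglongrightarrow> c * 0 ^ DIM('a)" by (intro tendsto_intros e)
    then show ?thesis by (simp add: power_0_left)
  qed
  have a_sq: "square_integrable M (a k)" for k
    using expectation_norm2_kop_Q_u(1)[OF e(1)] ab0 by (intro square_integrable_of_power2) (auto simp: a_def)
  have b_sq: "square_integrable M (b k)" for k
    using expectation_norm2_Q_kop_Q_u(1)[OF e(1)] ab0 by (intro square_integrable_of_power2) (auto simp: b_def)
  have usq: "square_integrable N (\<lambda>x. (u x)\<^sup>2)"
    by (rule N.square_integrable_bounded[where B="B\<^sup>2"]) (use u_bound_AE B_nonneg in \<open>auto elim!: eventually_mono simp: abs_le_square_iff[symmetric]\<close>)
  have t1: "(\<lambda>k. s k * (LINT \<omega>|M. \<bar>(l k \<omega> - \<Lambda>) * n k \<omega>\<bar>)) \<longlonglongrightarrow> 0"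
    unfolding s_def by (rule scaled_CS_tendsto[OF e(1) l epow n(1,2)])
  have t3: "(\<lambda>k. s k * (LINT \<omega>|M. \<bar>a k \<omega> * n k \<omega>\<bar>)) \<longlonglongrightarrow> 0"
    unfolding s_def
  proof (rule scaled_CS_tendsto[OF e(1) a_sq _ epow n(1,2)])
    show "(LINT \<omega>|M. (a k \<omega>)\<^sup>2) \<le> (measure N D * (corr_mass * (B\<^sup>2 * K))) * e k ^ DIM('a)" for k
      using expectation_norm2_kop_Q_u(2)[OF e(1)[of k]] unfolding a_def by (simp only: mult_ac)
  qed
  have t5: "(\<lambda>k. s k * (LINT \<omega>|M. \<bar>b k \<omega> * n k \<omega>\<bar>)) \<longlonglongrightarrow> 0"
    unfolding s_def
  proof (rule scaled_CS_tendsto[OF e(1) b_sq _ _ n(1,2)])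
    let ?c = "sqrt (B\<^sup>2 * K * (measure N D * (2 * moment 6))) * sqrt (corr_mass * (B\<^sup>2 * K))"
    show "(LINT \<omega>|M. (b k \<omega>)\<^sup>2) \<le> measure N D * (?c * sqrt (e k ^ DIM('a)))" for k
      unfolding b_def by (rule expectation_norm2_Q_kop_Q_u(2)[OF e(1)])
    have "(\<lambda>k. measure N D * (?c * sqrt (1 * e k ^ DIM('a)))) \<longlonglongrightarrow> measure N D * (?c * sqrt 0)"
      by (intro tendsto_mult_left tendsto_real_sqrt epow)
    then show "(\<lambda>k. measure N D * (?c * sqrt (e k ^ DIM('a)))) \<longlonglongrightarrow> 0" by simp
  qed
  have t4: "(\<lambda>k. s k * (LINT \<omega>|M. \<bar>\<beta> k \<omega>\<bar>)) \<longlonglongrightarrow> 0"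
    using bil_small_all[OF e square_integrable_kernel] unfolding bil_small_def s_def \<beta>_def by blast
  have t2: "(\<lambda>k. LINT \<omega>|M. hk k \<omega>) \<longlonglongrightarrow> 0" using cut(2) unfolding hk_def s_def .
  have t6: "(\<lambda>k. LINT \<omega>|M. (l k \<omega> - \<Lambda>)\<^sup>2) \<longlonglongrightarrow> 0"
    by (rule Lim_null_comparison[OF always_eventually epow[of C]]) (use l(2) in auto)
  \<comment> \<open>The last summand exceeds 1 when \<open>l k \<omega>\<close> is farther than 1
    from \<Lambda>, and so dominates the minimum there. Otherwise
    \<open>\<bar>l k \<omega>\<bar> \<le> \<bar>\<Lambda>\<bar> + 1\<close>, the origin of
    \<open>c4\<close>; a product with three random factors is avoided in this way.\<close>
  define R where "R k \<omega> = s k * \<bar>(l k \<omega> - \<Lambda>) * n k \<omega>\<bar> + \<Lambda>\<^sup>2 * U * hk k \<omega> + \<bar>\<Lambda>\<bar> * (s k * \<bar>a k \<omega> * n k \<omega>\<bar>)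
    + c4 * (s k * \<bar>\<beta> k \<omega>\<bar>) + c4 * (s k * \<bar>b k \<omega> * n k \<omega>\<bar>) + (l k \<omega> - \<Lambda>)\<^sup>2" for k \<omega>
  have i1: "integrable M (\<lambda>\<omega>. \<bar>(l k \<omega> - \<Lambda>) * n k \<omega>\<bar>)" for k
    by (rule integrable_abs[OF square_integrable_mult_integrable[OF l(1) n(1)]])
  have i2: "integrable M (hk k)" for k
    unfolding hk_def[abs_def] using integrable_mult_indicator[OF cut(1) square_integrable_integrable[OF norm2_Q_square_integrable]] by simp
  have i3: "integrable M (\<lambda>\<omega>. \<bar>a k \<omega> * n k \<omega>\<bar>)" for k
    by (rule integrable_abs[OF square_integrable_mult_integrable[OF a_sq n(1)]])
  have i4: "integrable M (\<lambda>\<omega>. \<bar>\<beta> k \<omega>\<bar>)" for k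
    unfolding \<beta>_def by (rule integrable_abs[OF bil_bound(1)[OF square_integrable_kernel e(1)]])
  have i5: "integrable M (\<lambda>\<omega>. \<bar>b k \<omega> * n k \<omega>\<bar>)" for k
    by (rule integrable_abs[OF square_integrable_mult_integrable[OF b_sq n(1)]])
  have i6: "integrable M (\<lambda>\<omega>. (l k \<omega> - \<Lambda>)\<^sup>2)" for k by (rule square_integrable_power2[OF l(1)])
  have R_int: "integrable M (R k)" for k
    unfolding R_def[abs_def] by (intro Bochner_Integration.integrable_add integrable_mult_right i1 i2 i3 i4 i5 i6)
  have R_eq: "(LINT \<omega>|M. R k \<omega>) = s k * (LINT \<omega>|M. \<bar>(l k \<omega> - \<Lambda>) * n k \<omega>\<bar>) + \<Lambda>\<^sup>2 * U * (LINT \<omega>|M. hk k \<omega>)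
    + \<bar>\<Lambda>\<bar> * (s k * (LINT \<omega>|M. \<bar>a k \<omega> * n k \<omega>\<bar>)) + c4 * (s k * (LINT \<omega>|M. \<bar>\<beta> k \<omega>\<bar>))
    + c4 * (s k * (LINT \<omega>|M. \<bar>b k \<omega> * n k \<omega>\<bar>)) + (LINT \<omega>|M. (l k \<omega> - \<Lambda>)\<^sup>2)" for k
    unfolding R_def
    by (subst Bochner_Integration.integral_add,
        (intro Bochner_Integration.integrable_add integrable_mult_right i1 i2 i3 i4 i5 i6)+)+
      (simp only: integral_mult_right_zero)
  have "(\<lambda>k. LINT \<omega>|M. R k \<omega>) \<longlonglongrightarrow> 0 + \<Lambda>\<^sup>2 * U * 0 + \<bar>\<Lambda>\<bar> * 0 + c4 * 0 + c4 * 0 + 0"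
    unfolding R_eq by (intro tendsto_add tendsto_mult_left t1 t2 t3 t4 t5 t6)
  then have R_lim: "(\<lambda>k. LINT \<omega>|M. R k \<omega>) \<longlonglongrightarrow> 0" by simp
  have hk0: "0 \<le> hk k \<omega>" for k \<omega> by (simp add: hk_def)
  have U0: "0 \<le> U" by (simp add: U_def)
  have le: "AE \<omega> in M. min 1 \<bar>s k * (l k \<omega> - \<Lambda>) + \<Lambda>\<^sup>2 * fluct (e k) (\<lambda>x. (u x)\<^sup>2) \<omega>\<bar> \<le> R k \<omega>" for k
    using off[of k] on[of k] bil_kernel_AE[of "e k"] AE_square_integrable_Q[of "e k"]
  proof eventually_elim
    case (elim \<omega>)
    let ?d = "l k \<omega> - \<Lambda>" and ?Y = "osc (e k) (\<lambda>x. (u x)\<^sup>2) \<omega>"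
    have fl: "s k * ?d + \<Lambda>\<^sup>2 * fluct (e k) (\<lambda>x. (u x)\<^sup>2) \<omega> = s k * (?d + \<Lambda>\<^sup>2 * ?Y)"
      by (simp add: fluct_def s_def algebra_simps)
    have nk: "0 \<le> n k \<omega>" by (rule n(3))
    note pos = s[of k, THEN less_imp_le] c4 hk0[of k \<omega>] U0
    have nonneg: "0 \<le> s k * \<bar>?d * n k \<omega>\<bar>" "0 \<le> \<Lambda>\<^sup>2 * U * hk k \<omega>" "0 \<le> \<bar>\<Lambda>\<bar> * (s k * \<bar>a k \<omega> * n k \<omega>\<bar>)"
      "0 \<le> c4 * (s k * \<bar>\<beta> k \<omega>\<bar>)" "0 \<le> c4 * (s k * \<bar>b k \<omega> * n k \<omega>\<bar>)" "0 \<le> ?d\<^sup>2"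
      using pos by (auto intro!: mult_nonneg_nonneg)
    show ?case
    proof (cases "\<omega> \<in> A k")
      case True
      \<comment> \<open>[H3] controls exactly the norm that Cauchy-Schwarz in \<open>x\<close>
        leaves here.\<close>
      have "\<bar>s k * ?Y\<bar> \<le> U * hk k \<omega>"
      proof -
        have "s k * ?Y = (LINT x|N. (u x)\<^sup>2 * (s k * Q (e k) x \<omega>))"
          by (simp add: osc_def mult.left_commute)
        also have "\<bar>\<dots>\<bar> \<le> U * norm2 N (\<lambda>x. s k * Q (e k) x \<omega>)"
          unfolding U_def by (rule abs_integral_mult_le_norm2[OF usq square_integrable_cmult[OF elim(4)]])
        finally show ?thesis using True by (simp add: hk_def)
      qed
      then have y: "\<bar>\<Lambda>\<^sup>2 * (s k * ?Y)\<bar> \<le> \<Lambda>\<^sup>2 * U * hk k \<omega>"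
        unfolding abs_mult[of "\<Lambda>\<^sup>2"] mult.assoc by (simp add: mult_left_mono)
      \<comment> \<open>On the cutoff event the deviation of the eigenvalue is bounded by a product
        of two small factors, already a summand of \<open>R k\<close>.\<close>
      have "\<bar>?d\<bar> \<le> \<bar>?d * n k \<omega>\<bar>" using elim(2) True nk by (simp add: abs_mult)
      then have "s k * \<bar>?d\<bar> \<le> s k * \<bar>?d * n k \<omega>\<bar>" using pos by (intro mult_left_mono) auto
      then have x: "\<bar>s k * ?d\<bar> \<le> s k * \<bar>?d * n k \<omega>\<bar>" using pos by (simp add: abs_mult)
      have "\<bar>s k * (?d + \<Lambda>\<^sup>2 * ?Y)\<bar> \<le> \<bar>s k * ?d\<bar> + \<bar>\<Lambda>\<^sup>2 * (s k * ?Y)\<bar>"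
        using abs_triangle_ineq[of "s k * ?d" "\<Lambda>\<^sup>2 * (s k * ?Y)"] by (simp add: algebra_simps)
      then show ?thesis unfolding fl R_def using x y nonneg by linarith
    next
      case False
      show ?thesis
      proof (cases "\<bar>?d\<bar> \<le> 1")
        case True
        have "\<bar>l k \<omega>\<bar> \<le> \<bar>\<Lambda>\<bar> + 1" using True by linarith
        then have lc: "\<bar>l k \<omega>\<bar> * \<bar>\<Lambda>\<bar> \<le> c4" unfolding c4_def by (intro mult_right_mono) auto
        have "\<bar>?d + \<Lambda>\<^sup>2 * ?Y\<bar> \<le> \<bar>?d\<bar> * n k \<omega> + \<bar>\<Lambda>\<bar> * (a k \<omega> * n k \<omega>)
            + \<bar>l k \<omega>\<bar> * \<bar>\<Lambda>\<bar> * (\<bar>\<beta> k \<omega>\<bar> + b k \<omega> * n k \<omega>)"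
          using elim(1,3) False by (simp add: a_def b_def \<beta>_def)
        also have "\<dots> \<le> \<bar>?d\<bar> * n k \<omega> + \<bar>\<Lambda>\<bar> * (a k \<omega> * n k \<omega>) + c4 * (\<bar>\<beta> k \<omega>\<bar> + b k \<omega> * n k \<omega>)"
          using ab0 nk by (intro add_left_mono mult_right_mono lc) auto
        also have "\<dots> = \<bar>?d * n k \<omega>\<bar> + \<bar>\<Lambda>\<bar> * \<bar>a k \<omega> * n k \<omega>\<bar> + c4 * (\<bar>\<beta> k \<omega>\<bar> + \<bar>b k \<omega> * n k \<omega>\<bar>)"
          using ab0[of k \<omega>] nk by (simp add: abs_mult)
        finally have "s k * \<bar>?d + \<Lambda>\<^sup>2 * ?Y\<bar>
            \<le> s k * (\<bar>?d * n k \<omega>\<bar> + \<bar>\<Lambda>\<bar> * \<bar>a k \<omega> * n k \<omega>\<bar> + c4 * (\<bar>\<beta> k \<omega>\<bar> + \<bar>b k \<omega> * n k \<omega>\<bar>))"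
          using pos by (intro mult_left_mono) auto
        also have "\<dots> = s k * \<bar>?d * n k \<omega>\<bar> + \<bar>\<Lambda>\<bar> * (s k * \<bar>a k \<omega> * n k \<omega>\<bar>)
            + c4 * (s k * \<bar>\<beta> k \<omega>\<bar>) + c4 * (s k * \<bar>b k \<omega> * n k \<omega>\<bar>)"
          by (simp add: distrib_left mult.left_commute)
        finally have "\<bar>s k * (?d + \<Lambda>\<^sup>2 * ?Y)\<bar> \<le> s k * \<bar>?d * n k \<omega>\<bar> + \<bar>\<Lambda>\<bar> * (s k * \<bar>a k \<omega> * n k \<omega>\<bar>)
            + c4 * (s k * \<bar>\<beta> k \<omega>\<bar>) + c4 * (s k * \<bar>b k \<omega> * n k \<omega>\<bar>)"
          using pos by (simp add: abs_mult[of "s k"])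
        then show ?thesis unfolding fl R_def using nonneg by linarith
      next
        case False
        then have "1 \<le> ?d\<^sup>2" using abs_le_square_iff[of 1 ?d] by simp
        then show ?thesis unfolding R_def using nonneg by linarith
      qed
    qed
  qed
  show ?thesis
  proof (rule Lim_null_comparison[OF always_eventually R_lim])
    show "\<forall>k. norm (LINT \<omega>|M. min 1 \<bar>e k powr (- real DIM('a) / 2) * (l k \<omega> - \<Lambda>) + \<Lambda>\<^sup>2 * fluct (e k) (\<lambda>x. (u x)\<^sup>2) \<omega>\<bar>)
        \<le> (LINT \<omega>|M. R k \<omega>)"
    proof
      fix k
      have "(LINT \<omega>|M. min 1 \<bar>s k * (l k \<omega> - \<Lambda>) + \<Lambda>\<^sup>2 * fluct (e k) (\<lambda>x. (u x)\<^sup>2) \<omega>\<bar>) \<le> (LINT \<omega>|M. R k \<omega>)"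
      proof (rule integral_mono_AE[OF _ R_int le])
        have [measurable]: "(\<lambda>\<omega>. l k \<omega> - \<Lambda>) \<in> borel_measurable M" using l(1)[of k] by simp
        show "integrable M (\<lambda>\<omega>. min 1 \<bar>s k * (l k \<omega> - \<Lambda>) + \<Lambda>\<^sup>2 * fluct (e k) (\<lambda>x. (u x)\<^sup>2) \<omega>\<bar>)"
          by (rule integrable_const_bound[where B=1]) auto
      qed
      then show "norm (LINT \<omega>|M. min 1 \<bar>e k powr (- real DIM('a) / 2) * (l k \<omega> - \<Lambda>) + \<Lambda>\<^sup>2 * fluct (e k) (\<lambda>x. (u x)\<^sup>2) \<omega>\<bar>)
        \<le> (LINT \<omega>|M. R k \<omega>)"
        unfolding s_def by simp
    qed
  qed
qed

text \<open>With d = l - \<Lambda>, 1/l - 1/\<Lambda> = - d/\<Lambda>^2 + d^2/(l \<Lambda>^2). The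
  linear part is the quantity already treated; the quadratic part is of order eps^d in mean as long
  as l stays away from 0. Realisations with l far from \<Lambda> are paid for by Chebyshev's
  inequality. This includes l = 0, where \<open>inverse\<close> takes its default value.\<close>

lemma inverse_remainder_tendsto:
  fixes e :: "nat \<Rightarrow> real" and l :: "nat \<Rightarrow> 'w \<Rightarrow> real" and \<Lambda> C :: real
  assumes e: "\<And>k. 0 < e k" "e \<longlonglongrightarrow> 0" and \<Lambda>: "\<Lambda> \<noteq> 0"
    and l: "\<And>k. square_integrable M (\<lambda>\<omega>. l k \<omega> - \<Lambda>)" "\<And>k. (LINT \<omega>|M. (l k \<omega> - \<Lambda>)\<^sup>2) \<le> C * e k ^ DIM('a)"
    and lm: "\<And>k. l k \<in> borel_measurable M" and Y [measurable]: "\<And>k. Y k \<in> borel_measurable M"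
    and lim: "(\<lambda>k. LINT \<omega>|M. min 1 \<bar>e k powr (- real DIM('a) / 2) * (l k \<omega> - \<Lambda>) + \<Lambda>\<^sup>2 * Y k \<omega>\<bar>) \<longlonglongrightarrow> 0"
  shows "(\<lambda>k. LINT \<omega>|M. min 1 \<bar>e k powr (- real DIM('a) / 2) * (inverse (l k \<omega>) - inverse \<Lambda>) - Y k \<omega>\<bar>) \<longlonglongrightarrow> 0"
proof -
  define s where "s k = e k powr (- real DIM('a) / 2)" for k
  have s: "0 < s k" for k using e(1)[of k] by (simp add: s_def)
  note [measurable] = lm
  \<comment> \<open>\<open>c1\<close> comes from the lower bound
    \<open>\<bar>\<Lambda>\<bar> ^ 3 / 2\<close> of the denominator when l is within
    \<open>\<bar>\<Lambda>\<bar> / 2\<close> of \<Lambda>, \<open>c2\<close> from Chebyshev at that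
    distance, \<open>c3\<close> from pulling the division by \<open>\<Lambda>\<^sup>2\<close> out of
    the minimum.\<close>
  define c1 where "c1 = 2 / \<bar>\<Lambda>\<bar> ^ 3"
  define c2 where "c2 = 4 / \<Lambda>\<^sup>2"
  define c3 where "c3 = 1 + 1 / \<Lambda>\<^sup>2"
  have c: "0 \<le> c1" "0 \<le> c2" "0 \<le> c3" by (auto simp: c1_def c2_def c3_def)
  have pw: "(\<lambda>k. e k powr p) \<longlonglongrightarrow> 0" if "0 < p" for p
    by (rule tendsto_zero_powrI[OF e(2) tendsto_const]) (use that less_imp_le[OF e(1)] in auto)
  have le: "min 1 \<bar>s k * (inverse (l k \<omega>) - inverse \<Lambda>) - Y k \<omega>\<bar>
      \<le> (c1 * s k + c2) * (l k \<omega> - \<Lambda>)\<^sup>2 + c3 * min 1 \<bar>s k * (l k \<omega> - \<Lambda>) + \<Lambda>\<^sup>2 * Y k \<omega>\<bar>" for k \<omega>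
  proof -
    let ?d = "l k \<omega> - \<Lambda>" and ?z = "s k * (l k \<omega> - \<Lambda>) + \<Lambda>\<^sup>2 * Y k \<omega>"
    have mm: "min 1 \<bar>a - b\<bar> \<le> \<bar>a\<bar> + min 1 \<bar>b\<bar>" for a b :: real by (auto simp: min_def)
    have zz: "min 1 \<bar>?z / \<Lambda>\<^sup>2\<bar> \<le> c3 * min 1 \<bar>?z\<bar>"
    proof (cases "\<bar>?z\<bar> \<le> 1")
      case True
      have "\<bar>?z / \<Lambda>\<^sup>2\<bar> = 1 / \<Lambda>\<^sup>2 * \<bar>?z\<bar>" by (simp add: abs_divide)
      also have "\<dots> \<le> c3 * \<bar>?z\<bar>" unfolding c3_def by (rule mult_right_mono) auto
      finally show ?thesis using True by simp
    next
      case False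
      then have "c3 * min 1 \<bar>?z\<bar> = c3" by simp
      moreover have "min 1 \<bar>?z / \<Lambda>\<^sup>2\<bar> \<le> 1" "1 \<le> c3" by (simp_all add: c3_def)
      ultimately show ?thesis by linarith
    qed
    show ?thesis
    proof (cases "\<bar>?d\<bar> \<le> \<bar>\<Lambda>\<bar> / 2")
      case True
      then have lb: "\<bar>\<Lambda>\<bar> / 2 \<le> \<bar>l k \<omega>\<bar>" by linarith
      then have l0: "l k \<omega> \<noteq> 0" using \<Lambda> by auto
      have id: "s k * (inverse (l k \<omega>) - inverse \<Lambda>) - Y k \<omega> = s k * ?d\<^sup>2 / (l k \<omega> * \<Lambda>\<^sup>2) - ?z / \<Lambda>\<^sup>2"
        using l0 \<Lambda> by (simp add: field_simps power2_eq_square)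
      have "\<bar>\<Lambda>\<bar> ^ 3 / 2 \<le> \<bar>l k \<omega> * \<Lambda>\<^sup>2\<bar>"
        using mult_right_mono[OF lb, of "\<Lambda>\<^sup>2"] by (simp add: abs_mult power3_eq_cube power2_eq_square)
      then have "s k * ?d\<^sup>2 / \<bar>l k \<omega> * \<Lambda>\<^sup>2\<bar> \<le> s k * ?d\<^sup>2 / (\<bar>\<Lambda>\<bar> ^ 3 / 2)"
        using s[of k] \<Lambda> l0 by (intro divide_left_mono) (auto intro!: mult_nonneg_nonneg)
      then have 1: "\<bar>s k * ?d\<^sup>2 / (l k \<omega> * \<Lambda>\<^sup>2)\<bar> \<le> c1 * s k * ?d\<^sup>2"
        using s[of k] by (simp add: abs_divide abs_mult c1_def mult_ac)
      have "min 1 \<bar>s k * (inverse (l k \<omega>) - inverse \<Lambda>) - Y k \<omega>\<bar>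
          \<le> \<bar>s k * ?d\<^sup>2 / (l k \<omega> * \<Lambda>\<^sup>2)\<bar> + min 1 \<bar>?z / \<Lambda>\<^sup>2\<bar>"
        unfolding id by (rule mm)
      also have "\<dots> \<le> c1 * s k * ?d\<^sup>2 + c3 * min 1 \<bar>?z\<bar>" by (rule add_mono[OF 1 zz])
      also have "\<dots> \<le> (c1 * s k + c2) * ?d\<^sup>2 + c3 * min 1 \<bar>?z\<bar>"
        using c by (simp add: distrib_right)
      finally show ?thesis .
    next
      case False
      then have "(\<bar>\<Lambda>\<bar> / 2)\<^sup>2 \<le> \<bar>?d\<bar>\<^sup>2" by (intro power_mono) auto
      then have "1 \<le> c2 * ?d\<^sup>2" using \<Lambda> by (simp add: c2_def power_divide field_simps)
      moreover have "0 \<le> c1 * s k * ?d\<^sup>2" "0 \<le> c3 * min 1 \<bar>?z\<bar>" using c s[of k] by auto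
      ultimately show ?thesis by (simp add: distrib_right)
    qed
  qed
  have i1: "integrable M (\<lambda>\<omega>. (l k \<omega> - \<Lambda>)\<^sup>2)" for k by (rule square_integrable_power2[OF l(1)])
  have i2: "integrable M (\<lambda>\<omega>. min 1 \<bar>s k * (l k \<omega> - \<Lambda>) + \<Lambda>\<^sup>2 * Y k \<omega>\<bar>)" for k
    by (rule integrable_const_bound[where B=1]) auto
  have i3: "integrable M (\<lambda>\<omega>. min 1 \<bar>s k * (inverse (l k \<omega>) - inverse \<Lambda>) - Y k \<omega>\<bar>)" for k
    by (rule integrable_const_bound[where B=1]) auto
  have bnd: "(LINT \<omega>|M. min 1 \<bar>s k * (inverse (l k \<omega>) - inverse \<Lambda>) - Y k \<omega>\<bar>)
      \<le> (c1 * C * e k powr (real DIM('a) / 2) + c2 * C * e k powr (real DIM('a)))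
        + c3 * (LINT \<omega>|M. min 1 \<bar>s k * (l k \<omega> - \<Lambda>) + \<Lambda>\<^sup>2 * Y k \<omega>\<bar>)" for k
  proof -
    have pe: "s k * e k ^ DIM('a) = e k powr (real DIM('a) / 2)"
      unfolding s_def powr_realpow[OF e(1), symmetric] powr_add[symmetric] by simp
    have "(c1 * s k + c2) * (LINT \<omega>|M. (l k \<omega> - \<Lambda>)\<^sup>2) \<le> (c1 * s k + c2) * (C * e k ^ DIM('a))"
      using c s[of k] by (intro mult_left_mono l) auto
    also have "\<dots> = c1 * C * (s k * e k ^ DIM('a)) + c2 * C * e k ^ DIM('a)" by (simp add: algebra_simps)
    also have "\<dots> = c1 * C * e k powr (real DIM('a) / 2) + c2 * C * e k powr (real DIM('a))"
      unfolding pe powr_realpow[OF e(1)] ..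
    finally have 1: "(c1 * s k + c2) * (LINT \<omega>|M. (l k \<omega> - \<Lambda>)\<^sup>2)
        \<le> c1 * C * e k powr (real DIM('a) / 2) + c2 * C * e k powr (real DIM('a))" .
    have "(LINT \<omega>|M. min 1 \<bar>s k * (inverse (l k \<omega>) - inverse \<Lambda>) - Y k \<omega>\<bar>)
        \<le> (LINT \<omega>|M. (c1 * s k + c2) * (l k \<omega> - \<Lambda>)\<^sup>2 + c3 * min 1 \<bar>s k * (l k \<omega> - \<Lambda>) + \<Lambda>\<^sup>2 * Y k \<omega>\<bar>)"
      by (intro integral_mono i3 le Bochner_Integration.integrable_add integrable_mult_right i1 i2)
    also have "\<dots> = (c1 * s k + c2) * (LINT \<omega>|M. (l k \<omega> - \<Lambda>)\<^sup>2)
        + c3 * (LINT \<omega>|M. min 1 \<bar>s k * (l k \<omega> - \<Lambda>) + \<Lambda>\<^sup>2 * Y k \<omega>\<bar>)"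
      using i1 i2 by simp
    finally show ?thesis using 1 by linarith
  qed
  have "(\<lambda>k. (c1 * C * e k powr (real DIM('a) / 2) + c2 * C * e k powr (real DIM('a)))
        + c3 * (LINT \<omega>|M. min 1 \<bar>s k * (l k \<omega> - \<Lambda>) + \<Lambda>\<^sup>2 * Y k \<omega>\<bar>))
      \<longlonglongrightarrow> (c1 * C * 0 + c2 * C * 0) + c3 * 0"
    using lim unfolding s_def[symmetric] by (intro tendsto_add tendsto_mult_left pw) auto
  then have lim0: "(\<lambda>k. (c1 * C * e k powr (real DIM('a) / 2) + c2 * C * e k powr (real DIM('a)))
        + c3 * (LINT \<omega>|M. min 1 \<bar>s k * (l k \<omega> - \<Lambda>) + \<Lambda>\<^sup>2 * Y k \<omega>\<bar>)) \<longlonglongrightarrow> 0"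
    by simp
  have "norm (LINT \<omega>|M. min 1 \<bar>s k * (inverse (l k \<omega>) - inverse \<Lambda>) - Y k \<omega>\<bar>)
      = (LINT \<omega>|M. min 1 \<bar>s k * (inverse (l k \<omega>) - inverse \<Lambda>) - Y k \<omega>\<bar>)" for k
    unfolding real_norm_def by (intro abs_of_nonneg Bochner_Integration.integral_nonneg) simp
  then show ?thesis
    unfolding s_def[symmetric]
    by (intro Lim_null_comparison[OF always_eventually lim0] allI) (simp only: bnd)
qed

end

section \<open>Assembly: verification of the abstract hypotheses and identification of the
  limits\<close>

theorem mainTheorem5:
  fixes D :: "(real^'d) set"
    and m :: real and a :: "(real^'d) \<times> (real^'d) \<Rightarrow> complex"
    and Dom :: "(real^'d \<Rightarrow> real) set" and P :: "(real^'d \<Rightarrow> real) \<Rightarrow> real^'d \<Rightarrow> real"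
    and G :: "real^'d \<Rightarrow> real^'d \<Rightarrow> real"
    and M :: "'w measure" and q :: "real^'d \<Rightarrow> 'w \<Rightarrow> real"
    and \<rho> \<sigma> \<epsilon>0 :: real
    and \<Lambda> :: real and u :: "real^'d \<Rightarrow> real"
    and \<Lambda>e :: "real \<Rightarrow> 'w \<Rightarrow> real" and ue :: "real \<Rightarrow> 'w \<Rightarrow> real^'d \<Rightarrow> real"
    and N :: "'v measure" and W :: "(real^'d \<Rightarrow> real) \<Rightarrow> 'v \<Rightarrow> real"
  assumes dim: "1 \<le> CARD('d)" "CARD('d) \<le> 3"
    and domain: "open D" "bounded D" "smooth_boundary D"
    and operator: "elliptic_dirichlet_operator D m a Dom P"
    and green: "solution_operator D Dom P G" "admissible_kernel D G"
    and prob: "prob_space M"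
    and q_meas: "case_prod q \<in> borel_measurable (borel \<Otimes>\<^sub>M M)"
    and q_mean: "\<And>x. integrable M (q x)" "\<And>x. (LINT \<omega>|M. q x \<omega>) = 0"
    and q_stat: "strictly_stationary M q"
    and q_corr: "integrable lborel (correlation M q)"
    and q_moment: "\<And>x. integrable M (\<lambda>\<omega>. (q x \<omega>) ^ 6)"
    and q_mixing: "strongly_mixing M q"
    and rho: "0 < \<rho>" "\<rho> < 1"
    and eps0: "0 < \<epsilon>0"
    and cutoff: "\<And>\<epsilon>. 0 < \<epsilon> \<Longrightarrow> \<epsilon> < \<epsilon>0 \<Longrightarrow> cutoff_event M D G \<rho> q \<epsilon> \<in> sets M"
    and cutoff_moment: "((\<lambda>\<epsilon>. LINT \<omega>|M. indicator (cutoff_event M D G \<rho> q \<epsilon>) \<omega> *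
               L2_norm D (\<lambda>x. \<epsilon> powr (- real CARD('d) / 2) * scaled_potential q \<epsilon> \<omega> x))
             \<longlongrightarrow> 0) (at_right 0)"
    and sigma: "0 \<le> \<sigma>" "\<sigma>\<^sup>2 = (LINT y|lborel. correlation M q y)"
    and eigen: "\<Lambda> \<noteq> 0" "u \<in> L2 D" "continuous_on D u" "L2_norm D u = 1"
               "AE x in lborel_on D. green_op D G u x = \<Lambda> * u x"
    and eigen_meas: "\<And>\<epsilon>. 0 < \<epsilon> \<Longrightarrow> \<epsilon> < \<epsilon>0 \<Longrightarrow> \<Lambda>e \<epsilon> \<in> borel_measurable M"
               "\<And>\<epsilon>. 0 < \<epsilon> \<Longrightarrow> \<epsilon> < \<epsilon>0 \<Longrightarrow>
                  case_prod (ue \<epsilon>) \<in> borel_measurable (M \<Otimes>\<^sub>M lborel_on D)"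
    and eigen_eps: "\<And>\<epsilon>. 0 < \<epsilon> \<Longrightarrow> \<epsilon> < \<epsilon>0 \<Longrightarrow> AE \<omega> in M.
               ue \<epsilon> \<omega> \<in> L2 D \<and> L2_norm D (ue \<epsilon> \<omega>) = 1 \<and>
               (AE x in lborel_on D. perturbed_op D G (modified_potential M D G \<rho> q \<epsilon> \<omega>) (ue \<epsilon> \<omega>) x
                  = \<Lambda>e \<epsilon> \<omega> * ue \<epsilon> \<omega> x)"
    and labelling: "\<exists>C. \<forall>\<epsilon>. 0 < \<epsilon> \<and> \<epsilon> < \<epsilon>0 \<longrightarrow>
               (\<integral>\<^sup>+\<omega>. ennreal (\<bar>\<Lambda> - \<Lambda>e \<epsilon> \<omega>\<bar>\<^sup>2) \<partial>M)
               + (\<integral>\<^sup>+\<omega>. ennreal ((L2_norm D (\<lambda>x. ue \<epsilon> \<omega> x - u x))\<^sup>2) \<partial>M)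
               \<le> ennreal (C * \<epsilon> ^ CARD('d))"
    and noise: "prob_space N" "white_noise N W"
  shows "converges_in_distribution M
           (\<lambda>\<epsilon> \<omega>. (\<Lambda>e \<epsilon> \<omega> - \<Lambda>) / \<epsilon> powr (real CARD('d) / 2))
           N (\<lambda>w. - \<Lambda> * \<sigma> * wiener_integral2 W D (\<lambda>x y. u x * G x y * u y) w)
       \<and> (AE w in N. - \<Lambda> * \<sigma> * wiener_integral2 W D (\<lambda>x y. u x * G x y * u y) w
                   = - \<Lambda>\<^sup>2 * \<sigma> * wiener_integral W D (\<lambda>y. (u y)\<^sup>2) w)
       \<and> converges_in_distribution M
           (\<lambda>\<epsilon> \<omega>. (inverse (\<Lambda>e \<epsilon> \<omega>) - inverse \<Lambda>) / \<epsilon> powr (real CARD('d) / 2))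
           N (\<lambda>w. \<sigma> * wiener_integral W D (\<lambda>y. (u y)\<^sup>2) w)"
proof -
  let ?N = "lborel_on D"
  have D_borel: "D \<in> sets lborel" using domain(1) by simp
  have D_fin: "emeasure lborel D < \<infinity>" by (rule emeasure_bounded_finite[OF domain(2)])
  obtain K where sk: "symmetric_kernel (lborel_on D) G K"
    by (rule symmetric_kernel_admissible[OF green(2) D_borel D_fin])
  note kop_eq = iter_kop_green_op[OF sk]
  interpret M: prob_space M by (rule prob)
  interpret random_field M q
    by unfold_locales (rule q_meas q_mean(2) q_stat q_corr q_moment)+
  interpret mixing_field_on M q D
    by unfold_locales (rule D_borel D_fin q_mixing)+
  interpret SK: symmetric_kernel "lborel_on D" G K by (rule sk)
  have usq: "square_integrable ?N u" using eigen(2) by (simp add: L2_iff_square_integrable)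
  have u1: "norm2 ?N u = 1" using eigen(4) by (simp add: L2_norm_eq_norm2)
  have eig: "AE x in ?N. SK.kop u x = \<Lambda> * u x" using eigen(5) by (simp add: kop_eq)

  \<comment> \<open>From G u = \<Lambda> u and the bound \<open>sqrt K\<close> of the operator from
    L2 to bounded functions, for \<open>u\<close> of norm one.\<close>
  define B where "B = sqrt K / \<bar>\<Lambda>\<bar>"
  have B0: "0 \<le> B" using SK.K_nonneg by (simp add: B_def)
  have ub: "\<bar>u x\<bar> \<le> B" if x: "x \<in> D" for x
  proof -
    \<comment> \<open>The set where the bound fails is open by continuity of \<open>u\<close> and
      null by the eigenvalue equation, hence empty.\<close>
    let ?S = "D \<inter> u -` {y. B < \<bar>y\<bar>}"
    have "open {y::real. B < \<bar>y\<bar>}" by (intro open_Collect_less continuous_intros)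
    then have op: "open ?S" by (rule continuous_open_preimage[OF eigen(3) domain(1)])
    have "AE x in ?N. \<bar>u x\<bar> \<le> B"
      using eig AE_space
    proof eventually_elim
      case (elim x)
      have "\<bar>\<Lambda>\<bar> * \<bar>u x\<bar> \<le> sqrt K"
        using SK.kop_bound[OF usq elim(2)] u1 unfolding elim(1) abs_mult by simp
      then show ?case using eigen(1) by (simp add: B_def field_simps)
    qed
    then have "AE x in lborel. x \<in> D \<longrightarrow> \<bar>u x\<bar> \<le> B"
      using D_borel by (subst (asm) AE_restrict_space_iff) auto
    then have "AE x in lborel. x \<notin> ?S" by eventually_elim auto
    from open_AE_lborel_empty[OF op this] x show ?thesis by force
  qed
  interpret kernel_field M q D G K u B
    by unfold_locales (use usq ub B0 in auto)

  define f where "f x = (u x)\<^sup>2" for x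
  have fm: "f \<in> borel_measurable ?N" unfolding f_def[abs_def] using usq by measurable
  have fb: "\<forall>x\<in>D. \<bar>f x\<bar> \<le> B\<^sup>2"
    using ub power_mono[of "\<bar>u _\<bar>" B 2] by (auto simp: f_def)
  have fc: "continuous_on D f" unfolding f_def[abs_def] by (intro continuous_intros eigen)
  have fsq: "square_integrable ?N f" by (rule square_integrable_f[OF fm fb]) simp

  obtain C where C: "\<And>\<epsilon>. 0 < \<epsilon> \<Longrightarrow> \<epsilon> < \<epsilon>0 \<Longrightarrow> (\<integral>\<^sup>+\<omega>. ennreal (\<bar>\<Lambda> - \<Lambda>e \<epsilon> \<omega>\<bar>\<^sup>2) \<partial>M)
      + (\<integral>\<^sup>+\<omega>. ennreal ((L2_norm D (\<lambda>x. ue \<epsilon> \<omega> x - u x))\<^sup>2) \<partial>M) \<le> ennreal (C * \<epsilon> ^ CARD('d))"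
    using labelling by blast
  \<comment> \<open>\<open>ennreal\<close> truncates negative numbers to 0, so the sign of
    \<open>C\<close> is not known; the maximum yields a valid real inequality.\<close>
  define C' where "C' = max 0 C"
  define n where "n \<epsilon> \<omega> = norm2 ?N (\<lambda>x. ue \<epsilon> \<omega> x - u x)" for \<epsilon> \<omega>
  have second_moment: "square_integrable M h \<and> (LINT \<omega>|M. (h \<omega>)\<^sup>2) \<le> C' * \<epsilon> ^ DIM(real^'d)"
    if \<epsilon>: "0 < \<epsilon>" and hm: "h \<in> borel_measurable M"
      and le: "(\<integral>\<^sup>+\<omega>. ennreal ((h \<omega>)\<^sup>2) \<partial>M) \<le> ennreal (C * \<epsilon> ^ CARD('d))" for h \<epsilon>
  proof -
    have "C * \<epsilon> ^ CARD('d) \<le> C' * \<epsilon> ^ CARD('d)" using \<epsilon> by (intro mult_right_mono) (auto simp: C'_def)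
    with le have le': "(\<integral>\<^sup>+\<omega>. ennreal ((h \<omega>)\<^sup>2) \<partial>M) \<le> ennreal (C' * \<epsilon> ^ CARD('d))"
      by (meson ennreal_leI order_trans)
    have i: "integrable M (\<lambda>\<omega>. (h \<omega>)\<^sup>2)"
    proof (rule integrableI_bounded)
      have "(\<integral>\<^sup>+\<omega>. ennreal (norm ((h \<omega>)\<^sup>2)) \<partial>M) \<le> ennreal (C' * \<epsilon> ^ CARD('d))" using le' by simp
      then show "(\<integral>\<^sup>+\<omega>. ennreal (norm ((h \<omega>)\<^sup>2)) \<partial>M) < \<infinity>" by (rule le_less_trans) simp
    qed (use hm in measurable)
    have "ennreal (LINT \<omega>|M. (h \<omega>)\<^sup>2) \<le> ennreal (C' * \<epsilon> ^ CARD('d))"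
      using le' by (subst nn_integral_eq_integral[OF i, symmetric]) auto
    then have "(LINT \<omega>|M. (h \<omega>)\<^sup>2) \<le> C' * \<epsilon> ^ CARD('d)"
      using \<epsilon> by (subst (asm) ennreal_le_iff) (auto simp: C'_def)
    then show ?thesis using i hm by (simp add: square_integrable_def)
  qed
  have l: "square_integrable M (\<lambda>\<omega>. \<Lambda>e \<epsilon> \<omega> - \<Lambda>)" "(LINT \<omega>|M. (\<Lambda>e \<epsilon> \<omega> - \<Lambda>)\<^sup>2) \<le> C' * \<epsilon> ^ DIM(real^'d)"
    if \<epsilon>: "0 < \<epsilon>" "\<epsilon> < \<epsilon>0" for \<epsilon>
  proof -
    have "(\<integral>\<^sup>+\<omega>. ennreal ((\<Lambda>e \<epsilon> \<omega> - \<Lambda>)\<^sup>2) \<partial>M) \<le> ennreal (C * \<epsilon> ^ CARD('d))"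
      using order_trans[OF add_increasing2[OF zero_le order_refl] C[OF \<epsilon>]] by (simp add: power2_commute)
    then show "square_integrable M (\<lambda>\<omega>. \<Lambda>e \<epsilon> \<omega> - \<Lambda>)" "(LINT \<omega>|M. (\<Lambda>e \<epsilon> \<omega> - \<Lambda>)\<^sup>2) \<le> C' * \<epsilon> ^ DIM(real^'d)"
      using second_moment[OF \<epsilon>(1), of "\<lambda>\<omega>. \<Lambda>e \<epsilon> \<omega> - \<Lambda>"] eigen_meas(1)[OF \<epsilon>] by auto
  qed
  have n: "square_integrable M (n \<epsilon>)" "(LINT \<omega>|M. (n \<epsilon> \<omega>)\<^sup>2) \<le> C' * \<epsilon> ^ DIM(real^'d)"
    if \<epsilon>: "0 < \<epsilon>" "\<epsilon> < \<epsilon>0" for \<epsilon>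
  proof -
    have 1: "(\<lambda>p. case_prod (ue \<epsilon>) p) \<in> borel_measurable (M \<Otimes>\<^sub>M ?N)" using eigen_meas(2)[OF \<epsilon>] .
    have 2: "(\<lambda>p. u (snd p)) \<in> borel_measurable (M \<Otimes>\<^sub>M ?N)" by measurable
    have "(\<lambda>(\<omega>, x). (ue \<epsilon> \<omega> x - u x)\<^sup>2) \<in> borel_measurable (M \<Otimes>\<^sub>M ?N)"
      using borel_measurable_power[OF borel_measurable_diff[OF 1 2], of 2] by (simp add: case_prod_beta')
    then have "(\<lambda>\<omega>. LINT x|?N. (ue \<epsilon> \<omega> x - u x)\<^sup>2) \<in> borel_measurable M"
      by (rule N.borel_measurable_lebesgue_integral)
    then have nm: "n \<epsilon> \<in> borel_measurable M" unfolding n_def[abs_def] norm2_def by measurable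
    have "(\<integral>\<^sup>+\<omega>. ennreal ((n \<epsilon> \<omega>)\<^sup>2) \<partial>M) \<le> ennreal (C * \<epsilon> ^ CARD('d))"
      unfolding n_def L2_norm_eq_norm2[symmetric]
      by (rule order_trans[OF add_increasing[OF zero_le order_refl] C[OF \<epsilon>]])
    then show "square_integrable M (n \<epsilon>)" "(LINT \<omega>|M. (n \<epsilon> \<omega>)\<^sup>2) \<le> C' * \<epsilon> ^ DIM(real^'d)"
      using second_moment[OF \<epsilon>(1) nm] by auto
  qed

  let ?A = "cutoff_event M D G \<rho> q"
  have expansion: "AE \<omega> in M.
      (\<omega> \<notin> ?A \<epsilon> \<longrightarrow>
        \<bar>(\<Lambda>e \<epsilon> \<omega> - \<Lambda>) + \<Lambda>\<^sup>2 * osc \<epsilon> (\<lambda>x. (u x)\<^sup>2) \<omega>\<bar> \<le> \<bar>\<Lambda>e \<epsilon> \<omega> - \<Lambda>\<bar> * n \<epsilon> \<omega>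
          + \<bar>\<Lambda>\<bar> * (norm2 ?N (SK.kop (\<lambda>y. Q \<epsilon> y \<omega> * u y)) * n \<epsilon> \<omega>)
          + \<bar>\<Lambda>e \<epsilon> \<omega>\<bar> * \<bar>\<Lambda>\<bar> * (\<bar>quad \<epsilon> \<omega>\<bar>
              + norm2 ?N (\<lambda>x. Q \<epsilon> x \<omega> * SK.kop (\<lambda>y. Q \<epsilon> y \<omega> * u y) x) * n \<epsilon> \<omega>)) \<and>
      (\<omega> \<in> ?A \<epsilon> \<longrightarrow> \<bar>\<Lambda>e \<epsilon> \<omega> - \<Lambda>\<bar> \<le> \<bar>\<Lambda>e \<epsilon> \<omega> - \<Lambda>\<bar> * n \<epsilon> \<omega>)"
    if \<epsilon>: "0 < \<epsilon>" "\<epsilon> < \<epsilon>0" for \<epsilon>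
    using eigen_eps[OF \<epsilon>] AE_square_integrable_Q[of \<epsilon>] AE_space
  proof eventually_elim
    case (elim \<omega>)
    define V where "V = modified_potential M D G \<rho> q \<epsilon> \<omega>"
    define v where "v = ue \<epsilon> \<omega>"
    define w where "w = perturbed_op D G V v"
    have v: "square_integrable ?N v" and v1: "norm2 ?N v = 1" and wv: "AE x in ?N. w x = \<Lambda>e \<epsilon> \<omega> * v x"
      using elim(1) by (auto simp: v_def w_def V_def L2_iff_square_integrable L2_norm_eq_norm2)
    have Vsq: "square_integrable ?N V" and ex: "\<exists>w. perturbed_solution D G V v w"
    proof -
      show Vsq: "square_integrable ?N V"
        unfolding V_def modified_potential_def[abs_def] using elim(2)
        by (cases "\<omega> \<in> ?A \<epsilon>") (auto simp: square_integrable_def)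
      show "\<exists>w. perturbed_solution D G V v w"
      proof (cases "\<omega> \<in> ?A \<epsilon>")
        case True
        then have "V = (\<lambda>_. 0)" by (simp add: V_def modified_potential_def fun_eq_iff)
        \<comment> \<open>With zero potential both correction terms vanish and the unperturbed
          solution solves the equation. Off the cutoff event the operator norm is at most \<rho> < 1
          and the Neumann series converges.\<close>
        then have "perturbed_solution D G V v (green_op D G v)"
          using SK.square_integrable_kop[OF v]
          by (simp add: perturbed_solution_def L2_iff_square_integrable kop_eq(1) green_op_def)
        then show ?thesis by blast
      next
        case False
        then have "V = scaled_potential q \<epsilon> \<omega>" by (simp add: V_def modified_potential_def fun_eq_iff)
        then have "L2_opnorm D (\<lambda>f. green_op D G (\<lambda>x. V x * green_op D G (\<lambda>y. V y * f y) x)) \<le> ennreal \<rho>"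
          using False elim(3) by (simp add: cutoff_event_def not_less)
        also have "\<dots> < 1" using rho by (simp add: ennreal_less_one_iff)
        finally show ?thesis
          using Vsq v by (intro perturbed_solution_exists[OF sk]) (auto simp: L2_iff_square_integrable)
      qed
    qed
    have "perturbed_solution D G V v w"
      unfolding w_def perturbed_op_def by (rule someI_ex[OF ex])
    then have w: "square_integrable ?N w"
      and eq: "AE x in ?N. w x = SK.kop v x - SK.kop (\<lambda>y. V y * SK.kop v y) x + SK.iter_kop V w x"
      by (auto simp: perturbed_solution_def L2_iff_square_integrable kop_eq)
    note main = SK.eigenvalue_expansion[OF Vsq usq u_bound_AE eig u1 v v1 w wv eq]
    show ?case
    proof (intro conjI impI)
      assume "\<omega> \<notin> ?A \<epsilon>"
      then have "V = scaled_potential q \<epsilon> \<omega>" by (simp add: V_def modified_potential_def fun_eq_iff)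
      then show "\<bar>(\<Lambda>e \<epsilon> \<omega> - \<Lambda>) + \<Lambda>\<^sup>2 * osc \<epsilon> (\<lambda>x. (u x)\<^sup>2) \<omega>\<bar> \<le> \<bar>\<Lambda>e \<epsilon> \<omega> - \<Lambda>\<bar> * n \<epsilon> \<omega>
          + \<bar>\<Lambda>\<bar> * (norm2 ?N (SK.kop (\<lambda>y. Q \<epsilon> y \<omega> * u y)) * n \<epsilon> \<omega>)
          + \<bar>\<Lambda>e \<epsilon> \<omega>\<bar> * \<bar>\<Lambda>\<bar> * (\<bar>quad \<epsilon> \<omega>\<bar>
              + norm2 ?N (\<lambda>x. Q \<epsilon> x \<omega> * SK.kop (\<lambda>y. Q \<epsilon> y \<omega> * u y) x) * n \<epsilon> \<omega>)"
        using main unfolding osc_def quad_def n_def v_def by simp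
    next
      assume "\<omega> \<in> ?A \<epsilon>"
      \<comment> \<open>With \<open>V = 0\<close> every term of the expansion vanishes except the
        two that compare \<Lambda> with its perturbation.\<close>
      then have "V = (\<lambda>_. 0)" by (simp add: V_def modified_potential_def fun_eq_iff)
      then show "\<bar>\<Lambda>e \<epsilon> \<omega> - \<Lambda>\<bar> \<le> \<bar>\<Lambda>e \<epsilon> \<omega> - \<Lambda>\<bar> * n \<epsilon> \<omega>"
        using main by (simp add: n_def v_def SK.kop_def norm2_def)
    qed
  qed

  define X where "X \<epsilon> \<omega> = \<epsilon> powr (- real DIM(real^'d) / 2) * (\<Lambda>e \<epsilon> \<omega> - \<Lambda>)" for \<epsilon> \<omega>
  define X' where "X' \<epsilon> \<omega> = \<epsilon> powr (- real DIM(real^'d) / 2) * (inverse (\<Lambda>e \<epsilon> \<omega>) - inverse \<Lambda>)" for \<epsilon> \<omega>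
  define Y where "Y \<epsilon> = fluct \<epsilon> f" for \<epsilon>
  have Ym: "Y \<epsilon> \<in> borel_measurable M" for \<epsilon> unfolding Y_def by (rule fluct_measurable[OF fm])
  have close: "(\<lambda>k. LINT \<omega>|M. min 1 \<bar>X (e k) \<omega> - (- \<Lambda>\<^sup>2) * Y (e k) \<omega>\<bar>) \<longlonglongrightarrow> 0"
    if e: "\<And>k. 0 < e k" "\<And>k. e k < \<epsilon>0" "e \<longlonglongrightarrow> 0" for e
  proof -
    have e_at: "filterlim e (at_right 0) sequentially"
      unfolding filterlim_at using e(3) e(1)[THEN less_imp_neq, symmetric] e(1) by (auto intro!: always_eventually)
    have H3: "(\<lambda>k. LINT \<omega>|M. indicator (?A (e k)) \<omega> * norm2 ?N (\<lambda>x. e k powr (- real DIM(real^'d) / 2) * Q (e k) x \<omega>)) \<longlonglongrightarrow> 0"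
      using filterlim_compose[OF cutoff_moment e_at] by (simp add: L2_norm_eq_norm2)
    have ex: "AE \<omega> in M. \<omega> \<notin> ?A (e k) \<longrightarrow>
        \<bar>(\<Lambda>e (e k) \<omega> - \<Lambda>) + \<Lambda>\<^sup>2 * osc (e k) (\<lambda>x. (u x)\<^sup>2) \<omega>\<bar> \<le> \<bar>\<Lambda>e (e k) \<omega> - \<Lambda>\<bar> * n (e k) \<omega>
          + \<bar>\<Lambda>\<bar> * (norm2 ?N (SK.kop (\<lambda>y. Q (e k) y \<omega> * u y)) * n (e k) \<omega>)
          + \<bar>\<Lambda>e (e k) \<omega>\<bar> * \<bar>\<Lambda>\<bar> * (\<bar>quad (e k) \<omega>\<bar>
              + norm2 ?N (\<lambda>x. Q (e k) x \<omega> * SK.kop (\<lambda>y. Q (e k) y \<omega> * u y) x) * n (e k) \<omega>)"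
      "AE \<omega> in M. \<omega> \<in> ?A (e k) \<longrightarrow> \<bar>\<Lambda>e (e k) \<omega> - \<Lambda>\<bar> \<le> \<bar>\<Lambda>e (e k) \<omega> - \<Lambda>\<bar> * n (e k) \<omega>" for k
      using expansion[OF e(1) e(2), of k] by (eventually_elim, blast)+
    have n0: "0 \<le> n \<epsilon> \<omega>" for \<epsilon> \<omega> by (simp add: n_def)
    have "(\<lambda>k. LINT \<omega>|M. min 1 \<bar>e k powr (- real DIM(real^'d) / 2) * (\<Lambda>e (e k) \<omega> - \<Lambda>)
        + \<Lambda>\<^sup>2 * fluct (e k) (\<lambda>x. (u x)\<^sup>2) \<omega>\<bar>) \<longlonglongrightarrow> 0"
      by (rule eigenvalue_remainder_tendsto[OF e(1,3) l[OF e(1,2)] n[OF e(1,2)] n0 cutoff[OF e(1,2)] H3 ex])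
    then show ?thesis by (simp add: X_def Y_def f_def[abs_def])
  qed
  have close': "(\<lambda>k. LINT \<omega>|M. min 1 \<bar>X' (e k) \<omega> - 1 * Y (e k) \<omega>\<bar>) \<longlonglongrightarrow> 0"
    if e: "\<And>k. 0 < e k" "\<And>k. e k < \<epsilon>0" "e \<longlonglongrightarrow> 0" for e
    using inverse_remainder_tendsto[OF e(1,3) eigen(1) l[OF e(1,2)] eigen_meas(1)[OF e(1,2)] Ym, of "\<lambda>k. e k"]
      close[OF e] by (simp add: X_def X'_def)
  \<comment> \<open>The limiting variance of \<open>Y\<close>; \<open>f\<close> is the square of
    \<open>u\<close>.\<close>
  define \<nu> where "\<nu> = \<sigma>\<^sup>2 * (norm2 ?N f)\<^sup>2"
  have clt: "(\<lambda>k. LINT \<omega>|M. iexp (t * Y (e k) \<omega>)) \<longlonglongrightarrow> of_real (exp (- \<nu> * t\<^sup>2 / 2))"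
    if e: "\<And>k. 0 < e k" "\<And>k. e k < \<epsilon>0" "e \<longlonglongrightarrow> 0" for e t
    using char_fluct_tendsto[OF fm fb _ domain(1) fc e(1,3), of t]
    by (simp add: Y_def \<nu>_def sigma(2) norm2_power2)

  \<comment> \<open>Zero extensions of the integrands of the two Wiener integrals. Symmetry of
    \<open>G\<close> and the eigenvalue equation give \<open>f1 = \<Lambda> * f2\<close> almost
    everywhere, the source of the equality of the two limits.\<close>
  define f2 where "f2 y = indicator D y * (u y)\<^sup>2" for y
  define f1 where "f1 y = indicator D y * (LINT x|?N. u x * G x y * u y)" for y
  have ext_sq: "square_integrable lborel (\<lambda>y. indicator D y * h y)"
    and ext_norm: "norm2 lborel (\<lambda>y. indicator D y * h y) = norm2 ?N h" if h: "square_integrable ?N h" for h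
  proof -
    have e: "(indicator D y * h y)\<^sup>2 = indicator D y * (h y)\<^sup>2" for y by (simp add: indicator_def)
    have m: "(\<lambda>y. indicator D y * h y) \<in> borel_measurable lborel"
      using square_integrable_measurable[OF h] D_borel
      by (subst (asm) borel_measurable_restrict_space_iff) (auto simp: mult.commute)
    have "integrable lborel (\<lambda>y. indicator D y * (h y)\<^sup>2)"
      using square_integrable_power2[OF h] D_borel by (subst (asm) integrable_restrict_space) auto
    then show "square_integrable lborel (\<lambda>y. indicator D y * h y)"
      using m by (simp add: square_integrable_def e)
    have "(LINT y|?N. (h y)\<^sup>2) = (LINT y|lborel. indicator D y * (h y)\<^sup>2)"
      using D_borel by (subst integral_restrict_space) auto
    then show "norm2 lborel (\<lambda>y. indicator D y * h y) = norm2 ?N h" by (simp add: norm2_def e)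
  qed
  have f2_L2: "f2 \<in> L2 UNIV" and f2_norm: "norm2 lborel f2 = norm2 ?N f"
    using ext_sq[OF fsq] ext_norm[OF fsq] by (simp_all add: L2_UNIV_iff f2_def[abs_def] f_def[abs_def])
  have inner: "(LINT x|?N. u x * G x y * u y) = u y * SK.kop u y" if "y \<in> D" for y
  proof -
    have "(LINT x|?N. u x * G x y * u y) = (LINT x|?N. u y * (G y x * u x))"
    proof (rule Bochner_Integration.integral_cong[OF refl])
      fix x assume "x \<in> space ?N"
      then show "u x * G x y * u y = u y * (G y x * u x)" using SK.G_sym[of x y] that by simp
    qed
    then show ?thesis by (simp add: SK.kop_def)
  qed
  have f1_alt: "f1 = (\<lambda>y. indicator D y * (u y * SK.kop u y))"
    using inner by (auto simp: f1_def indicator_def)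
  have uk: "square_integrable ?N (\<lambda>y. u y * SK.kop u y)"
    by (rule SK.square_integrable_mult_kop[OF usq usq])
  have f1_L2: "f1 \<in> L2 UNIV" unfolding f1_alt L2_UNIV_iff by (rule ext_sq[OF uk])
  have f12: "AE y in lborel. f1 y = \<Lambda> * f2 y"
  proof -
    have "AE y in lborel. y \<in> D \<longrightarrow> SK.kop u y = \<Lambda> * u y"
      using eig D_borel by (subst (asm) AE_restrict_space_iff) auto
    then show ?thesis
      by eventually_elim (auto simp: f1_alt f2_def indicator_def power2_eq_square)
  qed
  have Wi2: "wiener_integral2 W D (\<lambda>x y. u x * G x y * u y) = W f1"
    by (simp add: wiener_integral2_def wiener_integral_def f1_def[abs_def])
  have Wi: "wiener_integral W D (\<lambda>y. (u y)\<^sup>2) = W f2"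
    by (simp add: wiener_integral_def f2_def[abs_def])
  have f1_norm: "norm2 lborel f1 = \<bar>\<Lambda>\<bar> * norm2 ?N f"
  proof -
    have "norm2 lborel f1 = norm2 lborel (\<lambda>y. \<Lambda> * f2 y)"
      by (rule norm2_cong_AE[OF _ _ f12]) (use f1_L2 f2_L2 in \<open>auto simp: L2_UNIV_iff square_integrable_def\<close>)
    then show ?thesis by (simp add: norm2_cmult f2_norm)
  qed
  have W_eq: "AE w in N. W f1 w = \<Lambda> * W f2 w"
    by (rule white_noise_scale_AE[OF noise(2) f1_L2 f2_L2 f12])
  have Xm: "X \<epsilon> \<in> borel_measurable M" "X' \<epsilon> \<in> borel_measurable M" if "0 < \<epsilon>" "\<epsilon> < \<epsilon>0" for \<epsilon>
    unfolding X_def[abs_def] X'_def[abs_def] using eigen_meas(1)[OF that] by measurable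
  have X_eq: "(\<lambda>\<epsilon> \<omega>. (\<Lambda>e \<epsilon> \<omega> - \<Lambda>) / \<epsilon> powr (real CARD('d) / 2)) = X"
    "(\<lambda>\<epsilon> \<omega>. (inverse (\<Lambda>e \<epsilon> \<omega>) - inverse \<Lambda>) / \<epsilon> powr (real CARD('d) / 2)) = X'"
    by (auto simp: fun_eq_iff X_def X'_def powr_minus_divide)
  \<comment> \<open>Both sides are the fourth power of \<Lambda> times \<nu>: one factor \<Lambda>
    stands in front, the other is hidden in \<open>f1\<close>. Signs disappear because the limit is
    a centred Gaussian.\<close>
  have s1: "(\<bar>- \<Lambda> * \<sigma>\<bar> * norm2 lborel f1)\<^sup>2 = (- \<Lambda>\<^sup>2)\<^sup>2 * \<nu>"
    unfolding f1_norm \<nu>_def by (simp add: power_mult_distrib power2_eq_square mult_ac)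
  have s2: "(\<bar>\<sigma>\<bar> * norm2 lborel f2)\<^sup>2 = 1\<^sup>2 * \<nu>"
    unfolding f2_norm \<nu>_def by (simp add: power_mult_distrib)
  show ?thesis
    unfolding Wi Wi2 X_eq
  proof (intro conjI)
    show "converges_in_distribution M X N (\<lambda>w. - \<Lambda> * \<sigma> * W f1 w)"
      by (rule M.converges_in_distribution_perturb[OF eps0 Xm(1) Ym clt close
            white_noise_law(1)[OF noise(2) f1_L2] _ s1]) simp_all
    show "AE w in N. - \<Lambda> * \<sigma> * W f1 w = - \<Lambda>\<^sup>2 * \<sigma> * W f2 w"
      using W_eq by eventually_elim (simp add: power2_eq_square)
    show "converges_in_distribution M X' N (\<lambda>w. \<sigma> * W f2 w)"
      by (rule M.converges_in_distribution_perturb[OF eps0 Xm(2) Ym clt close'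
            white_noise_law(1)[OF noise(2) f2_L2] _ s2]) simp_all
  qed
qed

end
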